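(* Over $\mathsf{RCA}_0$ the following five statements are pairwise equivalent: (1) $\mathrm{WPO}(\mathcal{D})$; (2) there is no infinite ascending sequence of upwardly closed sets of diagrams; (3) there is no infinite ascending sequence of finitely generated, upwardly closed sets of diagrams; (4) every upwardly closed set of diagrams is finitely generated; (5) every upwardly closed sequence of diagrams is finitely generated.
   Context: $\mathbb{N}$ denotes the positive integers; $\mathsf{RCA}_0$ is the standard base system of second-order arithmetic. A diagram (Young diagram) is a partition $m_1\ge\cdots\ge m_k>0$ with $k>0$, viewed as left-justified rows of boxes; $\mathcal{D}$ is the set of diagrams; $r_i(D)$ is the length of the $i$th row (0 if none). $D\le E$ means $r_i(D)\le r_i(E)$ for all $i$. $\mathrm{WPO}(\mathcal{D})$ states that for every infinite sequence $\langle D_i\rangle_{i\in\mathbb{N}}$ of diagrams there are $i<j$ with $D_i\le D_j$. A set $\mathcal{U}$ of diagrams is upwardly closed if $D\in\mathcal{U}$ and $D\le E$ imply $E\in\mathcal{U}$. For a finite set $\mathcal{S}$ of diagrams, $\mathrm{ucl}(\mathcal{S})=\{E:\exists D\in\mathcal{S},\ D\le E\}$; an upwardly closed set is finitely generated if it equals $\mathrm{ucl}(\mathcal{S})$ for some finite $\mathcal{S}$. A sequence $\langle D_i\rangle_{i\in\mathbb{N}}$ of diagrams is upwardly closed if $\forall i\,\forall E\,(D_i\le E\Rightarrow\exists j\,(D_j=E))$, and finitely generated if there is a finite set $\mathcal{S}$ with $\forall E\,(E\in\mathrm{ucl}(\mathcal{S})\iff\exists j\,(D_j=E))$. An infinite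 ascending sequence of sets is a sequence $\langle\mathcal{U}_i\rangle_{i\in\mathbb{N}}$ with $\mathcal{U}_i\subsetneq\mathcal{U}_j$ for $i<j$. *)

theory Defs
  imports Main
begin

section \<open>The language of second-order arithmetic\<close>

text \<open>
  Number variables and set variables are named by natural numbers, independently of each other.
  As usual, equality is primitive for numbers only; all connectives are reduced to falsity and
  implication, and the existential quantifiers to the universal ones.
\<close>

datatype tm = Var nat | Zero | One | Add tm tm | Mul tm tm

datatype fm =
    Fls
  | Eq tm tm      (infix "\<^bold>=" 55)
  | Less tm tm    (infix "\<^bold><" 55)
  | Mem tm nat    (infix "\<^bold>\<in>" 55)
  | Imp fm fm     (infixr "\<^bold>\<longrightarrow>" 25)
  | AllN nat fm
  | AllS nat fm

abbreviation Neg :: "fm \<Rightarrow> fm" ("\<^bold>\<not> _" [40] 40)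
  where "\<^bold>\<not> p \<equiv> p \<^bold>\<longrightarrow> Fls"

abbreviation Disj :: "fm \<Rightarrow> fm \<Rightarrow> fm" (infixr "\<^bold>\<or>" 30)
  where "p \<^bold>\<or> q \<equiv> \<^bold>\<not> p \<^bold>\<longrightarrow> q"

abbreviation Conj :: "fm \<Rightarrow> fm \<Rightarrow> fm" (infixr "\<^bold>\<and>" 35)
  where "p \<^bold>\<and> q \<equiv> \<^bold>\<not> (p \<^bold>\<longrightarrow> \<^bold>\<not> q)"

abbreviation Iff :: "fm \<Rightarrow> fm \<Rightarrow> fm" (infix "\<^bold>\<longleftrightarrow>" 24)
  where "p \<^bold>\<longleftrightarrow> q \<equiv> (p \<^bold>\<longrightarrow> q) \<^bold>\<and> (q \<^bold>\<longrightarrow> p)"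

abbreviation ExN :: "nat \<Rightarrow> fm \<Rightarrow> fm"
  where "ExN x p \<equiv> \<^bold>\<not> AllN x (\<^bold>\<not> p)"

abbreviation ExS :: "nat \<Rightarrow> fm \<Rightarrow> fm"
  where "ExS X p \<equiv> \<^bold>\<not> AllS X (\<^bold>\<not> p)"

primrec vars :: "tm \<Rightarrow> nat set" where
  "vars (Var x) = {x}"
| "vars Zero = {}"
| "vars One = {}"
| "vars (Add s t) = vars s \<union> vars t"
| "vars (Mul s t) = vars s \<union> vars t"

text \<open>Free number variables and free set variables.\<close>

primrec fv :: "fm \<Rightarrow> nat set" where
  "fv Fls = {}"
| "fv (s \<^bold>= t) = vars s \<union> vars t"
| "fv (s \<^bold>< t) = vars s \<union> vars t"
| "fv (t \<^bold>\<in> X) = vars t"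
| "fv (p \<^bold>\<longrightarrow> q) = fv p \<union> fv q"
| "fv (AllN x p) = fv p - {x}"
| "fv (AllS X p) = fv p"

primrec fsv :: "fm \<Rightarrow> nat set" where
  "fsv Fls = {}"
| "fsv (s \<^bold>= t) = {}"
| "fsv (s \<^bold>< t) = {}"
| "fsv (t \<^bold>\<in> X) = {X}"
| "fsv (p \<^bold>\<longrightarrow> q) = fsv p \<union> fsv q"
| "fsv (AllN x p) = fsv p"
| "fsv (AllS X p) = fsv p - {X}"

text \<open>
  Replacement of the free occurrences of a variable. It does not rename bound variables; the
  side conditions \<open>free_for\<close> and \<open>free_forS\<close> say that no variable gets captured.
\<close>

primrec subst_tm :: "nat \<Rightarrow> tm \<Rightarrow> tm \<Rightarrow> tm" where
  "subst_tm x t (Var y) = (if y = x then t else Var y)"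
| "subst_tm x t Zero = Zero"
| "subst_tm x t One = One"
| "subst_tm x t (Add u v) = Add (subst_tm x t u) (subst_tm x t v)"
| "subst_tm x t (Mul u v) = Mul (subst_tm x t u) (subst_tm x t v)"

primrec subst :: "nat \<Rightarrow> tm \<Rightarrow> fm \<Rightarrow> fm" where
  "subst x t Fls = Fls"
| "subst x t (u \<^bold>= v) = (subst_tm x t u \<^bold>= subst_tm x t v)"
| "subst x t (u \<^bold>< v) = (subst_tm x t u \<^bold>< subst_tm x t v)"
| "subst x t (u \<^bold>\<in> X) = (subst_tm x t u \<^bold>\<in> X)"
| "subst x t (p \<^bold>\<longrightarrow> q) = (subst x t p \<^bold>\<longrightarrow> subst x t q)"
| "subst x t (AllN y p) = AllN y (if y = x then p else subst x t p)"
| "subst x t (AllS Y p) = AllS Y (subst x t p)"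

primrec free_for :: "tm \<Rightarrow> nat \<Rightarrow> fm \<Rightarrow> bool" where
  "free_for t x Fls \<longleftrightarrow> True"
| "free_for t x (u \<^bold>= v) \<longleftrightarrow> True"
| "free_for t x (u \<^bold>< v) \<longleftrightarrow> True"
| "free_for t x (u \<^bold>\<in> X) \<longleftrightarrow> True"
| "free_for t x (p \<^bold>\<longrightarrow> q) \<longleftrightarrow> free_for t x p \<and> free_for t x q"
| "free_for t x (AllN y p) \<longleftrightarrow> x \<notin> fv (AllN y p) \<or> y \<notin> vars t \<and> free_for t x p"
| "free_for t x (AllS Y p) \<longleftrightarrow> free_for t x p"

primrec substS :: "nat \<Rightarrow> nat \<Rightarrow> fm \<Rightarrow> fm" where
  "substS X Y Fls = Fls"
| "substS X Y (u \<^bold>= v) = (u \<^bold>= v)"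
| "substS X Y (u \<^bold>< v) = (u \<^bold>< v)"
| "substS X Y (u \<^bold>\<in> Z) = (u \<^bold>\<in> (if Z = X then Y else Z))"
| "substS X Y (p \<^bold>\<longrightarrow> q) = (substS X Y p \<^bold>\<longrightarrow> substS X Y q)"
| "substS X Y (AllN z p) = AllN z (substS X Y p)"
| "substS X Y (AllS Z p) = AllS Z (if Z = X then p else substS X Y p)"

primrec free_forS :: "nat \<Rightarrow> nat \<Rightarrow> fm \<Rightarrow> bool" where
  "free_forS Y X Fls \<longleftrightarrow> True"
| "free_forS Y X (u \<^bold>= v) \<longleftrightarrow> True"
| "free_forS Y X (u \<^bold>< v) \<longleftrightarrow> True"
| "free_forS Y X (u \<^bold>\<in> Z) \<longleftrightarrow> True"
| "free_forS Y X (p \<^bold>\<longrightarrow> q) \<longleftrightarrow> free_forS Y X p \<and> free_forS Y X q"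
| "free_forS Y X (AllN z p) \<longleftrightarrow> free_forS Y X p"
| "free_forS Y X (AllS Z p) \<longleftrightarrow> X \<notin> fsv (AllS Z p) \<or> Z \<noteq> Y \<and> free_forS Y X p"


section \<open>Derivability\<close>

text \<open>
  The usual Hilbert calculus of two-sorted classical first-order logic with equality. Formulas
  of \<open>T\<close> may have free variables; by the generalization rules they act as their universal
  closures.
\<close>

inductive derivable :: "fm set \<Rightarrow> fm \<Rightarrow> bool" (infix "\<turnstile>" 20) for T :: "fm set" where
  Ax: "p \<in> T \<Longrightarrow> T \<turnstile> p"
| K: "T \<turnstile> p \<^bold>\<longrightarrow> q \<^bold>\<longrightarrow> p"
| S: "T \<turnstile> (p \<^bold>\<longrightarrow> q \<^bold>\<longrightarrow> r) \<^bold>\<longrightarrow> (p \<^bold>\<longrightarrow> q) \<^bold>\<longrightarrow> p \<^bold>\<longrightarrow> r"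
| DN: "T \<turnstile> \<^bold>\<not> \<^bold>\<not> p \<^bold>\<longrightarrow> p"
| Inst: "free_for t x p \<Longrightarrow> T \<turnstile> AllN x p \<^bold>\<longrightarrow> subst x t p"
| Distr: "x \<notin> fv p \<Longrightarrow> T \<turnstile> AllN x (p \<^bold>\<longrightarrow> q) \<^bold>\<longrightarrow> p \<^bold>\<longrightarrow> AllN x q"
| InstS: "free_forS Y X p \<Longrightarrow> T \<turnstile> AllS X p \<^bold>\<longrightarrow> substS X Y p"
| DistrS: "X \<notin> fsv p \<Longrightarrow> T \<turnstile> AllS X (p \<^bold>\<longrightarrow> q) \<^bold>\<longrightarrow> p \<^bold>\<longrightarrow> AllS X q"
| Refl: "T \<turnstile> t \<^bold>= t"
| Leibniz: "free_for s x p \<Longrightarrow> free_for t x p \<Longrightarrow> T \<turnstile> s \<^bold>= t \<^bold>\<longrightarrow> subst x s p \<^bold>\<longrightarrow> subst x t p"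
| MP: "T \<turnstile> p \<^bold>\<longrightarrow> q \<Longrightarrow> T \<turnstile> p \<Longrightarrow> T \<turnstile> q"
| Gen: "T \<turnstile> p \<Longrightarrow> T \<turnstile> AllN x p"
| GenS: "T \<turnstile> p \<Longrightarrow> T \<turnstile> AllS X p"


section \<open>Writing formulas without choosing bound variables\<close>

text \<open>
  \<open>\<^bold>\<forall>x. p x\<close> is \<open>AllN n (p (Var n))\<close> for some \<open>n\<close> not free in \<open>p Zero\<close>. If \<open>p\<close> is a formula
  schema, that is, \<open>p t\<close> arises from a fixed formula by putting the term \<open>t\<close> in some places,
  then \<open>n\<close> is different from all other free variables, so nothing is captured.
\<close>

definition fresh :: "fm \<Rightarrow> nat"
  where "fresh p = Suc (Max (insert 0 (fv p)))"

definition AllH :: "(tm \<Rightarrow> fm) \<Rightarrow> fm" (binder "\<^bold>\<forall>" 10)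
  where "AllH p = AllN (fresh (p Zero)) (p (Var (fresh (p Zero))))"

abbreviation ExH :: "(tm \<Rightarrow> fm) \<Rightarrow> fm" (binder "\<^bold>\<exists>" 10)
  where "ExH p \<equiv> \<^bold>\<not> (\<^bold>\<forall>x. \<^bold>\<not> p x)"


section \<open>The axioms of $\mathsf{RCA}_0$\<close>

abbreviation suc :: "tm \<Rightarrow> tm"
  where "suc t \<equiv> Add t One"

abbreviation Leq :: "tm \<Rightarrow> tm \<Rightarrow> fm" (infix "\<^bold>\<le>" 55)
  where "s \<^bold>\<le> t \<equiv> s \<^bold>< t \<^bold>\<or> s \<^bold>= t"

inductive_set Delta00 :: "fm set" where
  "Fls \<in> Delta00"
| "(s \<^bold>= t) \<in> Delta00"
| "(s \<^bold>< t) \<in> Delta00"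
| "(t \<^bold>\<in> X) \<in> Delta00"
| "p \<in> Delta00 \<Longrightarrow> q \<in> Delta00 \<Longrightarrow> (p \<^bold>\<longrightarrow> q) \<in> Delta00"
| "p \<in> Delta00 \<Longrightarrow> x \<notin> vars t \<Longrightarrow> AllN x (Var x \<^bold>< t \<^bold>\<longrightarrow> p) \<in> Delta00"
| "p \<in> Delta00 \<Longrightarrow> x \<notin> vars t \<Longrightarrow> ExN x (Var x \<^bold>< t \<^bold>\<and> p) \<in> Delta00"

definition Sigma01 :: "fm set"
  where "Sigma01 = {ExN x p | x p. p \<in> Delta00}"

definition Pi01 :: "fm set"
  where "Pi01 = {AllN x p | x p. p \<in> Delta00}"

definition basic_axioms :: "fm set" where
  "basic_axioms =
    {\<^bold>\<forall>n. \<^bold>\<not> suc n \<^bold>= Zero,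
     \<^bold>\<forall>m n. suc m \<^bold>= suc n \<^bold>\<longrightarrow> m \<^bold>= n,
     \<^bold>\<forall>m. Add m Zero \<^bold>= m,
     \<^bold>\<forall>m n. Add m (suc n) \<^bold>= suc (Add m n),
     \<^bold>\<forall>m. Mul m Zero \<^bold>= Zero,
     \<^bold>\<forall>m n. Mul m (suc n) \<^bold>= Add (Mul m n) m,
     \<^bold>\<forall>m. \<^bold>\<not> m \<^bold>< Zero,
     \<^bold>\<forall>m n. m \<^bold>< suc n \<^bold>\<longleftrightarrow> m \<^bold>\<le> n}"

text \<open>
  The formulas in the two schemes may have further free number and set variables (parameters).
  Substituting \<open>suc (Var x)\<close> for \<open>x\<close> never captures a variable.
\<close>

definition Sigma01_induction :: "fm set" where
  "Sigma01_induction =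
    {subst x Zero p \<^bold>\<and> AllN x (p \<^bold>\<longrightarrow> subst x (suc (Var x)) p) \<^bold>\<longrightarrow> AllN x p | x p. p \<in> Sigma01}"

definition Delta01_comprehension :: "fm set" where
  "Delta01_comprehension =
    {AllN x (p \<^bold>\<longleftrightarrow> q) \<^bold>\<longrightarrow> ExS X (AllN x (Var x \<^bold>\<in> X \<^bold>\<longleftrightarrow> p)) | x p q X.
      p \<in> Sigma01 \<and> q \<in> Pi01 \<and> X \<notin> fsv p}"

definition RCA0 :: "fm set"
  where "RCA0 = basic_axioms \<union> Sigma01_induction \<union> Delta01_comprehension"


section \<open>Coding in second-order arithmetic\<close>

text \<open>
  Pairs, finite sets and finite sequences of numbers are coded as in Simpson's
  \<^emph>\<open>Subsystems of Second Order Arithmetic\<close>, Section II.2: the pair of \<open>i\<close> and \<open>j\<close> is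
  $(i+j)^2+i$, and the code of a finite set is the least triple $(k,(m,n))$ such that the
  elements are those $i<k$ for which $m(i+1)+1$ divides $n$.
\<close>

definition pr :: "tm \<Rightarrow> tm \<Rightarrow> tm"
  where "pr s t = Add (Mul (Add s t) (Add s t)) s"

definition dvd_fm :: "tm \<Rightarrow> tm \<Rightarrow> fm"
  where "dvd_fm s t = (\<^bold>\<exists>q. t \<^bold>= Mul s q)"

definition triple :: "tm \<Rightarrow> fm"
  where "triple c = (\<^bold>\<exists>k m n. c \<^bold>= pr k (pr m n))"

definition in_fin :: "tm \<Rightarrow> tm \<Rightarrow> fm" where
  "in_fin i c =
    (\<^bold>\<exists>k m n. c \<^bold>= pr k (pr m n) \<^bold>\<and> i \<^bold>< k \<^bold>\<and> dvd_fm (suc (Mul m (suc i))) n)"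

definition fin_code :: "tm \<Rightarrow> fm" where
  "fin_code c =
    (triple c \<^bold>\<and>
     \<^bold>\<not> (\<^bold>\<exists>c'. c' \<^bold>< c \<^bold>\<and> triple c' \<^bold>\<and> (\<^bold>\<forall>i. in_fin i c' \<^bold>\<longleftrightarrow> in_fin i c)))"

text \<open>Finite sequences are finite functions whose domain is an initial segment.\<close>

definition seq_code :: "tm \<Rightarrow> fm" where
  "seq_code s =
    (fin_code s \<^bold>\<and>
     (\<^bold>\<forall>n. in_fin n s \<^bold>\<longrightarrow> (\<^bold>\<exists>i j. n \<^bold>= pr i j)) \<^bold>\<and>
     (\<^bold>\<forall>i j j'. in_fin (pr i j) s \<^bold>\<and> in_fin (pr i j') s \<^bold>\<longrightarrow> j \<^bold>= j') \<^bold>\<and>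
     (\<^bold>\<exists>l. \<^bold>\<forall>i. i \<^bold>< l \<^bold>\<longleftrightarrow> (\<^bold>\<exists>j. in_fin (pr i j) s)))"


section \<open>Diagrams\<close>

text \<open>
  A diagram is coded by the sequence of its row lengths, the rows being counted from $0$.
  Since codes of finite sequences are unique, equality of diagrams is equality of codes.
\<close>

definition diagram :: "tm \<Rightarrow> fm" where
  "diagram d =
    (seq_code d \<^bold>\<and>
     (\<^bold>\<exists>a. in_fin (pr Zero a) d) \<^bold>\<and>
     (\<^bold>\<forall>i a. in_fin (pr i a) d \<^bold>\<longrightarrow> Zero \<^bold>< a) \<^bold>\<and>
     (\<^bold>\<forall>i a b. in_fin (pr i a) d \<^bold>\<and> in_fin (pr (suc i) b) d \<^bold>\<longrightarrow> b \<^bold>\<le> a))"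

definition row :: "tm \<Rightarrow> tm \<Rightarrow> tm \<Rightarrow> fm" where
  "row d i r =
    (in_fin (pr i r) d \<^bold>\<or> \<^bold>\<not> (\<^bold>\<exists>a. in_fin (pr i a) d) \<^bold>\<and> r \<^bold>= Zero)"

definition le_diagram :: "tm \<Rightarrow> tm \<Rightarrow> fm" where
  "le_diagram d e = (\<^bold>\<forall>i a b. row d i a \<^bold>\<and> row e i b \<^bold>\<longrightarrow> a \<^bold>\<le> b)"

text \<open>
  Collections of diagrams are given by formula schemas \<open>P\<close>, so that the following notions apply
  to sets, to members of sequences of sets, and to ranges of sequences of diagrams. The generating
  finite set is given by its code.
\<close>

definition upwardly_closed :: "(tm \<Rightarrow> fm) \<Rightarrow> fm" where
  "upwardly_closed P =
    ((\<^bold>\<forall>d. P d \<^bold>\<longrightarrow> diagram d) \<^bold>\<and>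
     (\<^bold>\<forall>d e. P d \<^bold>\<and> diagram e \<^bold>\<and> le_diagram d e \<^bold>\<longrightarrow> P e))"

definition in_ucl :: "tm \<Rightarrow> tm \<Rightarrow> fm" where
  "in_ucl e s = (diagram e \<^bold>\<and> (\<^bold>\<exists>d. in_fin d s \<^bold>\<and> le_diagram d e))"

definition finitely_generated :: "(tm \<Rightarrow> fm) \<Rightarrow> fm" where
  "finitely_generated P =
    (\<^bold>\<exists>s. fin_code s \<^bold>\<and> (\<^bold>\<forall>d. in_fin d s \<^bold>\<longrightarrow> diagram d) \<^bold>\<and> (\<^bold>\<forall>e. in_ucl e s \<^bold>\<longleftrightarrow> P e))"

definition strict_subset :: "(tm \<Rightarrow> fm) \<Rightarrow> (tm \<Rightarrow> fm) \<Rightarrow> fm" where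
  "strict_subset P Q = ((\<^bold>\<forall>d. P d \<^bold>\<longrightarrow> Q d) \<^bold>\<and> (\<^bold>\<exists>d. Q d \<^bold>\<and> \<^bold>\<not> P d))"

text \<open>
  A sequence of diagrams is a function, given as a set of pairs. A set \<open>U\<close> is regarded as the
  sequence of its sections $U_i = \{d : (d,i) \in U\}$.
\<close>

definition diagram_seq :: "nat \<Rightarrow> fm" where
  "diagram_seq F =
    ((\<^bold>\<forall>n. n \<^bold>\<in> F \<^bold>\<longrightarrow> (\<^bold>\<exists>i d. diagram d \<^bold>\<and> n \<^bold>= pr i d)) \<^bold>\<and>
     (\<^bold>\<forall>i. \<^bold>\<exists>d. pr i d \<^bold>\<in> F) \<^bold>\<and>
     (\<^bold>\<forall>i d e. pr i d \<^bold>\<in> F \<^bold>\<and> pr i e \<^bold>\<in> F \<^bold>\<longrightarrow> d \<^bold>= e))"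

definition range_seq :: "nat \<Rightarrow> tm \<Rightarrow> fm"
  where "range_seq F e = (\<^bold>\<exists>j. pr j e \<^bold>\<in> F)"

definition upwardly_closed_seq :: "nat \<Rightarrow> fm" where
  "upwardly_closed_seq F =
    (\<^bold>\<forall>i d e. pr i d \<^bold>\<in> F \<^bold>\<and> diagram e \<^bold>\<and> le_diagram d e \<^bold>\<longrightarrow> range_seq F e)"

definition member_of :: "nat \<Rightarrow> tm \<Rightarrow> fm"
  where "member_of U d = (d \<^bold>\<in> U)"

definition set_at :: "nat \<Rightarrow> tm \<Rightarrow> tm \<Rightarrow> fm"
  where "set_at U i d = (pr d i \<^bold>\<in> U)"

definition ascending :: "nat \<Rightarrow> fm" where
  "ascending U = (\<^bold>\<forall>i j. i \<^bold>< j \<^bold>\<longrightarrow> strict_subset (set_at U i) (set_at U j))"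


section \<open>The five statements\<close>

definition WPO_diagrams :: fm where
  "WPO_diagrams =
    AllS 0 (diagram_seq 0 \<^bold>\<longrightarrow>
      (\<^bold>\<exists>i j d e. i \<^bold>< j \<^bold>\<and> pr i d \<^bold>\<in> 0 \<^bold>\<and> pr j e \<^bold>\<in> 0 \<^bold>\<and> le_diagram d e))"

definition ACC_upwardly_closed :: fm where
  "ACC_upwardly_closed =
    (\<^bold>\<not> ExS 0 ((\<^bold>\<forall>i. upwardly_closed (set_at 0 i)) \<^bold>\<and> ascending 0))"

definition ACC_finitely_generated :: fm where
  "ACC_finitely_generated =
    (\<^bold>\<not> ExS 0 ((\<^bold>\<forall>i. finitely_generated (set_at 0 i) \<^bold>\<and> upwardly_closed (set_at 0 i)) \<^bold>\<and>
      ascending 0))"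

definition upwardly_closed_sets_fg :: fm where
  "upwardly_closed_sets_fg =
    AllS 0 (upwardly_closed (member_of 0) \<^bold>\<longrightarrow> finitely_generated (member_of 0))"

definition upwardly_closed_seqs_fg :: fm where
  "upwardly_closed_seqs_fg =
    AllS 0 (diagram_seq 0 \<^bold>\<and> upwardly_closed_seq 0 \<^bold>\<longrightarrow> finitely_generated (range_seq 0))"

end

theory Submission
  imports Defs "HOL-Library.Countable_Set"
begin

text \<open>
  By completeness of the calculus it suffices to prove the equivalences in an arbitrary countable
  model of $\mathsf{RCA}_0$, whose numbers satisfy the axioms of discretely ordered semirings and
  whose finite sets can be coded with Goedel's $\beta$ function. There the implications are
  (1) to (2) to (3) to (1) and (1) to (5) to (4) to (1).

  For (1) to (5), let \<open>V\<close> be the set of those \<open>n\<close> for which the \<open>n\<close>th diagram lies above no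
  earlier one. The diagrams with index in \<open>V\<close> generate the range. If \<open>V\<close> is bounded, they form a
  finite set; otherwise the increasing enumeration of \<open>V\<close>, obtained by primitive recursion,
  contradicts (1). For (4) to (1), the upward closure of a sequence without a good pair is only
  $\Sigma^0_1$. One therefore restricts the sequence to the indices at which a new largest element
  appears in the code of the diagram: a diagram \<open>E\<close> lies above none of the later ones once the
  largest element exceeds \<open>E\<close>, which makes the closure $\Delta^0_1$, but it is not finitely generated.
\<close>

text \<open>The obstacle throughout is the weak comprehension: to form a set, its complement needs
  an \<open>S1\<close> definition as well. What helps is that a sequence \<open>F\<close> is total
  and single-valued, so the negation of \<open>\<exists>d. pair n d \<in> F \<and> P d\<close> is
  \<open>\<exists>d. pair n d \<in> F \<and> \<not> P d\<close>, again with an existential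
  quantifier, and such quantifiers survive bounded universal ones by collection. An upward closure
  quantifies over all indices, where this device stops; hence the detour in (4) to (1). Its size
  measure looks at the elements of a code: on one side \<open>LeD d e\<close> passes a bound from
  \<open>e\<close> down to \<open>d\<close> because \<open>pair\<close> is monotone, on the other
  side the codes with all elements below a given number are themselves bounded. That the elements
  get arbitrarily large in a sequence without a good pair is then a pigeonhole principle, which has
  to be proved inside the model, with divisibility in place of counting.\<close>

section \<open>Completeness of the calculus\<close>

lemma imp_refl: "T \<turnstile> p \<^bold>\<longrightarrow> p"
  using derivable.MP[OF derivable.MP[OF derivable.S derivable.K] derivable.K] .

lemma imp_trans:
  assumes "T \<turnstile> p \<^bold>\<longrightarrow> q" "T \<turnstile> q \<^bold>\<longrightarrow> r" shows "T \<turnstile> p \<^bold>\<longrightarrow> r"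
  using derivable.MP[OF derivable.MP[OF derivable.S derivable.MP[OF derivable.K assms(2)]] assms(1)] .

text \<open>Derivability from \<open>T\<close> and hypotheses \<open>G\<close> whose free variables are treated as constants.\<close>

inductive from_hyps :: "fm set \<Rightarrow> fm set \<Rightarrow> fm \<Rightarrow> bool" for T G where
  hyp: "p \<in> G \<Longrightarrow> from_hyps T G p"
| theorem_of: "T \<turnstile> p \<Longrightarrow> from_hyps T G p"
| mp: "from_hyps T G (p \<^bold>\<longrightarrow> q) \<Longrightarrow> from_hyps T G p \<Longrightarrow> from_hyps T G q"

lemma from_hyps_mono:
  assumes "from_hyps T G p" "G \<subseteq> H" shows "from_hyps T H p"
  using assms by induction (auto intro: from_hyps.intros)

text \<open>Compactness, which carries consistency from the finite stages of the Henkin construction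
  to their union.\<close>

lemma from_hyps_finite:
  "from_hyps T G p \<Longrightarrow> \<exists>H\<subseteq>G. finite H \<and> from_hyps T H p"
proof (induction rule: from_hyps.induct)
  case (hyp p)
  then show ?case by (intro exI[of _ "{p}"]) (auto intro: from_hyps.hyp)
next
  case (theorem_of p)
  then show ?case by (intro exI[of _ "{}"]) (auto intro: from_hyps.theorem_of)
next
  case (mp p q)
  then obtain H1 H2 where "H1 \<subseteq> G" "finite H1" "from_hyps T H1 (p \<^bold>\<longrightarrow> q)"
    "H2 \<subseteq> G" "finite H2" "from_hyps T H2 p" by blast
  then show ?case
    by (intro exI[of _ "H1 \<union> H2"]) (auto intro: from_hyps.mp from_hyps_mono)
qed

text \<open>Free variables need no side condition here because \<open>from_hyps\<close> has no
  generalization rule; generalization is only available inside theorems of \<open>T\<close>.\<close>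

lemma deduction: "from_hyps T (insert a G) p \<Longrightarrow> from_hyps T G (a \<^bold>\<longrightarrow> p)"
proof (induction rule: from_hyps.induct)
  case (hyp p)
  then show ?case
    by (auto intro: from_hyps.theorem_of imp_refl from_hyps.mp[OF from_hyps.theorem_of[OF derivable.K]] from_hyps.hyp)
next
  case (theorem_of p)
  then show ?case by (rule from_hyps.mp[OF from_hyps.theorem_of[OF derivable.K] from_hyps.theorem_of])
next
  case (mp p q)
  show ?case by (rule from_hyps.mp[OF from_hyps.mp[OF from_hyps.theorem_of[OF derivable.S]]]) fact+
qed

lemma from_hyps_empty: "from_hyps T {} p \<longleftrightarrow> (T \<turnstile> p)"
proof
  show "from_hyps T {} p \<Longrightarrow> T \<turnstile> p"
    by (induction rule: from_hyps.induct) (auto intro: derivable.MP)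
qed (rule from_hyps.theorem_of)

lemma from_hyps_cut: "from_hyps T G a \<Longrightarrow> from_hyps T (insert a G) p \<Longrightarrow> from_hyps T G p"
  by (rule from_hyps.mp[OF deduction])

lemma from_hyps_ccontr: "from_hyps T (insert (\<^bold>\<not> p) G) Fls \<Longrightarrow> from_hyps T G p"
  by (rule from_hyps.mp[OF from_hyps.theorem_of[OF derivable.DN] deduction])

lemma from_hyps_exfalso: "from_hyps T G Fls \<Longrightarrow> from_hyps T G p"
  by (rule from_hyps_ccontr) (auto intro: from_hyps_mono)

lemma from_hyps_iff: "from_hyps T G (p \<^bold>\<longleftrightarrow> q)" if "from_hyps T G (p \<^bold>\<longrightarrow> q)" "from_hyps T G (q \<^bold>\<longrightarrow> p)"
\<comment> \<open>The conjunction of the two directions is the negation of an implication, so the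
  deduction theorem assumes that implication and derives falsity.\<close>
proof (rule deduction)
  have "from_hyps T (insert ((p \<^bold>\<longrightarrow> q) \<^bold>\<longrightarrow> \<^bold>\<not> (q \<^bold>\<longrightarrow> p)) G) (\<^bold>\<not> (q \<^bold>\<longrightarrow> p))"
    by (rule from_hyps.mp[of _ _ "p \<^bold>\<longrightarrow> q"]) (use that in \<open>auto intro: from_hyps.hyp from_hyps_mono\<close>)
  then show "from_hyps T (insert ((p \<^bold>\<longrightarrow> q) \<^bold>\<longrightarrow> \<^bold>\<not> (q \<^bold>\<longrightarrow> p)) G) Fls"
    by (rule from_hyps.mp) (use that in \<open>auto intro: from_hyps_mono\<close>)
qed


subsection \<open>Substitution\<close>

lemma subst_tm_self [simp]: "subst_tm x (Var x) t = t"
  by (induction t) auto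

lemma subst_self [simp]: "subst x (Var x) p = p"
  by (induction p) auto

lemma free_for_self [simp]: "free_for (Var x) x p"
  by (induction p) auto

lemma substS_self [simp]: "substS X X p = p"
  by (induction p) auto

lemma free_forS_self [simp]: "free_forS X X p"
  by (induction p) auto

text \<open>Bound variables count too: a variable outside this set can be substituted without
  capture, and the substitution can be undone.\<close>

primrec all_vars :: "fm \<Rightarrow> nat set" where
  "all_vars Fls = {}"
| "all_vars (s \<^bold>= t) = vars s \<union> vars t"
| "all_vars (s \<^bold>< t) = vars s \<union> vars t"
| "all_vars (t \<^bold>\<in> X) = vars t"
| "all_vars (p \<^bold>\<longrightarrow> q) = all_vars p \<union> all_vars q"
| "all_vars (AllN x p) = insert x (all_vars p)"
| "all_vars (AllS X p) = all_vars p"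

primrec all_svars :: "fm \<Rightarrow> nat set" where
  "all_svars Fls = {}"
| "all_svars (s \<^bold>= t) = {}"
| "all_svars (s \<^bold>< t) = {}"
| "all_svars (t \<^bold>\<in> X) = {X}"
| "all_svars (p \<^bold>\<longrightarrow> q) = all_svars p \<union> all_svars q"
| "all_svars (AllN x p) = all_svars p"
| "all_svars (AllS X p) = insert X (all_svars p)"

lemma finite_vars [simp]: "finite (vars t)"
  by (induction t) auto

lemma finite_fv [simp]: "finite (fv p)"
  by (induction p) auto

lemma finite_fsv [simp]: "finite (fsv p)"
  by (induction p) auto

lemma finite_all_vars [simp]: "finite (all_vars p)"
  by (induction p) auto

lemma finite_all_svars [simp]: "finite (all_svars p)"
  by (induction p) auto

lemma not_fv_if_not_all_vars [simp]: "x \<notin> all_vars p \<Longrightarrow> x \<notin> fv p"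
  by (induction p) auto

lemma not_fsv_if_not_all_svars [simp]: "X \<notin> all_svars p \<Longrightarrow> X \<notin> fsv p"
  by (induction p) auto

lemma subst_tm_idle: "x \<notin> vars t \<Longrightarrow> subst_tm x u t = t"
  by (induction t) auto

lemma subst_idle: "x \<notin> fv p \<Longrightarrow> subst x u p = p"
  by (induction p) (auto simp: subst_tm_idle)

lemma substS_idle: "X \<notin> fsv p \<Longrightarrow> substS X Y p = p"
  by (induction p) auto

lemma vars_subst_tm: "vars (subst_tm x u t) \<subseteq> (vars t - {x}) \<union> vars u"
  by (induction t) auto

lemma fv_subst: "fv (subst x u p) \<subseteq> (fv p - {x}) \<union> vars u"
  by (induction p) (auto dest: subsetD[OF vars_subst_tm])

lemma fsv_substS: "fsv (substS X Y p) \<subseteq> insert Y (fsv p - {X})"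
  by (induction p) auto

lemma free_for_new: "y \<notin> all_vars p \<Longrightarrow> free_for (Var y) x p"
  by (induction p) auto

lemma free_forS_new: "Y \<notin> all_svars p \<Longrightarrow> free_forS Y X p"
  by (induction p) auto

lemma subst_tm_back: "y \<notin> vars t \<Longrightarrow> subst_tm y (Var x) (subst_tm x (Var y) t) = t"
  by (induction t) auto

lemma subst_back: "y \<notin> all_vars p \<Longrightarrow> subst y (Var x) (subst x (Var y) p) = p"
  by (induction p) (auto simp: subst_tm_back subst_idle)

lemma substS_back: "Y \<notin> all_svars p \<Longrightarrow> substS Y X (substS X Y p) = p"
  by (induction p) (auto simp: substS_idle)

lemma free_for_back: "y \<notin> all_vars p \<Longrightarrow> free_for (Var x) y (subst x (Var y) p)"
proof (induction p)
  case (AllN z p)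
  then show ?case
    using fv_subst[of x "Var y" p] by (cases "z = x") auto
qed auto

lemma free_forS_back: "Y \<notin> all_svars p \<Longrightarrow> free_forS X Y (substS X Y p)"
proof (induction p)
  case (AllS Z p)
  then show ?case
    using fsv_substS[of X Y p] by (cases "Z = X") auto
qed auto

section \<open>Renaming of bound variables and generalization under hypotheses\<close>

lemma AllN_rename:
  assumes "y \<notin> all_vars p" "y \<noteq> x"
  shows "T \<turnstile> AllN y (subst x (Var y) p) \<^bold>\<longrightarrow> AllN x p"
proof -
  let ?q = "AllN y (subst x (Var y) p)"
  \<comment> \<open>Instantiating the renamed formula at the old variable restores \<open>p\<close>;
    as \<open>x\<close> is not free in \<open>?q\<close>, it can then be generalized.\<close>
  have "T \<turnstile> ?q \<^bold>\<longrightarrow> p"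
    using derivable.Inst[OF free_for_back[OF assms(1)], of T x] by (simp add: subst_back[OF assms(1)])
  moreover have "x \<notin> fv ?q"
    using fv_subst[of x "Var y" p] assms(2) by auto
  ultimately show ?thesis
    by (auto intro!: derivable.MP[OF derivable.Distr] derivable.Gen)
qed

lemma AllS_rename:
  assumes "Y \<notin> all_svars p" "Y \<noteq> X"
  shows "T \<turnstile> AllS Y (substS X Y p) \<^bold>\<longrightarrow> AllS X p"
proof -
  let ?q = "AllS Y (substS X Y p)"
  have "T \<turnstile> ?q \<^bold>\<longrightarrow> p"
    using derivable.InstS[OF free_forS_back[OF assms(1)], of T X] by (simp add: substS_back[OF assms(1)])
  moreover have "X \<notin> fsv ?q"
    using fsv_substS[of X Y p] assms(2) by auto
  ultimately show ?thesis
    by (auto intro!: derivable.MP[OF derivable.DistrS] derivable.GenS)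
qed

text \<open>\<open>Distr\<close> moves the quantifier past a premise only if \<open>x\<close> is not
  free there. Hence both premises are kept in universally quantified form, and the quantifier is
  introduced after \<open>q\<close> has been derived from them.\<close>

lemma AllN_mp: "T \<turnstile> AllN x (p \<^bold>\<longrightarrow> q) \<^bold>\<longrightarrow> AllN x p \<^bold>\<longrightarrow> AllN x q"
proof -
  let ?a = "AllN x (p \<^bold>\<longrightarrow> q)" and ?b = "AllN x p"
  let ?G = "insert ?b (insert ?a {})"
  have inst: "AllN x r \<in> G \<Longrightarrow> from_hyps T G r" for r G
    using derivable.Inst[of "Var x" x r T] by (auto intro: from_hyps.mp from_hyps.hyp from_hyps.theorem_of)
  have "from_hyps T ?G (p \<^bold>\<longrightarrow> q)" "from_hyps T ?G p"
    by (rule inst, simp)+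
  then have "from_hyps T {} (?a \<^bold>\<longrightarrow> ?b \<^bold>\<longrightarrow> q)"
    by (intro deduction) (rule from_hyps.mp)
  then have "T \<turnstile> ?a \<^bold>\<longrightarrow> ?b \<^bold>\<longrightarrow> q"
    by (simp only: from_hyps_empty)
  then have "T \<turnstile> ?a \<^bold>\<longrightarrow> AllN x (?b \<^bold>\<longrightarrow> q)"
    by (auto intro!: derivable.MP[OF derivable.Distr] derivable.Gen)
  moreover have "T \<turnstile> AllN x (?b \<^bold>\<longrightarrow> q) \<^bold>\<longrightarrow> ?b \<^bold>\<longrightarrow> AllN x q"
    by (rule derivable.Distr) simp
  ultimately show ?thesis
    by (rule imp_trans)
qed

lemma AllS_mp: "T \<turnstile> AllS X (p \<^bold>\<longrightarrow> q) \<^bold>\<longrightarrow> AllS X p \<^bold>\<longrightarrow> AllS X q"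
proof -
  let ?a = "AllS X (p \<^bold>\<longrightarrow> q)" and ?b = "AllS X p"
  let ?G = "insert ?b (insert ?a {})"
  have inst: "AllS X r \<in> G \<Longrightarrow> from_hyps T G r" for r G
    using derivable.InstS[of X X r T] by (auto intro: from_hyps.mp from_hyps.hyp from_hyps.theorem_of)
  have "from_hyps T ?G (p \<^bold>\<longrightarrow> q)" "from_hyps T ?G p"
    by (rule inst, simp)+
  then have "from_hyps T {} (?a \<^bold>\<longrightarrow> ?b \<^bold>\<longrightarrow> q)"
    by (intro deduction) (rule from_hyps.mp)
  then have "T \<turnstile> ?a \<^bold>\<longrightarrow> ?b \<^bold>\<longrightarrow> q"
    by (simp only: from_hyps_empty)
  then have "T \<turnstile> ?a \<^bold>\<longrightarrow> AllS X (?b \<^bold>\<longrightarrow> q)"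
    by (auto intro!: derivable.MP[OF derivable.DistrS] derivable.GenS)
  moreover have "T \<turnstile> AllS X (?b \<^bold>\<longrightarrow> q) \<^bold>\<longrightarrow> ?b \<^bold>\<longrightarrow> AllS X q"
    by (rule derivable.DistrS) simp
  ultimately show ?thesis
    by (rule imp_trans)
qed

text \<open>By induction on the derivation: modus ponens is matched by \<open>AllN_mp\<close>, and a
  hypothesis does not contain \<open>x\<close> freely, so it implies its own generalization.\<close>

lemma from_hyps_Gen:
  assumes "from_hyps T G p" "\<And>g. g \<in> G \<Longrightarrow> x \<notin> fv g"
  shows "from_hyps T G (AllN x p)"
  using assms
proof induction
  case (hyp p)
  then have "T \<turnstile> p \<^bold>\<longrightarrow> AllN x p"
    by (auto intro!: derivable.MP[OF derivable.Distr] derivable.Gen imp_refl)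
  then show ?case by (rule from_hyps.mp[OF from_hyps.theorem_of from_hyps.hyp[OF hyp.hyps]])
next
  case (mp p q)
  then show ?case
    using from_hyps.mp[OF from_hyps.mp[OF from_hyps.theorem_of[OF AllN_mp]]] by blast
qed (auto intro: from_hyps.theorem_of derivable.Gen)

lemma from_hyps_GenS:
  assumes "from_hyps T G p" "\<And>g. g \<in> G \<Longrightarrow> X \<notin> fsv g"
  shows "from_hyps T G (AllS X p)"
  using assms
proof induction
  case (hyp p)
  then have "T \<turnstile> p \<^bold>\<longrightarrow> AllS X p"
    by (auto intro!: derivable.MP[OF derivable.DistrS] derivable.GenS imp_refl)
  then show ?case by (rule from_hyps.mp[OF from_hyps.theorem_of from_hyps.hyp[OF hyp.hyps]])
next
  case (mp p q)
  then show ?case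
    using from_hyps.mp[OF from_hyps.mp[OF from_hyps.theorem_of[OF AllS_mp]]] by blast
qed (auto intro: from_hyps.theorem_of derivable.GenS)

subsection \<open>Structures\<close>

text \<open>Henkin semantics: set quantifiers range over \<open>SS\<close> only, which is what makes
  the two-sorted calculus complete.\<close>

locale interpretation_data =
  fixes zr on :: 'a and pl tm :: "'a \<Rightarrow> 'a \<Rightarrow> 'a" and ls :: "'a \<Rightarrow> 'a \<Rightarrow> bool"
    and SS :: "'a set set"
begin

primrec val :: "(nat \<Rightarrow> 'a) \<Rightarrow> tm \<Rightarrow> 'a" where
  "val v (Var x) = v x"
| "val v Zero = zr"
| "val v One = on"
| "val v (Add s t) = pl (val v s) (val v t)"
| "val v (Mul s t) = tm (val v s) (val v t)"

primrec sat :: "(nat \<Rightarrow> 'a) \<Rightarrow> (nat \<Rightarrow> 'a set) \<Rightarrow> fm \<Rightarrow> bool" where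
  "sat v \<sigma> Fls \<longleftrightarrow> False"
| "sat v \<sigma> (s \<^bold>= t) \<longleftrightarrow> val v s = val v t"
| "sat v \<sigma> (s \<^bold>< t) \<longleftrightarrow> ls (val v s) (val v t)"
| "sat v \<sigma> (t \<^bold>\<in> X) \<longleftrightarrow> val v t \<in> \<sigma> X"
| "sat v \<sigma> (p \<^bold>\<longrightarrow> q) \<longleftrightarrow> (sat v \<sigma> p \<longrightarrow> sat v \<sigma> q)"
| "sat v \<sigma> (AllN x p) \<longleftrightarrow> (\<forall>a. sat (v(x := a)) \<sigma> p)"
| "sat v \<sigma> (AllS X p) \<longleftrightarrow> (\<forall>A\<in>SS. sat v (\<sigma>(X := A)) p)"

lemma val_cong: "(\<And>x. x \<in> vars t \<Longrightarrow> v x = w x) \<Longrightarrow> val v t = val w t"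
  by (induction t) auto

lemma sat_cong:
  "(\<And>x. x \<in> fv p \<Longrightarrow> v x = w x) \<Longrightarrow> (\<And>X. X \<in> fsv p \<Longrightarrow> \<sigma> X = \<tau> X)
    \<Longrightarrow> sat v \<sigma> p \<longleftrightarrow> sat w \<tau> p"
proof (induction p arbitrary: v w \<sigma> \<tau>)
  case (AllN x p)
  have "sat (v(x := a)) \<sigma> p \<longleftrightarrow> sat (w(x := a)) \<tau> p" for a
    by (rule AllN.IH) (use AllN.prems in auto)
  then show ?case by simp
next
  case (AllS X p)
  have "sat v (\<sigma>(X := A)) p \<longleftrightarrow> sat w (\<tau>(X := A)) p" for A
    by (rule AllS.IH) (use AllS.prems in auto)
  then show ?case by simp
next
  case (Eq s t)
  then show ?case using val_cong[of s v w] val_cong[of t v w] by auto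
next
  case (Less s t)
  then show ?case using val_cong[of s v w] val_cong[of t v w] by auto
next
  case (Mem t X)
  then show ?case using val_cong[of t v w] by auto
next
  case (Imp p q)
  have "sat v \<sigma> p \<longleftrightarrow> sat w \<tau> p" "sat v \<sigma> q \<longleftrightarrow> sat w \<tau> q"
    by (rule Imp.IH; use Imp.prems in auto)+
  then show ?case by simp
qed simp

lemma val_upd_idle [simp]: "x \<notin> vars t \<Longrightarrow> val (v(x := a)) t = val v t"
  by (rule val_cong) auto

lemma val_subst_tm: "val v (subst_tm x t u) = val (v(x := val v t)) u"
  by (induction u) auto

lemma sat_subst: "free_for t x p \<Longrightarrow> sat v \<sigma> (subst x t p) \<longleftrightarrow> sat (v(x := val v t)) \<sigma> p"
proof (induction p arbitrary: v \<sigma>)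
  case (AllN y p)
  show ?case
  proof (cases "x \<in> fv (AllN y p)")
    case True
    then have "y \<noteq> x" "y \<notin> vars t" "free_for t x p"
      using AllN.prems by auto
    moreover have "v(y := a, x := b) = v(x := b, y := a)" for a b
      using \<open>y \<noteq> x\<close> by (rule fun_upd_twist)
    ultimately show ?thesis by (simp add: AllN.IH del: fun_upd_apply)
  next
    case False
    have "sat v \<sigma> (AllN y p) \<longleftrightarrow> sat (v(x := val v t)) \<sigma> (AllN y p)"
      by (rule sat_cong) (use False in auto)
    then show ?thesis using subst_idle[OF False] by metis
  qed
qed (auto simp: val_subst_tm)

lemma sat_substS: "free_forS Y X p \<Longrightarrow> sat v \<sigma> (substS X Y p) \<longleftrightarrow> sat v (\<sigma>(X := \<sigma> Y)) p"
proof (induction p arbitrary: v \<sigma>)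
  case (AllS Z p)
  show ?case
  proof (cases "X \<in> fsv (AllS Z p)")
    case True
    then have "Z \<noteq> X" "Z \<noteq> Y" "free_forS Y X p"
      using AllS.prems by auto
    moreover have "\<sigma>(Z := a, X := b) = \<sigma>(X := b, Z := a)" for a b
      using \<open>Z \<noteq> X\<close> by (rule fun_upd_twist)
    moreover have "(\<sigma>(Z := a)) Y = \<sigma> Y" for a
      using \<open>Z \<noteq> Y\<close> by simp
    ultimately show ?thesis by (simp add: AllS.IH del: fun_upd_apply)
  next
    case False
    have "sat v \<sigma> (AllS Z p) \<longleftrightarrow> sat v (\<sigma>(X := \<sigma> Y)) (AllS Z p)"
      by (rule sat_cong) (use False in auto)
    then show ?thesis using substS_idle[OF False] by metis
  qed
qed auto

lemma sat_closure:
  assumes "sat v \<sigma> (foldr AllN xs p)" and "\<And>x. x \<notin> set xs \<Longrightarrow> x \<in> fv p \<Longrightarrow> w x = v x"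
  shows "sat w \<sigma> p"
  using assms
proof (induction xs arbitrary: v)
  case Nil
  then show ?case using sat_cong[of p v w \<sigma> \<sigma>] by auto
next
  case (Cons x xs)
  have "sat (v(x := w x)) \<sigma> (foldr AllN xs p)" using Cons.prems(1) by simp
  then show ?case by (rule Cons.IH) (use Cons.prems(2) in auto)
qed

lemma sat_closureS:
  assumes "sat v \<sigma> (foldr AllS Xs p)" and "\<And>X. X \<notin> set Xs \<Longrightarrow> X \<in> fsv p \<Longrightarrow> \<tau> X = \<sigma> X"
    and "range \<tau> \<subseteq> SS"
  shows "sat v \<tau> p"
  using assms
proof (induction Xs arbitrary: \<sigma>)
  case Nil
  then show ?case using sat_cong[of p v v \<sigma> \<tau>] by auto
next
  case (Cons X Xs)
  have "sat v (\<sigma>(X := \<tau> X)) (foldr AllS Xs p)" using Cons.prems(1,3) by auto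
  then show ?case by (rule Cons.IH) (use Cons.prems(2,3) in auto)
qed

text \<open>An axiom with free variables acts as its universal closure. In the term model truth is
  known for one assignment only; this passes from the closures at that assignment to the formula at
  every assignment.\<close>

lemma sat_all_assignments:
  assumes "\<And>xs Xs. sat v \<sigma> (foldr AllN xs (foldr AllS Xs p))" and "range \<tau> \<subseteq> SS"
  shows "sat w \<tau> p"
proof -
  obtain xs Xs where "set xs = fv p" "set Xs = fsv p"
    using finite_list[OF finite_fv] finite_list[OF finite_fsv] by metis
  moreover have "fv (foldr AllS Xs p) = fv p" for Xs
    by (induction Xs) auto
  ultimately have "sat w \<sigma> (foldr AllS Xs p)"
    by (intro sat_closure[OF assms(1)[of xs Xs]]) auto
  then show ?thesis
    by (rule sat_closureS) (use \<open>set Xs = fsv p\<close> assms(2) in auto)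
qed

end


subsection \<open>Maximal consistent sets with witnesses\<close>

instance tm :: countable by countable_datatype
instance fm :: countable by countable_datatype

text \<open>A witness exceeds all variables of the formula, bound ones included, so that
  substituting it captures nothing; \<open>fresh_name\<close> also exploits its size to avoid a
  given finite set.\<close>

locale henkin_set =
  fixes T \<Gamma> :: "fm set"
  assumes closed: "from_hyps T \<Gamma> p \<Longrightarrow> p \<in> \<Gamma>"
    and consistent: "Fls \<notin> \<Gamma>"
    and complete: "p \<notin> \<Gamma> \<Longrightarrow> (\<^bold>\<not> p) \<in> \<Gamma>"
    and witness: "(\<^bold>\<not> AllN x p) \<in> \<Gamma> \<Longrightarrow>
      \<exists>y. (\<forall>z\<in>insert x (all_vars p). z < y) \<and> (\<^bold>\<not> subst x (Var y) p) \<in> \<Gamma>"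
    and witnessS: "(\<^bold>\<not> AllS X p) \<in> \<Gamma> \<Longrightarrow>
      \<exists>Y. (\<forall>Z\<in>insert X (all_svars p). Z < Y) \<and> (\<^bold>\<not> substS X Y p) \<in> \<Gamma>"

definition new_var :: "fm set \<Rightarrow> nat" where
  "new_var G = Suc (Max (insert 0 (\<Union>(all_vars ` G))))"

definition new_svar :: "fm set \<Rightarrow> nat" where
  "new_svar G = Suc (Max (insert 0 (\<Union>(all_svars ` G))))"

lemma less_new_var: "finite G \<Longrightarrow> p \<in> G \<Longrightarrow> x \<in> all_vars p \<Longrightarrow> x < new_var G"
  unfolding new_var_def by (intro le_imp_less_Suc Max_ge) auto

lemma less_new_svar: "finite G \<Longrightarrow> p \<in> G \<Longrightarrow> x \<in> all_svars p \<Longrightarrow> x < new_svar G"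
  unfolding new_svar_def by (intro le_imp_less_Suc Max_ge) auto

text \<open>Variables serve as Henkin constants, without extending the language: \<open>G\<close>
  stays finite, so a variable new to \<open>G\<close> always exists.\<close>

fun witnesses :: "fm set \<Rightarrow> fm \<Rightarrow> fm set" where
  "witnesses G (AllN x p \<^bold>\<longrightarrow> Fls) = {\<^bold>\<not> subst x (Var (new_var G)) p}"
| "witnesses G (AllS X p \<^bold>\<longrightarrow> Fls) = {\<^bold>\<not> substS X (new_svar G) p}"
| "witnesses G p = {}"

text \<open>If the negated instance at the new variable were inconsistent with \<open>G\<close>,
  then \<open>G\<close> would derive that instance; no hypothesis mentions the variable, so
  \<open>G\<close> would derive the universal statement that \<open>p\<close> denies.\<close>

lemma witnesses_consistent:
  assumes fin: "finite G" and "p \<in> G" and con: "\<not> from_hyps T G Fls"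
  shows "\<not> from_hyps T (G \<union> witnesses G p) Fls"
proof
  assume incon: "from_hyps T (G \<union> witnesses G p) Fls"
  have new: "new_var G \<notin> fv q" "new_svar G \<notin> fsv q" if "q \<in> G" for q
    using less_new_var[OF fin that] less_new_svar[OF fin that]
    by (metis less_irrefl not_fv_if_not_all_vars, metis less_irrefl not_fsv_if_not_all_svars)
  consider (N) x q where "p = (\<^bold>\<not> AllN x q)" | (S) X q where "p = (\<^bold>\<not> AllS X q)"
    | (none) "witnesses G p = {}"
    by (cases "(G, p)" rule: witnesses.cases) auto
  then show False
  proof cases
    case N
    let ?y = "new_var G"
    have "?y \<notin> all_vars q" "?y \<noteq> x"
      using less_new_var[OF fin \<open>p \<in> G\<close>] N by fastforce+
    moreover have "from_hyps T G (subst x (Var ?y) q)"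
      using incon N by - (rule from_hyps_ccontr, simp)
    then have "from_hyps T G (AllN ?y (subst x (Var ?y) q))"
      by (rule from_hyps_Gen) (use new in auto)
    ultimately have "from_hyps T G (AllN x q)"
      using AllN_rename from_hyps.mp from_hyps.theorem_of by blast
    then show False
      using N con \<open>p \<in> G\<close> from_hyps.hyp from_hyps.mp by blast
  next
    case S
    let ?y = "new_svar G"
    have "?y \<notin> all_svars q" "?y \<noteq> X"
      using less_new_svar[OF fin \<open>p \<in> G\<close>] S by fastforce+
    moreover have "from_hyps T G (substS X ?y q)"
      using incon S by - (rule from_hyps_ccontr, simp)
    then have "from_hyps T G (AllS ?y (substS X ?y q))"
      by (rule from_hyps_GenS) (use new in auto)
    ultimately have "from_hyps T G (AllS X q)"
      using AllS_rename from_hyps.mp from_hyps.theorem_of by blast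
    then show False
      using S con \<open>p \<in> G\<close> from_hyps.hyp from_hyps.mp by blast
  next
    case none
    then show False using incon con by simp
  qed
qed

primrec stage :: "fm set \<Rightarrow> fm set \<Rightarrow> nat \<Rightarrow> fm set" where
  "stage T G 0 = G"
| "stage T G (Suc n) = (let H = insert (from_nat n) (stage T G n) in
    if from_hyps T H Fls then stage T G n else H \<union> witnesses H (from_nat n))"

lemma finite_witnesses [simp]: "finite (witnesses G p)"
  by (cases "(G, p)" rule: witnesses.cases) auto

lemma finite_stage: "finite G \<Longrightarrow> finite (stage T G n)"
  by (induction n) (auto simp: Let_def)

lemma stage_consistent:
  assumes "finite G" "\<not> from_hyps T G Fls" shows "\<not> from_hyps T (stage T G n) Fls"
  using assms
proof (induction n)
  case (Suc n)
  then show ?case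
    using witnesses_consistent[of "insert (from_nat n) (stage T G n)" "from_nat n" T]
    by (auto simp: Let_def finite_stage)
qed simp

lemma stage_mono: "m \<le> n \<Longrightarrow> stage T G m \<subseteq> stage T G n"
  by (rule lift_Suc_mono_le[of "stage T G"]) (auto simp: Let_def)

lemma henkin_extension:
  assumes "finite G" "\<not> from_hyps T G Fls"
  obtains \<Gamma> where "G \<subseteq> \<Gamma>" "henkin_set T \<Gamma>"
proof
  define \<Gamma> where "\<Gamma> = (\<Union>n. stage T G n)"
  have stage_le: "stage T G n \<subseteq> \<Gamma>" for n
    unfolding \<Gamma>_def by auto
  show "G \<subseteq> \<Gamma>" using stage_le[of 0] by simp
  have finite_sub: "\<exists>n. H \<subseteq> stage T G n" if "finite H" "H \<subseteq> \<Gamma>" for H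
    using that
  proof (induction rule: finite_induct)
    case (insert p H)
    then obtain m n where "H \<subseteq> stage T G m" "p \<in> stage T G n"
      unfolding \<Gamma>_def by auto
    then have "insert p H \<subseteq> stage T G (max m n)"
      using stage_mono[of m "max m n" T G] stage_mono[of n "max m n" T G] by auto
    then show ?case by blast
  qed simp
  have con: "\<not> from_hyps T \<Gamma> Fls"
    using from_hyps_finite[of T \<Gamma> Fls] finite_sub stage_consistent[OF assms]
    by (metis from_hyps_mono)
  \<comment> \<open>The formula \<open>p\<close> is considered at stage \<open>to_nat p\<close>, and
    its witness is chosen fresh for that stage together with \<open>p\<close> itself.\<close>
  have added: "insert p (stage T G (to_nat p)) \<union> witnesses (insert p (stage T G (to_nat p))) p \<subseteq> \<Gamma>"
    if "\<not> from_hyps T (insert p (stage T G (to_nat p))) Fls" for p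
    using that stage_le[of "Suc (to_nat p)"] by (simp add: Let_def)
  have incl: "p \<in> \<Gamma>" if "\<not> from_hyps T (insert p \<Gamma>) Fls" for p
    using added[of p] that from_hyps_mono[of T _ Fls "insert p \<Gamma>"] stage_le by blast
  have cl: "p \<in> \<Gamma>" if "from_hyps T \<Gamma> p" for p
    using incl[of p] con from_hyps_cut[OF that] by blast
  have stage_con: "\<not> from_hyps T (insert p (stage T G (to_nat p))) Fls" if "p \<in> \<Gamma>" for p
    using con from_hyps_mono[of T _ Fls \<Gamma>] stage_le[of "to_nat p"] that by blast
  show "henkin_set T \<Gamma>"
  proof
    show "p \<in> \<Gamma>" if "from_hyps T \<Gamma> p" for p
      using cl that .
    show "Fls \<notin> \<Gamma>"
      using con from_hyps.hyp by blast
    show "(\<^bold>\<not> p) \<in> \<Gamma>" if "p \<notin> \<Gamma>" for p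
      using that incl cl deduction by blast
  next
    fix x p assume in_\<Gamma>: "(\<^bold>\<not> AllN x p) \<in> \<Gamma>"
    let ?H = "insert (\<^bold>\<not> AllN x p) (stage T G (to_nat (\<^bold>\<not> AllN x p)))"
    have "(\<^bold>\<not> subst x (Var (new_var ?H)) p) \<in> \<Gamma>"
      using added[OF stage_con[OF in_\<Gamma>]] by simp
    moreover have "\<forall>z\<in>insert x (all_vars p). z < new_var ?H"
      using less_new_var[of ?H "\<^bold>\<not> AllN x p"] finite_stage[OF assms(1)] by auto
    ultimately show "\<exists>y. (\<forall>z\<in>insert x (all_vars p). z < y) \<and> (\<^bold>\<not> subst x (Var y) p) \<in> \<Gamma>"
      by blast
  next
    fix X p assume in_\<Gamma>: "(\<^bold>\<not> AllS X p) \<in> \<Gamma>"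
    let ?H = "insert (\<^bold>\<not> AllS X p) (stage T G (to_nat (\<^bold>\<not> AllS X p)))"
    have "(\<^bold>\<not> substS X (new_svar ?H) p) \<in> \<Gamma>"
      using added[OF stage_con[OF in_\<Gamma>]] by simp
    moreover have "\<forall>z\<in>insert X (all_svars p). z < new_svar ?H"
      using less_new_svar[of ?H "\<^bold>\<not> AllS X p"] finite_stage[OF assms(1)] by auto
    ultimately show "\<exists>Y. (\<forall>Z\<in>insert X (all_svars p). Z < Y) \<and> (\<^bold>\<not> substS X Y p) \<in> \<Gamma>"
      by blast
  qed
qed


subsection \<open>The term model\<close>

text \<open>Places a quotient with infinitely many classes on the type \<open>nat\<close>, since the
  models have to live on one fixed type. The pairwise unrelated values of \<open>f\<close> guarantee
  infinitely many classes, hence surjectivity.\<close>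

lemma surj_representation:
  fixes R :: "'b :: countable \<Rightarrow> 'b \<Rightarrow> bool" and f :: "nat \<Rightarrow> 'b"
  assumes "equivp R" and "\<And>i j. i \<noteq> j \<Longrightarrow> \<not> R (f i) (f j)"
  obtains r :: "'b \<Rightarrow> nat" where "surj r" "\<And>a b. r a = r b \<longleftrightarrow> R a b"
proof
  define c where "c a = {b. R a b}" for a
  have c_iff: "c a = c b \<longleftrightarrow> R a b" for a b
    unfolding c_def using assms(1) by (metis equivp_def mem_Collect_eq Collect_cong)
  have "inj (c \<circ> f)"
    using assms(2) by (auto simp: inj_def c_iff)
  then have "infinite (range c)"
    by (metis finite_subset image_comp infinite_UNIV_nat finite_imageD image_mono top_greatest)
  then have bij: "bij_betw (to_nat_on (range c)) (range c) UNIV"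
    by (simp add: to_nat_on_infinite)
  show "surj (\<lambda>a. to_nat_on (range c) (c a))"
    using bij unfolding bij_betw_def by (metis image_image)
  show "to_nat_on (range c) (c a) = to_nat_on (range c) (c b) \<longleftrightarrow> R a b" for a b
    using bij unfolding bij_betw_def c_iff[symmetric] by (metis inj_onD rangeI)
qed

primrec num :: "nat \<Rightarrow> tm" where
  "num 0 = Zero"
| "num (Suc n) = suc (num n)"

text \<open>The truth lemma passes from a quantified formula to a substitution instance of its body,
  which is no subformula but has smaller depth.\<close>

primrec depth :: "fm \<Rightarrow> nat" where
  "depth Fls = 0"
| "depth (s \<^bold>= t) = 0"
| "depth (s \<^bold>< t) = 0"
| "depth (t \<^bold>\<in> X) = 0"
| "depth (p \<^bold>\<longrightarrow> q) = Suc (depth p + depth q)"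
| "depth (AllN x p) = Suc (depth p)"
| "depth (AllS X p) = Suc (depth p)"

lemma depth_subst [simp]: "depth (subst x t p) = depth p"
  by (induction p) auto

lemma depth_substS [simp]: "depth (substS X Y p) = depth p"
  by (induction p) auto

context henkin_set
begin

lemma thm_in: "T \<turnstile> p \<Longrightarrow> p \<in> \<Gamma>"
  using closed from_hyps.theorem_of by blast

lemma mp_in: "(p \<^bold>\<longrightarrow> q) \<in> \<Gamma> \<Longrightarrow> p \<in> \<Gamma> \<Longrightarrow> q \<in> \<Gamma>"
  using closed from_hyps.mp from_hyps.hyp by blast

lemma neg_in_iff: "(\<^bold>\<not> p) \<in> \<Gamma> \<longleftrightarrow> p \<notin> \<Gamma>"
  using complete consistent mp_in by blast

lemma imp_in_iff: "(p \<^bold>\<longrightarrow> q) \<in> \<Gamma> \<longleftrightarrow> (p \<in> \<Gamma> \<longrightarrow> q \<in> \<Gamma>)"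
proof
  assume *: "p \<in> \<Gamma> \<longrightarrow> q \<in> \<Gamma>"
  show "(p \<^bold>\<longrightarrow> q) \<in> \<Gamma>"
  proof (cases "q \<in> \<Gamma>")
    case True
    then show ?thesis using mp_in thm_in[OF derivable.K] by blast
  next
    case False
    then have "(\<^bold>\<not> p) \<in> \<Gamma>" using * neg_in_iff by blast
    then have "from_hyps T (insert p \<Gamma>) Fls"
      by (meson from_hyps.hyp from_hyps.mp insertCI)
    then show ?thesis by (rule closed[OF deduction[OF from_hyps_exfalso]])
  qed
qed (use mp_in in blast)

lemma AllN_inst: "AllN x p \<in> \<Gamma> \<Longrightarrow> free_for t x p \<Longrightarrow> subst x t p \<in> \<Gamma>"
  using mp_in thm_in[OF derivable.Inst] by blast

lemma AllS_inst: "AllS X p \<in> \<Gamma> \<Longrightarrow> free_forS Y X p \<Longrightarrow> substS X Y p \<in> \<Gamma>"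
  using mp_in thm_in[OF derivable.InstS] by blast

lemma leibniz:
  assumes "(s \<^bold>= t) \<in> \<Gamma>" "free_for s x p" "free_for t x p" "subst x s p \<in> \<Gamma>"
  shows "subst x t p \<in> \<Gamma>"
  using assms mp_in thm_in[OF derivable.Leibniz] by meson

definition eqv :: "tm \<Rightarrow> tm \<Rightarrow> bool" where
  "eqv s t \<longleftrightarrow> (s \<^bold>= t) \<in> \<Gamma>"

lemma ex_fresh: "finite A \<Longrightarrow> \<exists>x::nat. x \<notin> A"
  by (rule ex_new_if_finite) auto

lemma eqv_refl: "eqv t t"
  unfolding eqv_def using thm_in derivable.Refl by blast

lemma eqv_subst:
  assumes "eqv s t" "\<And>u. free_for u x p" "subst x s p \<in> \<Gamma>" shows "subst x t p \<in> \<Gamma>"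
  using leibniz assms unfolding eqv_def by blast

lemma eqv_sym: "eqv s t \<Longrightarrow> eqv t s"
proof -
  assume "eqv s t"
  obtain x where "x \<notin> vars s" using ex_fresh[of "vars s"] by auto
  then show ?thesis
    using eqv_subst[OF \<open>eqv s t\<close>, of x "Var x \<^bold>= s"] eqv_refl[of s]
    by (simp add: eqv_def subst_tm_idle)
qed

lemma eqv_trans: "eqv s t \<Longrightarrow> eqv t u \<Longrightarrow> eqv s u"
proof -
  assume "eqv s t" "eqv t u"
  obtain x where "x \<notin> vars s" using ex_fresh[of "vars s"] by auto
  then show ?thesis
    using eqv_subst[OF \<open>eqv t u\<close>, of x "s \<^bold>= Var x"] \<open>eqv s t\<close>
    by (simp add: eqv_def subst_tm_idle)
qed

lemma equivp_eqv: "equivp eqv"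
  by (rule equivpI) (auto simp: reflp_def symp_def transp_def intro: eqv_refl eqv_sym eqv_trans)

text \<open>The arguments are replaced one at a time; a fresh variable marks the place at which the
  Leibniz axiom substitutes.\<close>

lemma eqv_binary:
  assumes "eqv s s'" "eqv t t'"
    and C: "\<And>x u s t. subst_tm x u (C s t) = C (subst_tm x u s) (subst_tm x u t)"
  shows "eqv (C s t) (C s' t')"
proof -
  obtain x where x: "x \<notin> vars s \<union> vars t" using ex_fresh[of "vars s \<union> vars t"] by auto
  have "eqv (C s t) (C s' t)"
    using eqv_subst[OF assms(1), of x "C s t \<^bold>= C (Var x) t"] eqv_refl x
    by (simp add: eqv_def subst_tm_idle C)
  moreover obtain y where "y \<notin> vars s' \<union> vars t" using ex_fresh[of "vars s' \<union> vars t"] by auto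
  then have "eqv (C s' t) (C s' t')"
    using eqv_subst[OF assms(2), of y "C s' t \<^bold>= C s' (Var y)"] eqv_refl
    by (simp add: eqv_def subst_tm_idle C)
  ultimately show ?thesis by (rule eqv_trans)
qed

lemma eqv_Add: "eqv s s' \<Longrightarrow> eqv t t' \<Longrightarrow> eqv (Add s t) (Add s' t')"
  by (rule eqv_binary) auto

lemma eqv_Mul: "eqv s s' \<Longrightarrow> eqv t t' \<Longrightarrow> eqv (Mul s t) (Mul s' t')"
  by (rule eqv_binary) auto

lemma eqv_Less: "eqv s s' \<Longrightarrow> eqv t t' \<Longrightarrow> (s \<^bold>< t) \<in> \<Gamma> \<Longrightarrow> (s' \<^bold>< t') \<in> \<Gamma>"
proof -
  assume s: "eqv s s'" and t: "eqv t t'" and st: "(s \<^bold>< t) \<in> \<Gamma>"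
  obtain x where x: "x \<notin> vars t" using ex_fresh[of "vars t"] by auto
  have "(s' \<^bold>< t) \<in> \<Gamma>"
    using eqv_subst[OF s, of x "Var x \<^bold>< t"] st x by (simp add: subst_tm_idle)
  moreover obtain y where "y \<notin> vars s'" using ex_fresh[of "vars s'"] by auto
  ultimately show ?thesis
    using eqv_subst[OF t, of y "s' \<^bold>< Var y"] by (simp add: subst_tm_idle)
qed

lemma eqv_Mem: "eqv s s' \<Longrightarrow> (s \<^bold>\<in> X) \<in> \<Gamma> \<Longrightarrow> (s' \<^bold>\<in> X) \<in> \<Gamma>"
  using eqv_subst[of s s' 0 "Var 0 \<^bold>\<in> X"] by simp

text \<open>An arbitrary term may be captured when it instantiates a quantifier, a fresh variable
  equal to it may not. The witness of \<open>\<exists>z. z = t\<close> is such a variable, because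
  witnesses are larger than \<open>z\<close>, which lies above \<open>A\<close>.\<close>

lemma fresh_name: "finite A \<Longrightarrow> \<exists>y. y \<notin> A \<and> eqv (Var y) t"
proof -
  assume "finite A"
  define z where "z = Suc (Max (insert 0 (A \<union> vars t)))"
  have z: "x < z" if "x \<in> A \<union> vars t" for x
    unfolding z_def using that \<open>finite A\<close> by (intro le_imp_less_Suc Max_ge) auto
  have "z \<notin> vars t" using z[of z] by blast
  have "(\<^bold>\<not> AllN z (\<^bold>\<not> Var z \<^bold>= t)) \<in> \<Gamma>"
  proof (rule ccontr)
    assume "\<not> ?thesis"
    then have "AllN z (\<^bold>\<not> Var z \<^bold>= t) \<in> \<Gamma>" using neg_in_iff by blast
    with \<open>z \<notin> vars t\<close> have "(\<^bold>\<not> t \<^bold>= t) \<in> \<Gamma>"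
      using AllN_inst[of z "\<^bold>\<not> Var z \<^bold>= t" t] by (simp add: subst_tm_idle)
    then show False using neg_in_iff eqv_refl eqv_def by blast
  qed
  from witness[OF this] obtain y where "z < y" "(Var y \<^bold>= t) \<in> \<Gamma>"
    using \<open>z \<notin> vars t\<close> by (auto simp: subst_tm_idle neg_in_iff)
  then show ?thesis using z eqv_def by fastforce
qed

lemma iff_in_iff: "(p \<^bold>\<longleftrightarrow> q) \<in> \<Gamma> \<longleftrightarrow> (p \<in> \<Gamma> \<longleftrightarrow> q \<in> \<Gamma>)"
  using consistent by (auto simp: imp_in_iff)

text \<open>The analogue for set variables. Sets have no primitive equality, so having the same
  elements replaces it.\<close>

lemma fresh_set_name: "finite A \<Longrightarrow> \<exists>Y. Y \<notin> A \<and> (\<forall>t. (t \<^bold>\<in> Y) \<in> \<Gamma> \<longleftrightarrow> (t \<^bold>\<in> X) \<in> \<Gamma>)"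
proof -
  assume "finite A"
  define Z where "Z = Suc (Max (insert X A))"
  have Z: "Y < Z" if "Y \<in> insert X A" for Y
    unfolding Z_def using that \<open>finite A\<close> by (intro le_imp_less_Suc Max_ge) auto
  let ?p = "\<lambda>Y. AllN 0 (Var 0 \<^bold>\<in> Y \<^bold>\<longleftrightarrow> Var 0 \<^bold>\<in> X)"
  have "(\<^bold>\<not> AllS Z (\<^bold>\<not> ?p Z)) \<in> \<Gamma>"
  proof (rule ccontr)
    assume "\<not> ?thesis"
    then have "AllS Z (\<^bold>\<not> ?p Z) \<in> \<Gamma>" using neg_in_iff by blast
    then have "(\<^bold>\<not> ?p X) \<in> \<Gamma>"
      using AllS_inst[of Z "\<^bold>\<not> ?p Z" X] Z by auto
    moreover have "T \<turnstile> ?p X"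
      by (intro derivable.Gen, subst from_hyps_empty[symmetric])
        (intro from_hyps_iff from_hyps.theorem_of imp_refl)
    ultimately show False using neg_in_iff thm_in by blast
  qed
  from witnessS[OF this] obtain Y where "Z < Y" "?p Y \<in> \<Gamma>"
    using Z by (auto simp: neg_in_iff split: if_splits)
  moreover from this have "(t \<^bold>\<in> Y) \<in> \<Gamma> \<longleftrightarrow> (t \<^bold>\<in> X) \<in> \<Gamma>" for t
    using AllN_inst[of 0 "Var 0 \<^bold>\<in> Y \<^bold>\<longleftrightarrow> Var 0 \<^bold>\<in> X" t] by (simp add: iff_in_iff[symmetric])
  ultimately show ?thesis using Z by (metis insertCI less_trans less_irrefl)
qed

text \<open>\<open>c\<close> picks a representative term of each number, and each set of the model
  is the interpretation of some set variable; a set quantifier therefore amounts to a quantifier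
  over set variables.\<close>

lemma term_model:
  fixes r :: "tm \<Rightarrow> nat"
  assumes "surj r" and r_iff: "\<And>s t. r s = r t \<longleftrightarrow> eqv s t"
  obtains zr on pl tm ls v \<sigma> where
    "\<And>p. interpretation_data.sat zr on pl tm ls (range \<sigma>) v (\<sigma> :: nat \<Rightarrow> nat set) p \<longleftrightarrow> p \<in> \<Gamma>"
proof
  define c where "c = inv r"
  have r_c: "r (c a) = a" for a
    unfolding c_def using \<open>surj r\<close> by (rule surj_f_inv_f)
  have c_r: "eqv (c (r t)) t" for t
    using r_c r_iff by blast
  define pl where "pl a b = r (Add (c a) (c b))" for a b
  define tm where "tm a b = r (Mul (c a) (c b))" for a b
  define ls where "ls a b \<longleftrightarrow> (c a \<^bold>< c b) \<in> \<Gamma>" for a b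
  define v where "v x = r (Var x)" for x
  define \<sigma> where "\<sigma> X = {a. (c a \<^bold>\<in> X) \<in> \<Gamma>}" for X
  interpret interpretation_data "r Zero" "r One" pl tm ls "range \<sigma>" .
  have "pl (r s) (r t) = r (Add s t)" "tm (r s) (r t) = r (Mul s t)" for s t
    unfolding pl_def tm_def r_iff by (intro eqv_Add eqv_Mul c_r)+
  moreover have v_Var: "v x = r (Var x)" for x
    by (simp add: v_def)
  ultimately have val: "val v t = r t" for t
    by (induction t) auto
  have mem: "r t \<in> \<sigma> X \<longleftrightarrow> (t \<^bold>\<in> X) \<in> \<Gamma>" for t X
    unfolding \<sigma>_def using eqv_Mem c_r eqv_sym by blast
  show "sat v \<sigma> p \<longleftrightarrow> p \<in> \<Gamma>" for p
  proof (induction p rule: measure_induct_rule[of depth])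
    case (less p)
    show ?case
    proof (cases p)
      case Fls
      then show ?thesis using consistent by simp
    next
      case (Eq s t)
      then show ?thesis by (simp add: val r_iff eqv_def)
    next
      case (Less s t)
      have "ls (r s) (r t) \<longleftrightarrow> (s \<^bold>< t) \<in> \<Gamma>"
        unfolding ls_def using eqv_Less c_r eqv_sym by blast
      then show ?thesis using Less by (simp add: val)
    next
      case (Mem t X)
      then show ?thesis by (simp add: val mem)
    next
      case (Imp p1 p2)
      then show ?thesis using less[of p1] less[of p2] by (simp add: imp_in_iff)
    next
      case (AllN x q)
      have inst: "subst x (Var y) q \<in> \<Gamma> \<longleftrightarrow> sat (v(x := r (Var y))) \<sigma> q" if "y \<notin> all_vars q" for y
        using less[of "subst x (Var y) q"] AllN sat_subst[OF free_for_new[OF that], of v \<sigma> x, unfolded val]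
        by simp
      show ?thesis
      proof
        assume "p \<in> \<Gamma>"
        have "sat (v(x := a)) \<sigma> q" for a
        proof -
          obtain y where "y \<notin> all_vars q" "eqv (Var y) (c a)"
            using fresh_name[OF finite_all_vars] by blast
          moreover from this have "r (Var y) = a" using r_iff r_c by metis
          ultimately show ?thesis
            using inst AllN_inst[of x q "Var y"] \<open>p \<in> \<Gamma>\<close> AllN free_for_new by blast
        qed
        then show "sat v \<sigma> p" using AllN by simp
      next
        assume *: "sat v \<sigma> p"
        show "p \<in> \<Gamma>"
        proof (rule ccontr)
          assume "p \<notin> \<Gamma>"
          then obtain y where "\<forall>z\<in>insert x (all_vars q). z < y" "(\<^bold>\<not> subst x (Var y) q) \<in> \<Gamma>"
            using witness complete AllN by blast
          then show False using inst[of y] neg_in_iff * AllN by fastforce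
        qed
      qed
    next
      case (AllS X q)
      have inst: "substS X Y q \<in> \<Gamma> \<longleftrightarrow> sat v (\<sigma>(X := \<sigma> Y)) q" if "Y \<notin> all_svars q" for Y
        using less[of "substS X Y q"] AllS sat_substS[OF free_forS_new[OF that], of v \<sigma> X]
        by simp
      show ?thesis
      proof
        assume "p \<in> \<Gamma>"
        have "sat v (\<sigma>(X := \<sigma> Z)) q" for Z
        proof -
          obtain Y where "Y \<notin> all_svars q" "\<And>t. (t \<^bold>\<in> Y) \<in> \<Gamma> \<longleftrightarrow> (t \<^bold>\<in> Z) \<in> \<Gamma>"
            using fresh_set_name[OF finite_all_svars] by blast
          moreover from this have "\<sigma> Y = \<sigma> Z" by (simp add: \<sigma>_def)
          ultimately show ?thesis
            using inst[of Y] AllS_inst[of X q Y] \<open>p \<in> \<Gamma>\<close> AllS free_forS_new by metis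
        qed
        then show "sat v \<sigma> p" using AllS by simp
      next
        assume *: "sat v \<sigma> p"
        show "p \<in> \<Gamma>"
        proof (rule ccontr)
          assume "p \<notin> \<Gamma>"
          then obtain Y where "\<forall>Z\<in>insert X (all_svars q). Z < Y" "(\<^bold>\<not> substS X Y q) \<in> \<Gamma>"
            using witnessS complete AllS by blast
          then show False using inst[of Y] neg_in_iff * AllS by fastforce
        qed
      qed
    qed
  qed
qed

end

text \<open>
  That \<open>T\<close> proves the numerals to be distinct makes the domain infinite, so that it can be
  taken to be the type of natural numbers.
\<close>

theorem completeness:
  assumes "\<not> (T \<turnstile> p)" and num: "\<And>i j. j < i \<Longrightarrow> T \<turnstile> \<^bold>\<not> num i \<^bold>= num j"
  obtains zr on pl tm ls v and \<sigma> :: "nat \<Rightarrow> nat set" where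
    "\<And>q w \<tau>. q \<in> T \<Longrightarrow> range \<tau> \<subseteq> range \<sigma>
      \<Longrightarrow> interpretation_data.sat zr on pl tm ls (range \<sigma>) w \<tau> q"
    "\<not> interpretation_data.sat zr on pl tm ls (range \<sigma>) v \<sigma> p"
proof -
  have "\<not> from_hyps T {\<^bold>\<not> p} Fls"
    using assms(1) from_hyps_ccontr[of T p "{}"] by (auto simp: from_hyps_empty)
  then obtain \<Gamma> where "(\<^bold>\<not> p) \<in> \<Gamma>" "henkin_set T \<Gamma>"
    using henkin_extension[of "{\<^bold>\<not> p}" T] by blast
  then interpret henkin_set T \<Gamma> by simp
  have "\<not> eqv (num i) (num j)" if "j < i" for i j
    using num[OF that] thm_in neg_in_iff unfolding eqv_def by blast
  then have "\<not> eqv (num i) (num j)" if "i \<noteq> j" for i j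
    using that eqv_sym by (metis linorder_neqE_nat)
  then obtain r :: "tm \<Rightarrow> nat" where r: "surj r" "\<And>s t. r s = r t \<longleftrightarrow> eqv s t"
    using surj_representation[OF equivp_eqv, of num] by blast
  obtain zr on pl tm ls v and \<sigma> :: "nat \<Rightarrow> nat set" where
    truth: "\<And>p. interpretation_data.sat zr on pl tm ls (range \<sigma>) v \<sigma> p \<longleftrightarrow> p \<in> \<Gamma>"
    using term_model[OF r] by metis
  show ?thesis
  proof
    fix q w and \<tau> :: "nat \<Rightarrow> nat set" assume "q \<in> T" "range \<tau> \<subseteq> range \<sigma>"
    have "T \<turnstile> foldr AllN xs (foldr AllS Xs q)" for xs Xs
    proof (induction xs)
      case Nil
      show ?case
        using \<open>q \<in> T\<close> by (induction Xs) (auto intro: derivable.Ax derivable.GenS)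
    qed (auto intro: derivable.Gen)
    then show "interpretation_data.sat zr on pl tm ls (range \<sigma>) w \<tau> q"
      using interpretation_data.sat_all_assignments[OF _ \<open>range \<tau> \<subseteq> range \<sigma>\<close>] truth thm_in by metis
  next
    show "\<not> interpretation_data.sat zr on pl tm ls (range \<sigma>) v \<sigma> p"
      using \<open>(\<^bold>\<not> p) \<in> \<Gamma>\<close> neg_in_iff truth by blast
  qed
qed

section \<open>Models of $\mathsf{RCA}_0$\<close>

lemma fresh_notin: "fresh p \<notin> fv p"
proof
  assume "fresh p \<in> fv p"
  then have "fresh p \<le> Max (insert 0 (fv p))"
    by (intro Max_ge) auto
  then show False by (simp add: fresh_def)
qed

text \<open>
  \<open>schematic\<close> says that \<open>p\<close> behaves like a formula schema with respect to free variables: this is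
  what makes the bound variable chosen by \<open>AllH\<close> different from all others.
\<close>

definition schematic :: "(tm \<Rightarrow> fm) \<Rightarrow> bool" where
  "schematic p \<longleftrightarrow> (\<forall>t. fv (p Zero) \<subseteq> fv (p t) \<and> fv (p t) \<subseteq> fv (p Zero) \<union> vars t)"

definition schematic_tm :: "(tm \<Rightarrow> tm) \<Rightarrow> bool" where
  "schematic_tm f \<longleftrightarrow> (\<forall>t. vars (f Zero) \<subseteq> vars (f t) \<and> vars (f t) \<subseteq> vars (f Zero) \<union> vars t)"

lemma schematic_tm_simps [simp]:
  "schematic_tm (\<lambda>t. t)"
  "schematic_tm (\<lambda>t. u)"
  "schematic_tm f \<Longrightarrow> schematic_tm g \<Longrightarrow> schematic_tm (\<lambda>t. Add (f t) (g t))"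
  "schematic_tm f \<Longrightarrow> schematic_tm g \<Longrightarrow> schematic_tm (\<lambda>t. Mul (f t) (g t))"
  unfolding schematic_tm_def by auto

lemma fv_AllH [simp]: "schematic p \<Longrightarrow> fv (AllH p) = fv (p Zero)"
  unfolding AllH_def schematic_def using fresh_notin[of "p Zero"] by fastforce

lemma schematic_simps [simp]:
  "schematic (\<lambda>t. q)"
  "schematic_tm f \<Longrightarrow> schematic_tm g \<Longrightarrow> schematic (\<lambda>t. f t \<^bold>= g t)"
  "schematic_tm f \<Longrightarrow> schematic_tm g \<Longrightarrow> schematic (\<lambda>t. f t \<^bold>< g t)"
  "schematic_tm f \<Longrightarrow> schematic (\<lambda>t. f t \<^bold>\<in> X)"
  "schematic p \<Longrightarrow> schematic p' \<Longrightarrow> schematic (\<lambda>t. p t \<^bold>\<longrightarrow> p' t)"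
  unfolding schematic_def schematic_tm_def by auto

lemma schematic_AllH [simp]:
  "(\<And>t. schematic (q t)) \<Longrightarrow> (\<And>u. schematic (\<lambda>t. q t u)) \<Longrightarrow> schematic (\<lambda>t. \<^bold>\<forall>x. q t x)"
  using fv_AllH[of "q t" for t] unfolding schematic_def[of "\<lambda>t. AllH (q t)"]
  by (simp add: schematic_def)

lemma RCA0_num_neq: "j < i \<Longrightarrow> RCA0 \<turnstile> \<^bold>\<not> num i \<^bold>= num j"
proof (induction i arbitrary: j)
  case (Suc i)
  have [simp]: "vars (num k) = {}" for k
    by (induction k) auto
  show ?case
  proof (cases j)
    case 0
    \<comment> \<open>\<open>AllH\<close> binds variable 1 when the body has no other free variable
      and, in the nested axiom below, variable 2 under it.\<close>
    have "RCA0 \<turnstile> AllN 1 (\<^bold>\<not> suc (Var 1) \<^bold>= Zero)"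
      by (rule derivable.Ax) (simp add: RCA0_def basic_axioms_def AllH_def fresh_def)
    then show ?thesis
      using derivable.Inst[of "num i" 1 "\<^bold>\<not> suc (Var 1) \<^bold>= Zero" RCA0] 0
      by (auto intro: derivable.MP)
  next
    case (Suc k)
    have "RCA0 \<turnstile> AllN 1 (AllN 2 (suc (Var 1) \<^bold>= suc (Var 2) \<^bold>\<longrightarrow> Var 1 \<^bold>= Var 2))"
      by (rule derivable.Ax) (simp add: RCA0_def basic_axioms_def AllH_def fresh_def)
    then have "RCA0 \<turnstile> AllN 2 (suc (num i) \<^bold>= suc (Var 2) \<^bold>\<longrightarrow> num i \<^bold>= Var 2)"
      using derivable.Inst[of "num i" 1
          "AllN 2 (suc (Var 1) \<^bold>= suc (Var 2) \<^bold>\<longrightarrow> Var 1 \<^bold>= Var 2)" RCA0]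
      by (auto intro: derivable.MP)
    then have "RCA0 \<turnstile> suc (num i) \<^bold>= suc (num k) \<^bold>\<longrightarrow> num i \<^bold>= num k"
      using derivable.Inst[of "num k" 2
          "suc (num i) \<^bold>= suc (Var 2) \<^bold>\<longrightarrow> num i \<^bold>= Var 2" RCA0]
      by (auto intro: derivable.MP simp: subst_tm_idle)
    then show ?thesis
      using Suc.IH[of k] Suc.prems Suc by (auto intro: imp_trans)
  qed
qed simp

context interpretation_data
begin

text \<open>Introduction rules that read a formula off into the model. The first two treat the body
  under every variable \<open>n\<close> not free in \<open>p Zero\<close>, so the name chosen by
  \<open>AllH\<close> is never computed.\<close>

lemma sat_congs:
  "(\<And>n x. n \<notin> fv (p Zero) \<Longrightarrow> sat (v(n := x)) \<tau> (p (Var n)) \<longleftrightarrow> P x)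
    \<Longrightarrow> sat v \<tau> (AllH p) \<longleftrightarrow> (\<forall>x. P x)"
  "(\<And>n x. n \<notin> fv (p Zero) \<Longrightarrow> sat (v(n := x)) \<tau> (p (Var n)) \<longleftrightarrow> P x)
    \<Longrightarrow> sat v \<tau> (ExH p) \<longleftrightarrow> (\<exists>x. P x)"
  "sat v \<tau> q \<longleftrightarrow> Q \<Longrightarrow> sat v \<tau> r \<longleftrightarrow> R \<Longrightarrow> sat v \<tau> (q \<^bold>\<and> r) \<longleftrightarrow> Q \<and> R"
  "sat v \<tau> q \<longleftrightarrow> Q \<Longrightarrow> sat v \<tau> r \<longleftrightarrow> R \<Longrightarrow> sat v \<tau> (q \<^bold>\<or> r) \<longleftrightarrow> Q \<or> R"
  "sat v \<tau> q \<longleftrightarrow> Q \<Longrightarrow> sat v \<tau> r \<longleftrightarrow> R \<Longrightarrow> sat v \<tau> (q \<^bold>\<longrightarrow> r) \<longleftrightarrow> (Q \<longrightarrow> R)"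
  "sat v \<tau> q \<longleftrightarrow> Q \<Longrightarrow> sat v \<tau> r \<longleftrightarrow> R \<Longrightarrow> sat v \<tau> (q \<^bold>\<longleftrightarrow> r) \<longleftrightarrow> (Q \<longleftrightarrow> R)"
  "sat v \<tau> q \<longleftrightarrow> Q \<Longrightarrow> sat v \<tau> (\<^bold>\<not> q) \<longleftrightarrow> \<not> Q"
  using fresh_notin[of "p Zero"] fresh_notin[of "\<^bold>\<not> p Zero"] by (auto simp: AllH_def)

end

lemma free_for_Zero [simp]: "free_for Zero x p"
  by (induction p) auto

lemma free_for_suc_Var [simp]: "free_for (suc (Var x)) x p"
  by (induction p) auto

locale rca0_model =
  fixes zr on :: "'a :: countable" and pl tm :: "'a \<Rightarrow> 'a \<Rightarrow> 'a" and ls :: "'a \<Rightarrow> 'a \<Rightarrow> bool"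
    and \<sigma> :: "nat \<Rightarrow> 'a set"
  assumes model: "q \<in> RCA0 \<Longrightarrow> range \<tau> \<subseteq> range \<sigma>
    \<Longrightarrow> interpretation_data.sat zr on pl tm ls (range \<sigma>) w \<tau> q"
begin

notation zr ("\<zero>") and on ("\<one>") and pl (infixl "\<oplus>" 65) and tm (infixl "\<otimes>" 70)
  and ls (infix "\<prec>" 50)

sublocale interpretation_data zr on pl tm ls "range \<sigma>" .

definition le :: "'a \<Rightarrow> 'a \<Rightarrow> bool" (infix "\<preceq>" 50) where
  "a \<preceq> b \<longleftrightarrow> a \<prec> b \<or> a = b"

section \<open>The basic axioms read in the model\<close>

lemma basic_axiom: "q \<in> basic_axioms \<Longrightarrow> sat w \<sigma> q"
  using model[of q \<sigma>] by (auto simp: RCA0_def)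

lemma suc_neq_zero: "a \<oplus> \<one> \<noteq> \<zero>"
proof -
  have "sat w \<sigma> (\<^bold>\<forall>n. \<^bold>\<not> suc n \<^bold>= Zero) \<longleftrightarrow> (\<forall>n. \<not> n \<oplus> \<one> = \<zero>)" for w
    by (intro sat_congs) auto
  then show ?thesis using basic_axiom unfolding basic_axioms_def by blast
qed

lemma suc_inject: "a \<oplus> \<one> = b \<oplus> \<one> \<Longrightarrow> a = b"
proof -
  have "sat w \<sigma> (\<^bold>\<forall>m n. suc m \<^bold>= suc n \<^bold>\<longrightarrow> m \<^bold>= n)
      \<longleftrightarrow> (\<forall>m n. m \<oplus> \<one> = n \<oplus> \<one> \<longrightarrow> m = n)" for w
    by (intro sat_congs) auto
  then show "a \<oplus> \<one> = b \<oplus> \<one> \<Longrightarrow> a = b" using basic_axiom unfolding basic_axioms_def by blast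
qed

lemma add_zero: "a \<oplus> \<zero> = a"
proof -
  have "sat w \<sigma> (\<^bold>\<forall>m. Add m Zero \<^bold>= m) \<longleftrightarrow> (\<forall>m. m \<oplus> \<zero> = m)" for w
    by (intro sat_congs) auto
  then show ?thesis using basic_axiom unfolding basic_axioms_def by blast
qed

lemma add_suc: "a \<oplus> (b \<oplus> \<one>) = a \<oplus> b \<oplus> \<one>"
proof -
  have "sat w \<sigma> (\<^bold>\<forall>m n. Add m (suc n) \<^bold>= suc (Add m n))
      \<longleftrightarrow> (\<forall>m n. m \<oplus> (n \<oplus> \<one>) = m \<oplus> n \<oplus> \<one>)" for w
    by (intro sat_congs) auto
  then show ?thesis using basic_axiom unfolding basic_axioms_def by blast
qed

lemma mult_zero: "a \<otimes> \<zero> = \<zero>"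
proof -
  have "sat w \<sigma> (\<^bold>\<forall>m. Mul m Zero \<^bold>= Zero) \<longleftrightarrow> (\<forall>m. m \<otimes> \<zero> = \<zero>)" for w
    by (intro sat_congs) auto
  then show ?thesis using basic_axiom unfolding basic_axioms_def by blast
qed

lemma mult_suc: "a \<otimes> (b \<oplus> \<one>) = a \<otimes> b \<oplus> a"
proof -
  have "sat w \<sigma> (\<^bold>\<forall>m n. Mul m (suc n) \<^bold>= Add (Mul m n) m)
      \<longleftrightarrow> (\<forall>m n. m \<otimes> (n \<oplus> \<one>) = m \<otimes> n \<oplus> m)" for w
    by (intro sat_congs) auto
  then show ?thesis using basic_axiom unfolding basic_axioms_def by blast
qed

lemma not_less_zero: "\<not> a \<prec> \<zero>"
proof -
  have "sat w \<sigma> (\<^bold>\<forall>m. \<^bold>\<not> m \<^bold>< Zero) \<longleftrightarrow> (\<forall>m. \<not> m \<prec> \<zero>)" for w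
    by (intro sat_congs) auto
  then show ?thesis using basic_axiom unfolding basic_axioms_def by blast
qed

lemma less_suc_iff: "a \<prec> b \<oplus> \<one> \<longleftrightarrow> a \<prec> b \<or> a = b"
proof -
  have "sat w \<sigma> (\<^bold>\<forall>m n. m \<^bold>< suc n \<^bold>\<longleftrightarrow> m \<^bold>\<le> n)
      \<longleftrightarrow> (\<forall>m n. m \<prec> n \<oplus> \<one> \<longleftrightarrow> m \<prec> n \<or> m = n)" for w
    by (intro sat_congs) auto
  then show ?thesis using basic_axiom unfolding basic_axioms_def by blast
qed


subsection \<open>Definability\<close>

text \<open>
  Predicates of environments are classified by their definability. An environment assigns a
  number to each de Bruijn index, and every element of the model may be used as a constant: in
  the defining formula, the variable $3i$ or $3i+1$ plays the role of an index and the variable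
  $3i+2$ denotes the element with number $i$. A bound variable introduced below \<open>n\<close> others is
  called $3n+1$.
\<close>

definition layout :: "nat \<Rightarrow> (nat \<Rightarrow> nat) \<Rightarrow> bool" where
  "layout n \<rho> \<longleftrightarrow> (\<forall>i m. \<rho> i = 3 * m + 1 \<longrightarrow> m < n)"

definition consts_ok :: "(nat \<Rightarrow> 'a) \<Rightarrow> bool" where
  "consts_ok u \<longleftrightarrow> (\<forall>c. u (3 * to_nat c + 2) = c)"

text \<open>The condition on \<open>vars t\<close> makes the term a legitimate bound: it cannot
  contain the variable of a quantifier introduced at this level.\<close>

definition Tm :: "((nat \<Rightarrow> 'a) \<Rightarrow> 'a) \<Rightarrow> bool" where
  "Tm f \<longleftrightarrow> (\<forall>n \<rho>. layout n \<rho> \<longrightarrow> (\<exists>t. vars t \<subseteq> range \<rho> \<union> {x. x mod 3 = 2} \<and>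
    (\<forall>u. consts_ok u \<longrightarrow> val u t = f (\<lambda>i. u (\<rho> i)))))"

text \<open>Asking for a formula at every layout \<open>\<rho>\<close> makes the notion stable under
  quantifiers, since going under a binder is just a change of layout.\<close>

definition D0 :: "((nat \<Rightarrow> 'a) \<Rightarrow> bool) \<Rightarrow> bool" where
  "D0 P \<longleftrightarrow> (\<forall>n \<rho>. layout n \<rho> \<longrightarrow> (\<exists>p\<in>Delta00.
    \<forall>u. consts_ok u \<longrightarrow> sat u \<sigma> p = P (\<lambda>i. u (\<rho> i))))"

definition S1 :: "((nat \<Rightarrow> 'a) \<Rightarrow> bool) \<Rightarrow> bool" where
  "S1 P \<longleftrightarrow> (\<exists>Q. D0 Q \<and> (\<forall>v. P v \<longleftrightarrow> (\<exists>x. Q (case_nat x v))))"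

definition D1 :: "((nat \<Rightarrow> 'a) \<Rightarrow> bool) \<Rightarrow> bool" where
  "D1 P \<longleftrightarrow> S1 P \<and> S1 (\<lambda>v. \<not> P v)"

lemma Tm_index: "Tm (\<lambda>v. v i)"
  unfolding Tm_def by (intro allI impI exI[of _ "Var (\<rho> i)" for \<rho>]) auto

lemma Tm_const: "Tm (\<lambda>v. c)"
proof -
  have "(3 * to_nat c + 2) mod 3 = 2" by presburger
  then show ?thesis
    unfolding Tm_def consts_ok_def
    by (intro allI impI exI[of _ "Var (3 * to_nat c + 2)"]) (simp del: add_2_eq_Suc')
qed

lemma Tm_zero: "Tm (\<lambda>v. \<zero>)" and Tm_one: "Tm (\<lambda>v. \<one>)"
  by (rule Tm_const)+

lemma Tm_binary:
  assumes "Tm f" "Tm g" and "\<And>s t. vars (C s t) = vars s \<union> vars t"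
    and "\<And>u s t. val u (C s t) = h (val u s) (val u t)"
  shows "Tm (\<lambda>v. h (f v) (g v))"
  unfolding Tm_def
proof (intro allI impI)
  fix n \<rho> assume "layout n \<rho>"
  then obtain s t where "vars s \<subseteq> range \<rho> \<union> {x. x mod 3 = 2}" "vars t \<subseteq> range \<rho> \<union> {x. x mod 3 = 2}"
    "\<And>u. consts_ok u \<Longrightarrow> val u s = f (\<lambda>i. u (\<rho> i))" "\<And>u. consts_ok u \<Longrightarrow> val u t = g (\<lambda>i. u (\<rho> i))"
    using assms(1,2) unfolding Tm_def by metis
  then show "\<exists>t. vars t \<subseteq> range \<rho> \<union> {x. x mod 3 = 2} \<and>
      (\<forall>u. consts_ok u \<longrightarrow> val u t = h (f (\<lambda>i. u (\<rho> i))) (g (\<lambda>i. u (\<rho> i))))"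
    by (intro exI[of _ "C s t"]) (auto simp: assms(3,4))
qed

lemma Tm_add: "Tm f \<Longrightarrow> Tm g \<Longrightarrow> Tm (\<lambda>v. f v \<oplus> g v)"
  by (rule Tm_binary[where C = Add]) auto

lemma Tm_mult: "Tm f \<Longrightarrow> Tm g \<Longrightarrow> Tm (\<lambda>v. f v \<otimes> g v)"
  by (rule Tm_binary[where C = Mul]) auto

lemma D0_atomic:
  assumes "Tm f" "Tm g" and "\<And>s t. C s t \<in> Delta00"
    and "\<And>u s t. sat u \<sigma> (C s t) \<longleftrightarrow> R (val u s) (val u t)"
  shows "D0 (\<lambda>v. R (f v) (g v))"
  unfolding D0_def
proof (intro allI impI)
  fix n \<rho> assume "layout n \<rho>"
  then obtain s t where
    "\<And>u. consts_ok u \<Longrightarrow> val u s = f (\<lambda>i. u (\<rho> i))" "\<And>u. consts_ok u \<Longrightarrow> val u t = g (\<lambda>i. u (\<rho> i))"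
    using assms(1,2) unfolding Tm_def by metis
  then show "\<exists>p\<in>Delta00. \<forall>u. consts_ok u \<longrightarrow> sat u \<sigma> p = R (f (\<lambda>i. u (\<rho> i))) (g (\<lambda>i. u (\<rho> i)))"
    by (intro bexI[of _ "C s t"]) (auto simp: assms(3,4))
qed

lemma D0_eq: "Tm f \<Longrightarrow> Tm g \<Longrightarrow> D0 (\<lambda>v. f v = g v)"
  by (rule D0_atomic[where C = Eq]) (auto intro: Delta00.intros)

lemma D0_less: "Tm f \<Longrightarrow> Tm g \<Longrightarrow> D0 (\<lambda>v. f v \<prec> g v)"
  by (rule D0_atomic[where C = Less]) (auto intro: Delta00.intros)

lemma D0_mem:
  assumes "A \<in> range \<sigma>" "Tm f" shows "D0 (\<lambda>v. f v \<in> A)"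
  unfolding D0_def
proof (intro allI impI)
  fix n \<rho> assume "layout n \<rho>"
  then obtain t where "\<And>u. consts_ok u \<Longrightarrow> val u t = f (\<lambda>i. u (\<rho> i))"
    using assms unfolding Tm_def by metis
  moreover obtain X where "A = \<sigma> X" using assms(1) by blast
  ultimately show "\<exists>p\<in>Delta00. \<forall>u. consts_ok u \<longrightarrow> sat u \<sigma> p = (f (\<lambda>i. u (\<rho> i)) \<in> A)"
    by (intro bexI[of _ "t \<^bold>\<in> X"]) (auto intro: Delta00.intros)
qed

lemma D0_imp:
  assumes "D0 P" "D0 Q" shows "D0 (\<lambda>v. P v \<longrightarrow> Q v)"
  unfolding D0_def
proof (intro allI impI)
  fix n \<rho> assume "layout n \<rho>"
  then obtain p q where "p \<in> Delta00" "q \<in> Delta00"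
    "\<And>u. consts_ok u \<Longrightarrow> sat u \<sigma> p = P (\<lambda>i. u (\<rho> i))" "\<And>u. consts_ok u \<Longrightarrow> sat u \<sigma> q = Q (\<lambda>i. u (\<rho> i))"
    using assms unfolding D0_def by metis
  then show "\<exists>p\<in>Delta00. \<forall>u. consts_ok u \<longrightarrow> sat u \<sigma> p = (P (\<lambda>i. u (\<rho> i)) \<longrightarrow> Q (\<lambda>i. u (\<rho> i)))"
    by (intro bexI[of _ "p \<^bold>\<longrightarrow> q"]) (auto intro: Delta00.intros)
qed

lemma D0_prop: "D0 (\<lambda>v. b)"
proof (cases b)
  case True
  then show ?thesis using D0_eq[OF Tm_zero Tm_zero] by simp
next
  case False
  then show ?thesis
    unfolding D0_def by (intro allI impI bexI[of _ Fls]) (auto intro: Delta00.intros)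
qed

lemma D0_not: "D0 P \<Longrightarrow> D0 (\<lambda>v. \<not> P v)"
  using D0_imp[OF _ D0_prop[of False]] by simp

lemma D0_conj: "D0 P \<Longrightarrow> D0 Q \<Longrightarrow> D0 (\<lambda>v. P v \<and> Q v)"
  using D0_not[OF D0_imp[OF _ D0_not]] by simp

lemma D0_disj: "D0 P \<Longrightarrow> D0 Q \<Longrightarrow> D0 (\<lambda>v. P v \<or> Q v)"
  using D0_imp[OF D0_not] by (simp add: disj_imp)

lemma D0_iff: "D0 P \<Longrightarrow> D0 Q \<Longrightarrow> D0 (\<lambda>v. P v \<longleftrightarrow> Q v)"
  using D0_conj[OF D0_imp[of P Q] D0_imp[of Q P]] by (simp add: iff_conv_conj_imp)

text \<open>The bound variable gets the name \<open>3 * n + 1\<close>, which a layout of level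
  \<open>n\<close> leaves free and which does not name a constant. \<open>P\<close> takes the bound
  value and the outer environment separately, so that the rule unifies with goals in de Bruijn
  form.\<close>

lemma D0_all_less:
  assumes "Tm f" "D0 (\<lambda>v. P (v 0) (\<lambda>i. v (Suc i)))" shows "D0 (\<lambda>v. \<forall>x. x \<prec> f v \<longrightarrow> P x v)"
  unfolding D0_def
proof (intro allI impI)
  fix n \<rho> assume lay: "layout n \<rho>"
  let ?y = "3 * n + 1"
  have "layout (Suc n) (case_nat ?y \<rho>)"
    using lay unfolding layout_def by (auto split: nat.splits intro: less_SucI)
  then obtain p where p: "p \<in> Delta00" "\<And>u. consts_ok u \<Longrightarrow>
      sat u \<sigma> p = P (u ?y) (\<lambda>i. u (\<rho> i))"
    using assms(2) unfolding D0_def by fastforce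
  obtain t where t: "vars t \<subseteq> range \<rho> \<union> {x. x mod 3 = 2}"
    "\<And>u. consts_ok u \<Longrightarrow> val u t = f (\<lambda>i. u (\<rho> i))"
    using lay assms(1) unfolding Tm_def by metis
  have y: "\<rho> i \<noteq> ?y" for i
    using lay unfolding layout_def by (metis less_irrefl)
  have "?y mod 3 \<noteq> 2" by presburger
  moreover from y have "?y \<notin> range \<rho>" by (metis imageE)
  ultimately have "?y \<notin> vars t" using t(1) by auto
  have "sat u \<sigma> (AllN ?y (Var ?y \<^bold>< t \<^bold>\<longrightarrow> p)) \<longleftrightarrow>
      (\<forall>x. x \<prec> f (\<lambda>i. u (\<rho> i)) \<longrightarrow> P x (\<lambda>i. u (\<rho> i)))" if "consts_ok u" for u
  proof -
    have "consts_ok (u(?y := x))" for x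
      using that unfolding consts_ok_def by auto presburger
    then show ?thesis
      using t(2)[OF that] p(2)[of "u(?y := x)" for x] y \<open>?y \<notin> vars t\<close>
      by (simp del: One_nat_def add_Suc_right)
  qed
  then show "\<exists>p\<in>Delta00. \<forall>u. consts_ok u \<longrightarrow>
      sat u \<sigma> p = (\<forall>x. x \<prec> f (\<lambda>i. u (\<rho> i)) \<longrightarrow> P x (\<lambda>i. u (\<rho> i)))"
    using p(1) \<open>?y \<notin> vars t\<close> by (intro bexI[OF _ Delta00.intros(6)[of p ?y t]]) auto
qed

lemma D0_ex_less:
  assumes "Tm f" "D0 (\<lambda>v. P (v 0) (\<lambda>i. v (Suc i)))" shows "D0 (\<lambda>v. \<exists>x. x \<prec> f v \<and> P x v)"
  using D0_not[OF D0_all_less[OF assms(1) D0_not[OF assms(2)]]] by simp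

text \<open>Indices can be replaced by indices or constants because a layout sends indices to
  variables and constants are named by variables. Composite terms are handled by
  \<open>D0_subst1\<close> and \<open>D0_subst2\<close>.\<close>

lemma D0_env:
  assumes "D0 P" and "\<And>i. (\<exists>j. g i = (\<lambda>v. v j)) \<or> (\<exists>c. g i = (\<lambda>v. c))"
  shows "D0 (\<lambda>v. P (\<lambda>i. g i v))"
  unfolding D0_def
proof (intro allI impI)
  fix n \<rho> assume lay: "layout n \<rho>"
  have "\<exists>k. (k \<in> range \<rho> \<or> k mod 3 = 2) \<and> (\<forall>u. consts_ok u \<longrightarrow> u k = g i (\<lambda>j. u (\<rho> j)))" for i
    using assms(2)[of i]
  proof
    assume "\<exists>j. g i = (\<lambda>v. v j)"
    then obtain j where "g i = (\<lambda>v. v j)" by blast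
    then show ?thesis by (intro exI[of _ "\<rho> j"]) simp
  next
    assume "\<exists>c. g i = (\<lambda>v. c)"
    then obtain c where c: "g i = (\<lambda>v. c)" by blast
    have "(3 * to_nat c + 2) mod 3 = 2" by presburger
    then show ?thesis
      using c unfolding consts_ok_def by (intro exI[of _ "3 * to_nat c + 2"]) simp
  qed
  then obtain \<rho>' where \<rho>': "\<And>i. \<rho>' i \<in> range \<rho> \<or> \<rho>' i mod 3 = 2"
    "\<And>i u. consts_ok u \<Longrightarrow> u (\<rho>' i) = g i (\<lambda>j. u (\<rho> j))"
    by metis
  have "m < n" if "\<rho>' i = 3 * m + 1" for i m
  proof -
    have "(3 * m + 1) mod 3 \<noteq> 2" by presburger
    then have "3 * m + 1 \<in> range \<rho>" using \<rho>'(1)[of i] that by auto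
    then show ?thesis using lay unfolding layout_def by (metis imageE)
  qed
  then have "layout n \<rho>'" unfolding layout_def by blast
  then show "\<exists>p\<in>Delta00. \<forall>u. consts_ok u \<longrightarrow> sat u \<sigma> p = P (\<lambda>i. g i (\<lambda>i. u (\<rho> i)))"
    using assms(1) \<rho>'(2) unfolding D0_def by fastforce
qed

lemma D0_envI:
  assumes "D0 P" and "\<And>i. (\<exists>j. g i = (\<lambda>v. v j)) \<or> (\<exists>c. g i = (\<lambda>v. c))"
    and "\<And>v i. e v i = g i v"
  shows "D0 (\<lambda>v. P (e v))"
proof -
  have "e v = (\<lambda>i. g i v)" for v using assms(3) by blast
  then show ?thesis using D0_env[OF assms(1,2)] by simp
qed

lemma D0_rename: "D0 P \<Longrightarrow> D0 (\<lambda>v. P (\<lambda>i. v (\<pi> i)))"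
  by (rule D0_envI[where g = "\<lambda>i v. v (\<pi> i)"]) auto

lemma Tm_rename:
  assumes "Tm f" shows "Tm (\<lambda>v. f (\<lambda>i. v (\<pi> i)))"
  unfolding Tm_def
proof (intro allI impI)
  fix n \<rho> assume "layout n \<rho>"
  then have "layout n (\<lambda>i. \<rho> (\<pi> i))" unfolding layout_def by blast
  then obtain t where "vars t \<subseteq> range (\<lambda>i. \<rho> (\<pi> i)) \<union> {x. x mod 3 = 2}"
    "\<And>u. consts_ok u \<Longrightarrow> val u t = f (\<lambda>i. u (\<rho> (\<pi> i)))"
    using assms unfolding Tm_def by metis
  then show "\<exists>t. vars t \<subseteq> range \<rho> \<union> {x. x mod 3 = 2} \<and>
      (\<forall>u. consts_ok u \<longrightarrow> val u t = f (\<lambda>i. u (\<rho> (\<pi> i))))"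
    by (intro exI[of _ t]) auto
qed

definition base_env :: "nat \<Rightarrow> 'a" where
  "base_env k = (if k mod 3 = 2 then from_nat (k div 3) else \<zero>)"

lemma consts_ok_base_env: "consts_ok (base_env(0 := x, 1 := y))"
proof -
  have "(3 * k + 2) mod 3 = 2" "(3 * k + 2) div 3 = k" "3 * k + 2 \<noteq> 1" for k :: nat
    by presburger+
  then show ?thesis
    unfolding consts_ok_def base_env_def by (simp del: add_2_eq_Suc')
qed

lemma S1_formula:
  assumes "S1 (\<lambda>v. P (v 0))"
  obtains p where "p \<in> Sigma01" "\<And>x. sat (base_env(0 := x)) \<sigma> p \<longleftrightarrow> P x"
proof -
  obtain Q where Q: "D0 Q" "\<And>v. P (v 0) \<longleftrightarrow> (\<exists>x. Q (case_nat x v))"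
    using assms unfolding S1_def by blast
  \<comment> \<open>The witness of the existential quantifier becomes variable 1, and the argument
    of \<open>P\<close> becomes variable 0, the one on which the schemes act; the remaining indices
    go to other multiples of 3.\<close>
  have "layout 1 (case_nat 1 (\<lambda>i. 3 * i))"
    unfolding layout_def by (auto split: nat.splits) presburger
  then obtain q where q: "q \<in> Delta00"
    "\<And>u. consts_ok u \<Longrightarrow> sat u \<sigma> q = Q (\<lambda>i. u (case_nat 1 (\<lambda>i. 3 * i) i))"
    using Q(1) unfolding D0_def by blast
  have "3 * i \<noteq> (1 :: nat)" for i by presburger
  then have "(\<lambda>i. (base_env(0 := x, 1 := y)) (case_nat 1 (\<lambda>i. 3 * i) i)) =
      case_nat y (\<lambda>i. (base_env(0 := x)) (3 * i))" for x y
    by (intro ext) (auto split: nat.splits)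
  then have "sat (base_env(0 := x, 1 := y)) \<sigma> q = Q (case_nat y (\<lambda>i. (base_env(0 := x)) (3 * i)))" for x y
    using q(2)[OF consts_ok_base_env] by simp
  then have "sat (base_env(0 := x)) \<sigma> (ExN 1 q) \<longleftrightarrow> P x" for x
    using Q(2)[of "\<lambda>i. (base_env(0 := x)) (3 * i)"] by simp
  then show ?thesis using that[of "ExN 1 q"] q(1) unfolding Sigma01_def by blast
qed

lemma S1_induct:
  assumes "S1 (\<lambda>v. P (v 0))" and "P \<zero>" and "\<And>x. P x \<Longrightarrow> P (x \<oplus> \<one>)"
  shows "P a"
proof -
  obtain p where p: "p \<in> Sigma01" "\<And>x. sat (base_env(0 := x)) \<sigma> p \<longleftrightarrow> P x"
    using S1_formula[OF assms(1)] by blast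
  have "sat base_env \<sigma> (subst 0 Zero p \<^bold>\<and> AllN 0 (p \<^bold>\<longrightarrow> subst 0 (suc (Var 0)) p) \<^bold>\<longrightarrow> AllN 0 p)"
    by (rule model) (use p(1) in \<open>auto simp: RCA0_def Sigma01_induction_def\<close>)
  then show ?thesis using assms(2,3) by (simp add: sat_subst p(2))
qed

lemma comprehension:
  assumes "D1 (\<lambda>v. P (v 0))" shows "{x. P x} \<in> range \<sigma>"
proof -
  obtain p q where p: "p \<in> Sigma01" "\<And>x. sat (base_env(0 := x)) \<sigma> p \<longleftrightarrow> P x"
    and q: "q \<in> Sigma01" "\<And>x. sat (base_env(0 := x)) \<sigma> q \<longleftrightarrow> \<not> P x"
    using S1_formula[of P] S1_formula[of "\<lambda>x. \<not> P x"] assms unfolding D1_def by metis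
  obtain y r where r: "q = ExN y r" "r \<in> Delta00"
    using q(1) unfolding Sigma01_def by blast
  \<comment> \<open>The Pi01 form of \<open>P\<close> is the negation of the Sigma01 formula for its
    complement.\<close>
  have "AllN y (\<^bold>\<not> r) \<in> Pi01"
    using r(2) unfolding Pi01_def by (auto intro: Delta00.intros)
  moreover obtain X where "X \<notin> fsv p"
    using ex_new_if_finite[of "fsv p"] by auto
  ultimately have "(AllN 0 (p \<^bold>\<longleftrightarrow> AllN y (\<^bold>\<not> r)) \<^bold>\<longrightarrow> ExS X (AllN 0 (Var 0 \<^bold>\<in> X \<^bold>\<longleftrightarrow> p))) \<in> RCA0"
    using p(1) unfolding RCA0_def Delta01_comprehension_def by blast
  from model[OF this, of \<sigma> base_env]
  have "\<exists>A\<in>range \<sigma>. \<forall>x. x \<in> A \<longleftrightarrow> sat (base_env(0 := x)) (\<sigma>(X := A)) p"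
    using p(2) q(2) r(1) by auto
  moreover have "sat u (\<sigma>(X := A)) p \<longleftrightarrow> sat u \<sigma> p" for u A
    by (rule sat_cong) (use \<open>X \<notin> fsv p\<close> in auto)
  ultimately obtain A where "A \<in> range \<sigma>" "\<And>x. x \<in> A \<longleftrightarrow> P x"
    using p(2) by auto
  then show ?thesis by (metis Collect_mem_eq Collect_cong)
qed


lemma D0_le: "Tm f \<Longrightarrow> Tm g \<Longrightarrow> D0 (\<lambda>v. f v \<preceq> g v)"
  unfolding le_def by (intro D0_disj D0_less D0_eq)

lemmas Tm_intros = Tm_index Tm_const Tm_add Tm_mult

lemmas D0_intros = Tm_intros D0_prop D0_eq D0_less D0_le D0_mem D0_not D0_conj D0_disj
  D0_iff D0_imp D0_all_less D0_ex_less

lemma S1_exI0: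
  assumes "D0 (\<lambda>v. Q (v 0) (\<lambda>i. v (Suc i)))" shows "S1 (\<lambda>v. \<exists>x. Q x v)"
  unfolding S1_def by (rule exI, rule conjI[OF assms]) simp

lemma D0_S1: "D0 P \<Longrightarrow> S1 P"
  using S1_exI0[of "\<lambda>x. P"] D0_rename[of P Suc] by simp

lemma D0_D1: "D0 P \<Longrightarrow> D1 P"
  unfolding D1_def using D0_S1 D0_not by blast

lemma D0_induct:
  assumes "D0 (\<lambda>v. P (v 0))" and "P \<zero>" and "\<And>x. P x \<Longrightarrow> P (x \<oplus> \<one>)" shows "P a"
  using S1_induct[OF D0_S1] assms by blast


subsection \<open>The ordered semiring\<close>

lemma zero_add: "\<zero> \<oplus> a = a"
  by (rule D0_induct[where P = "\<lambda>a. \<zero> \<oplus> a = a"])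
    (intro D0_intros, auto simp: add_zero add_suc)

lemma add_assoc': "a \<oplus> b \<oplus> c = a \<oplus> (b \<oplus> c)"
  by (rule D0_induct[where P = "\<lambda>c. a \<oplus> b \<oplus> c = a \<oplus> (b \<oplus> c)"])
    (intro D0_intros, auto simp: add_zero add_suc)

lemma one_add: "\<one> \<oplus> a = a \<oplus> \<one>"
  by (rule D0_induct[where P = "\<lambda>a. \<one> \<oplus> a = a \<oplus> \<one>"])
    (intro D0_intros, auto simp: add_zero zero_add add_suc)

lemma add_commute': "a \<oplus> b = b \<oplus> a"
proof (rule D0_induct[where P = "\<lambda>b. a \<oplus> b = b \<oplus> a"])
  fix x assume "a \<oplus> x = x \<oplus> a"
  then show "a \<oplus> (x \<oplus> \<one>) = x \<oplus> \<one> \<oplus> a"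
    by (metis add_suc add_assoc' one_add)
qed (intro D0_intros, auto simp: add_zero zero_add)

lemma add_left_commute': "a \<oplus> (b \<oplus> c) = b \<oplus> (a \<oplus> c)"
  by (metis add_assoc' add_commute')

lemma add_right_cancel': "a \<oplus> c = b \<oplus> c \<longleftrightarrow> a = b"
  by (rule D0_induct[where P = "\<lambda>c. a \<oplus> c = b \<oplus> c \<longleftrightarrow> a = b"])
    (intro D0_intros, auto simp: add_zero add_suc dest: suc_inject)

lemma add_left_cancel': "c \<oplus> a = c \<oplus> b \<Longrightarrow> a = b"
  using add_right_cancel' add_commute' by metis

lemma zero_mult: "\<zero> \<otimes> a = \<zero>"
  by (rule D0_induct[where P = "\<lambda>a. \<zero> \<otimes> a = \<zero>"])
    (intro D0_intros, auto simp: mult_zero mult_suc add_zero)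

lemma suc_mult: "(a \<oplus> \<one>) \<otimes> b = a \<otimes> b \<oplus> b"
proof (rule D0_induct[where P = "\<lambda>b. (a \<oplus> \<one>) \<otimes> b = a \<otimes> b \<oplus> b"])
  fix x assume "(a \<oplus> \<one>) \<otimes> x = a \<otimes> x \<oplus> x"
  then show "(a \<oplus> \<one>) \<otimes> (x \<oplus> \<one>) = a \<otimes> (x \<oplus> \<one>) \<oplus> (x \<oplus> \<one>)"
    by (simp only: mult_suc) (simp only: add_assoc' add_left_commute' add_commute')
qed (intro D0_intros, auto simp: mult_zero add_zero)

lemma mult_commute': "a \<otimes> b = b \<otimes> a"
  by (rule D0_induct[where P = "\<lambda>b. a \<otimes> b = b \<otimes> a"])
    (intro D0_intros, auto simp: mult_zero zero_mult mult_suc suc_mult)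

lemma distrib_right': "(a \<oplus> b) \<otimes> c = a \<otimes> c \<oplus> b \<otimes> c"
proof (rule D0_induct[where P = "\<lambda>c. (a \<oplus> b) \<otimes> c = a \<otimes> c \<oplus> b \<otimes> c"])
  fix x assume "(a \<oplus> b) \<otimes> x = a \<otimes> x \<oplus> b \<otimes> x"
  then show "(a \<oplus> b) \<otimes> (x \<oplus> \<one>) = a \<otimes> (x \<oplus> \<one>) \<oplus> b \<otimes> (x \<oplus> \<one>)"
    by (simp only: mult_suc) (simp only: add_assoc' add_left_commute' add_commute')
qed (intro D0_intros, auto simp: mult_zero add_zero)

lemma mult_assoc': "a \<otimes> b \<otimes> c = a \<otimes> (b \<otimes> c)"
proof (rule D0_induct[where P = "\<lambda>c. a \<otimes> b \<otimes> c = a \<otimes> (b \<otimes> c)"])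
  fix x assume "a \<otimes> b \<otimes> x = a \<otimes> (b \<otimes> x)"
  then show "a \<otimes> b \<otimes> (x \<oplus> \<one>) = a \<otimes> (b \<otimes> (x \<oplus> \<one>))"
    by (metis mult_suc distrib_right' mult_commute')
qed (intro D0_intros, auto simp: mult_zero)

lemma one_mult: "\<one> \<otimes> a = a"
  using suc_mult[of \<zero> a] by (simp add: zero_add zero_mult)

lemma zero_or_suc: "a = \<zero> \<or> (\<exists>b. a = b \<oplus> \<one>)"
  by (rule S1_induct[where P = "\<lambda>a. a = \<zero> \<or> (\<exists>b. a = b \<oplus> \<one>)"])
    (unfold ex_simps[symmetric], intro S1_exI0 D0_intros, auto)

lemma less_add_suc: "a \<prec> a \<oplus> (c \<oplus> \<one>)"
  by (rule D0_induct[where P = "\<lambda>c. a \<prec> a \<oplus> (c \<oplus> \<one>)"])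
    (intro D0_intros, auto simp: zero_add add_suc less_suc_iff)

lemma less_iff_add: "a \<prec> b \<longleftrightarrow> (\<exists>c. b = a \<oplus> (c \<oplus> \<one>))"
proof
  \<comment> \<open>The implication stands under the existential quantifier, so that the induction
    formula has the form required by \<open>S1_exI0\<close>; the witness is arbitrary when the
    premise fails.\<close>
  have "\<exists>c. a \<prec> b \<longrightarrow> b = a \<oplus> (c \<oplus> \<one>)"
  proof (rule S1_induct[where P = "\<lambda>b. \<exists>c. a \<prec> b \<longrightarrow> b = a \<oplus> (c \<oplus> \<one>)"])
    fix b assume "\<exists>c. a \<prec> b \<longrightarrow> b = a \<oplus> (c \<oplus> \<one>)"
    then obtain c where "a \<prec> b \<Longrightarrow> b = a \<oplus> (c \<oplus> \<one>)" by blast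
    then have "b \<oplus> \<one> = a \<oplus> (c \<oplus> \<one> \<oplus> \<one>) \<or> b \<oplus> \<one> = a \<oplus> (\<zero> \<oplus> \<one>)" if "a \<prec> b \<oplus> \<one>"
      using that by (auto simp: less_suc_iff zero_add add_assoc')
    then show "\<exists>c. a \<prec> b \<oplus> \<one> \<longrightarrow> b \<oplus> \<one> = a \<oplus> (c \<oplus> \<one>)" by blast
  qed (intro S1_exI0 D0_intros, auto simp: not_less_zero)
  then show "a \<prec> b \<Longrightarrow> \<exists>c. b = a \<oplus> (c \<oplus> \<one>)" by blast
qed (auto simp: less_add_suc)

lemma less_irrefl': "\<not> a \<prec> a"
proof
  assume "a \<prec> a"
  then obtain c where "a \<oplus> \<zero> = a \<oplus> (c \<oplus> \<one>)" unfolding less_iff_add by (auto simp: add_zero)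
  then show False using add_left_cancel' suc_neq_zero by metis
qed

lemma less_trans': "a \<prec> b \<Longrightarrow> b \<prec> c \<Longrightarrow> a \<prec> c"
proof -
  assume "a \<prec> b" "b \<prec> c"
  then obtain x y where "b = a \<oplus> (x \<oplus> \<one>)" "c = b \<oplus> (y \<oplus> \<one>)"
    unfolding less_iff_add by blast
  then have "c = a \<oplus> (x \<oplus> \<one> \<oplus> y \<oplus> \<one>)" by (simp add: add_assoc')
  then show ?thesis unfolding less_iff_add by blast
qed

lemma zero_less_suc: "\<zero> \<prec> a \<oplus> \<one>"
  unfolding less_iff_add by (auto simp: zero_add)

lemma less_linear': "a \<prec> b \<or> a = b \<or> b \<prec> a"
proof (rule D0_induct[where P = "\<lambda>a. a \<prec> b \<or> a = b \<or> b \<prec> a"])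
  show "\<zero> \<prec> b \<or> \<zero> = b \<or> b \<prec> \<zero>"
    using zero_or_suc[of b] zero_less_suc by auto
next
  fix a assume "a \<prec> b \<or> a = b \<or> b \<prec> a"
  then consider "a \<prec> b" | "a = b \<or> b \<prec> a" by blast
  then show "a \<oplus> \<one> \<prec> b \<or> a \<oplus> \<one> = b \<or> b \<prec> a \<oplus> \<one>"
  proof cases
    case 1
    then obtain c where c: "b = a \<oplus> (c \<oplus> \<one>)" unfolding less_iff_add by blast
    from zero_or_suc[of c] show ?thesis
    proof
      assume "\<exists>d. c = d \<oplus> \<one>"
      then have "a \<oplus> \<one> \<prec> b"
        using c unfolding less_iff_add[of "a \<oplus> \<one>"] by (metis add_assoc' add_commute')
      then show ?thesis by simp
    qed (use c in \<open>simp add: zero_add\<close>)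
  qed (auto simp: less_suc_iff)
qed (intro D0_intros)

lemma le_iff_add': "a \<preceq> b \<longleftrightarrow> (\<exists>c. b = a \<oplus> c)"
  unfolding le_def less_iff_add using zero_or_suc add_zero by metis

lemma add_less_left: "a \<prec> b \<Longrightarrow> c \<oplus> a \<prec> c \<oplus> b"
  unfolding less_iff_add using add_assoc' by metis

lemma mult_less_left: "a \<prec> b \<Longrightarrow> \<zero> \<prec> c \<Longrightarrow> c \<otimes> a \<prec> c \<otimes> b"
proof -
  assume "a \<prec> b" "\<zero> \<prec> c"
  then obtain d e where "b = d \<oplus> \<one> \<oplus> a" "c = e \<oplus> \<one>"
    unfolding less_iff_add by (metis zero_add add_commute')
  then have "c \<otimes> b = c \<otimes> d \<oplus> (e \<oplus> \<one>) \<oplus> c \<otimes> a"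
    by (metis mult_commute' distrib_right' mult_suc)
  then have "c \<otimes> b = c \<otimes> a \<oplus> (c \<otimes> d \<oplus> e \<oplus> \<one>)"
    by (simp only: add_assoc' add_left_commute' add_commute')
  then show ?thesis unfolding less_iff_add by blast
qed

text \<open>Truncated subtraction is demanded by \<open>linordered_semidom\<close>; it is no term of
  the language and therefore has no rule among \<open>Tm_intros\<close>.\<close>

definition mns :: "'a \<Rightarrow> 'a \<Rightarrow> 'a" where
  "mns a b = (if b \<preceq> a then THE c. a = b \<oplus> c else \<zero>)"

lemma mns_add [simp]: "mns (b \<oplus> c) b = c"
proof -
  have "b \<preceq> b \<oplus> c" unfolding le_iff_add' by blast
  then show ?thesis
    unfolding mns_def using add_left_cancel' by auto
qed

lemma mns_self [simp]: "mns a a = \<zero>"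
  using mns_add[of a \<zero>] by (simp add: add_zero)

lemma le_or_less: "a \<preceq> b \<or> b \<prec> a"
  using less_linear' unfolding le_def by blast

lemma not_le_iff: "\<not> a \<preceq> b \<longleftrightarrow> b \<prec> a"
  using le_or_less less_irrefl' less_trans' unfolding le_def by blast

lemma mns_zero: "\<not> b \<preceq> a \<Longrightarrow> mns a b = \<zero>"
  by (simp add: mns_def)

lemma mns_mns: "mns (mns a b) c = mns a (b \<oplus> c)"
proof (cases "b \<preceq> a")
  case True
  then obtain d where d: "a = b \<oplus> d" unfolding le_iff_add' by blast
  show ?thesis
  proof (cases "c \<preceq> d")
    case True
    then obtain e where "d = c \<oplus> e" unfolding le_iff_add' by blast
    then show ?thesis using d mns_add add_assoc' by metis
  next
    case False
    then have "\<not> b \<oplus> c \<preceq> a" using d by (simp add: not_le_iff add_less_left)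
    then show ?thesis using d False by (simp add: mns_zero)
  qed
next
  case False
  then have "\<not> b \<oplus> c \<preceq> a"
    unfolding le_iff_add' by (metis add_assoc')
  moreover have "mns \<zero> c = \<zero>"
    by (cases "c = \<zero>") (auto simp: mns_zero le_def not_less_zero)
  ultimately show ?thesis using False by (simp add: mns_zero)
qed

lemma mult_mns: "a \<otimes> mns b c = mns (a \<otimes> b) (a \<otimes> c)"
proof (cases "c \<preceq> b")
  case True
  then obtain d where "b = c \<oplus> d" unfolding le_iff_add' by blast
  then show ?thesis by (simp add: mult_commute'[of a] distrib_right')
next
  case False
  show ?thesis
  proof (cases "a = \<zero>")
    case False
    then have "a \<otimes> b \<prec> a \<otimes> c"
      using \<open>\<not> c \<preceq> b\<close> mult_less_left not_le_iff le_or_less[of a \<zero>]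
      by (auto simp: le_def not_less_zero)
    then show ?thesis using \<open>\<not> c \<preceq> b\<close> by (simp add: mns_zero mult_zero not_le_iff)
  qed (simp add: zero_mult)
qed

lemma le_order:
  "a \<prec> b \<longleftrightarrow> a \<preceq> b \<and> \<not> b \<preceq> a" "a \<preceq> a"
  "a \<preceq> b \<Longrightarrow> b \<preceq> c \<Longrightarrow> a \<preceq> c" "a \<preceq> b \<Longrightarrow> b \<preceq> a \<Longrightarrow> a = b"
  "a \<preceq> b \<or> b \<preceq> a" "a \<preceq> b \<Longrightarrow> c \<oplus> a \<preceq> c \<oplus> b"
  unfolding le_def using less_irrefl' less_trans' less_linear' add_less_left by blast+

lemma distrib_left': "c \<otimes> (a \<oplus> b) = c \<otimes> a \<oplus> c \<otimes> b"
  by (simp add: mult_commute'[of c] distrib_right')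

lemma zero_less_one': "\<zero> \<prec> \<one>" and zero_neq_one': "\<zero> \<noteq> \<one>" "\<one> \<noteq> \<zero>"
  using zero_less_suc[of \<zero>] less_irrefl' by (auto simp: zero_add)

lemma neq_zero_iff: "a \<noteq> \<zero> \<longleftrightarrow> \<zero> \<prec> a"
  using zero_or_suc[of a] zero_less_suc less_irrefl' by auto

lemma mult_neq_zero': "a \<noteq> \<zero> \<Longrightarrow> b \<noteq> \<zero> \<Longrightarrow> a \<otimes> b \<noteq> \<zero>"
  using mult_less_left[of \<zero> b a] by (simp add: neq_zero_iff mult_zero)

lemma mns_inverse: "b \<preceq> a \<Longrightarrow> mns a b \<oplus> b = a"
  using add_commute' unfolding le_iff_add' by (metis mns_add)

sublocale arith: linordered_semidom
  where plus = pl and zero = zr and one = on and times = tm and minus = mns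
    and less_eq = le and less = ls
  by (unfold_locales; (fact add_assoc' add_commute' mns_add mns_mns mult_mns le_order
        distrib_right' distrib_left' mult_assoc' mult_commute' zero_add add_zero one_mult zero_mult mult_zero
        zero_less_one' zero_neq_one' mult_neq_zero' mns_inverse mult_less_left)?)
lemma less_suc_le: "a \<prec> b \<oplus> \<one> \<longleftrightarrow> a \<preceq> b"
  by (simp add: less_suc_iff le_def)

lemma suc_le_iff: "a \<oplus> \<one> \<preceq> b \<longleftrightarrow> a \<prec> b"
  by (metis arith.not_less less_suc_le)

lemma zero_le [simp]: "\<zero> \<preceq> a"
  unfolding le_iff_add' by simp

lemma not_less_zero_simp [simp]: "\<not> a \<prec> \<zero>"
  by (rule not_less_zero)

lemma le_add_left [simp]: "a \<preceq> a \<oplus> b" and le_add_right [simp]: "b \<preceq> a \<oplus> b"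
  unfolding le_iff_add' using add_commute' by blast+


subsection \<open>Closure properties and collection\<close>

lemma D0_all_le:
  assumes "Tm f" "D0 (\<lambda>v. P (v 0) (\<lambda>i. v (Suc i)))" shows "D0 (\<lambda>v. \<forall>x. x \<preceq> f v \<longrightarrow> P x v)"
  using D0_all_less[OF Tm_add[OF assms(1) Tm_one] assms(2)] by (simp add: less_suc_le)

lemma D0_ex_le:
  assumes "Tm f" "D0 (\<lambda>v. P (v 0) (\<lambda>i. v (Suc i)))" shows "D0 (\<lambda>v. \<exists>x. x \<preceq> f v \<and> P x v)"
  using D0_ex_less[OF Tm_add[OF assms(1) Tm_one] assms(2)] by (simp add: less_suc_le)

text \<open>Two unbounded existential quantifiers become one by bounding both witnesses by their
  sum.\<close>

lemma S1_exI:
  assumes "S1 (\<lambda>v. P (v 0) (\<lambda>i. v (Suc i)))" shows "S1 (\<lambda>v. \<exists>x. P x v)"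
proof -
  obtain Q where Q: "D0 Q" "\<And>v. P (v 0) (\<lambda>i. v (Suc i)) \<longleftrightarrow> (\<exists>y. Q (case_nat y v))"
    using assms unfolding S1_def by blast
  have P_iff: "P x v \<longleftrightarrow> (\<exists>y. Q (case_nat y (case_nat x v)))" for x v
    using Q(2)[of "case_nat x v"] by simp
  have "D0 (\<lambda>v. Q (case_nat (v 0) (case_nat (v 1) (\<lambda>i. v (Suc (Suc (Suc i)))))))"
    by (rule D0_envI[OF Q(1), where
          g = "case_nat (\<lambda>v. v 0) (case_nat (\<lambda>v. v 1) (\<lambda>i v. v (Suc (Suc (Suc i)))))"])
      (auto split: nat.splits)
  then have "S1 (\<lambda>v. \<exists>z. \<exists>x. x \<preceq> z \<and> (\<exists>y. y \<preceq> z \<and> Q (case_nat y (case_nat x v))))"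
    by (intro S1_exI0 D0_ex_le Tm_intros) simp
  moreover have "(\<exists>x. P x v) \<longleftrightarrow> (\<exists>z. \<exists>x. x \<preceq> z \<and> (\<exists>y. y \<preceq> z \<and> Q (case_nat y (case_nat x v))))" for v
    unfolding P_iff using le_add_left le_add_right by blast
  ultimately show ?thesis by simp
qed

lemma S1_rename:
  assumes "S1 P" shows "S1 (\<lambda>v. P (\<lambda>i. v (\<pi> i)))"
proof -
  obtain Q where Q: "D0 Q" "\<And>v. P v \<longleftrightarrow> (\<exists>y. Q (case_nat y v))"
    using assms unfolding S1_def by blast
  have "D0 (\<lambda>v. Q (case_nat (v 0) (\<lambda>i. v (Suc (\<pi> i)))))"
    by (rule D0_envI[OF Q(1), where g = "case_nat (\<lambda>v. v 0) (\<lambda>i v. v (Suc (\<pi> i)))"])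
      (auto split: nat.splits)
  then show ?thesis unfolding Q(2) by (rule S1_exI0)
qed

lemma S1_conj:
  assumes "S1 P" "S1 P'" shows "S1 (\<lambda>v. P v \<and> P' v)"
proof -
  obtain Q Q' where Q: "D0 Q" "\<And>v. P v \<longleftrightarrow> (\<exists>y. Q (case_nat y v))"
    "D0 Q'" "\<And>v. P' v \<longleftrightarrow> (\<exists>y. Q' (case_nat y v))"
    using assms unfolding S1_def by blast
  have "D0 (\<lambda>v. Q (case_nat (v 0) (\<lambda>i. v (Suc (Suc i)))))"
    by (rule D0_envI[OF Q(1), where g = "case_nat (\<lambda>v. v 0) (\<lambda>i v. v (Suc (Suc i)))"])
      (auto split: nat.splits)
  moreover have "D0 (\<lambda>v. Q' (case_nat (v 1) (\<lambda>i. v (Suc (Suc i)))))"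
    by (rule D0_envI[OF Q(3), where g = "case_nat (\<lambda>v. v 1) (\<lambda>i v. v (Suc (Suc i)))"])
      (auto split: nat.splits)
  ultimately have "S1 (\<lambda>v. \<exists>x. \<exists>y. Q (case_nat y v) \<and> Q' (case_nat x v))"
    by (intro S1_exI S1_exI0 D0_conj) simp_all
  then show ?thesis unfolding Q(2,4) by (simp add: conj_commute)
qed

lemma S1_disj:
  assumes "S1 P" "S1 P'" shows "S1 (\<lambda>v. P v \<or> P' v)"
proof -
  obtain Q Q' where Q: "D0 Q" "\<And>v. P v \<longleftrightarrow> (\<exists>y. Q (case_nat y v))"
    "D0 Q'" "\<And>v. P' v \<longleftrightarrow> (\<exists>y. Q' (case_nat y v))"
    using assms unfolding S1_def by blast
  have "S1 (\<lambda>v. \<exists>y. Q (case_nat y v) \<or> Q' (case_nat y v))"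
    using D0_disj[OF Q(1,3)] unfolding S1_def by blast
  then show ?thesis unfolding Q(2,4) by (simp add: ex_disj_distrib)
qed

text \<open>Sigma01 induction on \<open>c\<close>: a bound for the arguments below \<open>c\<close>
  is enlarged by the witness for \<open>c\<close>. The guard \<open>x \<prec> a\<close> lets the
  induction run past \<open>a\<close>, where no witness need exist.\<close>

lemma D0_collection:
  assumes "D0 (\<lambda>v. R (v 0) (v 1))" and "\<And>x. x \<prec> a \<Longrightarrow> \<exists>y. R x y"
  shows "\<exists>b. \<forall>x. x \<prec> a \<longrightarrow> (\<exists>y. y \<preceq> b \<and> R x y)"
proof -
  have "D0 (\<lambda>v. R (v 0) (v 2))"
    using D0_rename[OF assms(1), of "case_nat 0 (\<lambda>_. 2)"] by simp
  have "\<exists>b. \<forall>x. x \<prec> c \<longrightarrow> x \<prec> a \<longrightarrow> (\<exists>y. y \<preceq> b \<and> R x y)" for c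
  proof (rule S1_induct[where
        P = "\<lambda>c. \<exists>b. \<forall>x. x \<prec> c \<longrightarrow> x \<prec> a \<longrightarrow> (\<exists>y. y \<preceq> b \<and> R x y)"])
    have "D0 (\<lambda>v. R (v 1) (v 0))"
      using D0_rename[OF assms(1), of "case_nat 1 (\<lambda>_. 0)"] by simp
    then show "S1 (\<lambda>v. \<exists>b. \<forall>x. x \<prec> v 0 \<longrightarrow> x \<prec> a \<longrightarrow> (\<exists>y. y \<preceq> b \<and> R x y))"
      by (intro S1_exI0 D0_all_less D0_imp D0_less D0_ex_le Tm_intros) simp
  next
    fix c assume "\<exists>b. \<forall>x. x \<prec> c \<longrightarrow> x \<prec> a \<longrightarrow> (\<exists>y. y \<preceq> b \<and> R x y)"
    then obtain b where b: "\<And>x. x \<prec> c \<Longrightarrow> x \<prec> a \<Longrightarrow> \<exists>y. y \<preceq> b \<and> R x y" by blast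
    obtain d where d: "c \<prec> a \<Longrightarrow> R c d" using assms(2) by blast
    have "\<exists>y. y \<preceq> b \<oplus> d \<and> R x y" if "x \<prec> c \<oplus> \<one>" "x \<prec> a" for x
      using that b[of x] d le_add_right[of d b] le_add_left[of b d] arith.order_trans
      unfolding less_suc_iff by blast
    then show "\<exists>b. \<forall>x. x \<prec> c \<oplus> \<one> \<longrightarrow> x \<prec> a \<longrightarrow> (\<exists>y. y \<preceq> b \<and> R x y)" by blast
  qed simp
  then show ?thesis using assms(2) arith.less_trans by blast
qed

text \<open>Collection turns a bounded universal quantifier in front of an existential one into an
  existential quantifier over a bound, with a bounded matrix.\<close>

lemma S1_all_less:
  assumes "Tm f" "S1 (\<lambda>v. P (v 0) (\<lambda>i. v (Suc i)))" shows "S1 (\<lambda>v. \<forall>x. x \<prec> f v \<longrightarrow> P x v)"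
proof -
  obtain Q where Q: "D0 Q" "\<And>v. P (v 0) (\<lambda>i. v (Suc i)) \<longleftrightarrow> (\<exists>y. Q (case_nat y v))"
    using assms unfolding S1_def by blast
  have P_iff: "P x v \<longleftrightarrow> (\<exists>y. Q (case_nat y (case_nat x v)))" for x v
    using Q(2)[of "case_nat x v"] by simp
  have "D0 (\<lambda>w. Q (case_nat (w 1) (case_nat (w 0) v)))" for v
    by (rule D0_envI[OF Q(1), where g = "case_nat (\<lambda>w. w 1) (case_nat (\<lambda>w. w 0) (\<lambda>i w. v i))"])
      (auto split: nat.splits)
  then have "(\<forall>x. x \<prec> f v \<longrightarrow> P x v) \<longleftrightarrow>
      (\<exists>b. \<forall>x. x \<prec> f v \<longrightarrow> (\<exists>y. y \<preceq> b \<and> Q (case_nat y (case_nat x v))))" for v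
    unfolding P_iff using D0_collection[of "\<lambda>x y. Q (case_nat y (case_nat x v))" "f v"] by blast
  moreover have "D0 (\<lambda>v. Q (case_nat (v 0) (case_nat (v 1) (\<lambda>i. v (Suc (Suc (Suc i)))))))"
    by (rule D0_envI[OF Q(1), where
          g = "case_nat (\<lambda>v. v 0) (case_nat (\<lambda>v. v 1) (\<lambda>i v. v (Suc (Suc (Suc i)))))"])
      (auto split: nat.splits)
  then have "S1 (\<lambda>v. \<exists>b. \<forall>x. x \<prec> f v \<longrightarrow> (\<exists>y. y \<preceq> b \<and> Q (case_nat y (case_nat x v))))"
    using Tm_rename[OF assms(1), of Suc]
    by (intro S1_exI0 D0_all_less D0_ex_le Tm_intros) simp_all
  ultimately show ?thesis by simp
qed

lemma S1_ex_less:
  assumes "Tm f" "S1 (\<lambda>v. P (v 0) (\<lambda>i. v (Suc i)))" shows "S1 (\<lambda>v. \<exists>x. x \<prec> f v \<and> P x v)"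
  using Tm_rename[OF assms(1), of Suc] assms(2)
  by (intro S1_exI S1_conj) (auto intro!: D0_S1 D0_less Tm_index)

lemma D1_not: "D1 P \<Longrightarrow> D1 (\<lambda>v. \<not> P v)"
  unfolding D1_def by simp

lemma D1_conj: "D1 P \<Longrightarrow> D1 Q \<Longrightarrow> D1 (\<lambda>v. P v \<and> Q v)"
  unfolding D1_def de_Morgan_conj using S1_conj S1_disj by blast

lemma D1_all_less:
  assumes "Tm f" "D1 (\<lambda>v. P (v 0) (\<lambda>i. v (Suc i)))" shows "D1 (\<lambda>v. \<forall>x. x \<prec> f v \<longrightarrow> P x v)"
  using assms S1_all_less[of f P] S1_ex_less[of f "\<lambda>x v. \<not> P x v"] unfolding D1_def by simp

lemma D1_ex_less:
  assumes "Tm f" "D1 (\<lambda>v. P (v 0) (\<lambda>i. v (Suc i)))" shows "D1 (\<lambda>v. \<exists>x. x \<prec> f v \<and> P x v)"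
  using D1_not[OF D1_all_less[OF assms(1) D1_not[OF assms(2)]]] by simp

text \<open>A composite term is introduced through a quantifier bounded by the term itself, since
  \<open>D0_env\<close> inserts only indices and constants.\<close>

lemma D0_subst1:
  assumes "D0 (\<lambda>v. P (v 0))" "Tm f" shows "D0 (\<lambda>v. P (f v))"
proof -
  have "D0 (\<lambda>v. \<exists>x. x \<preceq> f v \<and> x = f v \<and> P x)"
    using assms Tm_rename[OF assms(2), of Suc] by (intro D0_ex_le D0_conj D0_eq Tm_intros) auto
  then show ?thesis by simp
qed

lemma least_element:
  assumes "D0 (\<lambda>v. P (v 0))" "P a"
  obtains m where "P m" "\<And>x. x \<prec> m \<Longrightarrow> \<not> P x"
proof -
  have "\<exists>m. P m \<and> (\<forall>x. x \<prec> m \<longrightarrow> \<not> P x)"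
  proof (rule ccontr)
    assume none: "\<not> ?thesis"
    have "\<forall>x. x \<prec> b \<longrightarrow> \<not> P x" for b
    proof (rule D0_induct[where P = "\<lambda>b. \<forall>x. x \<prec> b \<longrightarrow> \<not> P x"])
      show "D0 (\<lambda>v. \<forall>x. x \<prec> v 0 \<longrightarrow> \<not> P x)"
        by (intro D0_all_less D0_not assms(1) Tm_intros)
    qed (use none less_suc_iff in auto)
    then show False using assms(2) zero_less_one' less_suc_iff by blast
  qed
  then show ?thesis using that by blast
qed


lemmas D0_bounded_intros = D0_intros D0_all_le D0_ex_le

lemma D0_subst2:
  assumes "D0 (\<lambda>v. R (v 0) (v 1))" "Tm f" "Tm g" shows "D0 (\<lambda>v. R (f v) (g v))"
proof -
  have "D0 (\<lambda>v. R (v 1) (v 0))"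
    using D0_rename[OF assms(1), of "case_nat 1 (\<lambda>_. 0)"] by simp
  then have "D0 (\<lambda>v. \<exists>x. x \<preceq> f v \<and> (\<exists>y. y \<preceq> g v \<and> x = f v \<and> y = g v \<and> R x y))"
    using Tm_rename[OF assms(3), of Suc] Tm_rename[OF assms(2), of "\<lambda>i. Suc (Suc i)"]
      Tm_rename[OF assms(3), of "\<lambda>i. Suc (Suc i)"]
    by (intro D0_ex_le D0_conj D0_eq Tm_intros assms(2)) auto
  moreover have "(\<exists>x. x \<preceq> f v \<and> (\<exists>y. y \<preceq> g v \<and> x = f v \<and> y = g v \<and> R x y)) \<longleftrightarrow> R (f v) (g v)" for v
    by auto
  ultimately show ?thesis by simp
qed


subsection \<open>Pairs and divisibility\<close>

definition pair :: "'a \<Rightarrow> 'a \<Rightarrow> 'a" where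
  "pair a b = (a \<oplus> b) \<otimes> (a \<oplus> b) \<oplus> a"

lemma Tm_pair: "Tm f \<Longrightarrow> Tm g \<Longrightarrow> Tm (\<lambda>v. pair (f v) (g v))"
  unfolding pair_def by (intro Tm_add Tm_mult)

lemma le_square: "a \<preceq> a \<otimes> a"
  using zero_or_suc[of a] by (auto simp: mult_suc)

lemma le_pair: "a \<preceq> pair a b" "b \<preceq> pair a b"
proof -
  show "a \<preceq> pair a b" unfolding pair_def by simp
  have "b \<preceq> a \<oplus> b" "a \<oplus> b \<preceq> (a \<oplus> b) \<otimes> (a \<oplus> b)" "(a \<oplus> b) \<otimes> (a \<oplus> b) \<preceq> pair a b"
    unfolding pair_def by (auto intro: le_square)
  then show "b \<preceq> pair a b" using arith.order_trans by blast
qed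

text \<open>\<open>pair a b\<close> lies between the square of \<open>a \<oplus> b\<close> and the
  next square, so the sum can be recovered from the code.\<close>

lemma pair_less_if_sum_less:
  assumes "a \<oplus> b \<prec> c \<oplus> d" shows "pair a b \<prec> pair c d"
proof -
  let ?s = "a \<oplus> b"
  have "?s \<oplus> \<one> \<preceq> c \<oplus> d" using assms by (simp add: suc_le_iff)
  then have "(?s \<oplus> \<one>) \<otimes> (?s \<oplus> \<one>) \<preceq> (c \<oplus> d) \<otimes> (c \<oplus> d)"
    by (intro arith.mult_mono) auto
  moreover have "(?s \<oplus> \<one>) \<otimes> (?s \<oplus> \<one>) = pair a b \<oplus> (b \<oplus> ?s \<oplus> \<one>)"
    unfolding pair_def by (simp add: algebra_simps del: arith.one_add_one)
  then have "pair a b \<prec> (?s \<oplus> \<one>) \<otimes> (?s \<oplus> \<one>)"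
    unfolding less_iff_add by auto
  moreover have "(c \<oplus> d) \<otimes> (c \<oplus> d) \<preceq> pair c d"
    unfolding pair_def by simp
  ultimately show ?thesis
    using arith.less_le_trans by blast
qed

lemma pair_inject [simp]: "pair a b = pair c d \<longleftrightarrow> a = c \<and> b = d"
proof
  assume eq: "pair a b = pair c d"
  then have "a \<oplus> b = c \<oplus> d"
    using pair_less_if_sum_less[of a b c d] pair_less_if_sum_less[of c d a b]
    by (metis arith.linorder_cases arith.less_irrefl)
  with eq show "a = c \<and> b = d" unfolding pair_def by simp
qed simp

lemma pair_mono: "a \<preceq> c \<Longrightarrow> b \<preceq> d \<Longrightarrow> pair a b \<preceq> pair c d"
  unfolding pair_def by (intro arith.add_mono arith.mult_mono) auto

definition dv :: "'a \<Rightarrow> 'a \<Rightarrow> bool" where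
  "dv a b \<longleftrightarrow> (\<exists>q. b = a \<otimes> q)"

lemma dv_refl [simp]: "dv a a"
  unfolding dv_def by (metis arith.mult_1_right)

lemma dv_mult: "dv a b \<Longrightarrow> dv a (b \<otimes> c)"
  unfolding dv_def by (metis arith.mult.assoc)

lemma dv_mult_left: "dv a b \<Longrightarrow> dv a (c \<otimes> b)"
  using dv_mult by (simp add: arith.mult.commute)

lemma le_mult: "b \<noteq> \<zero> \<Longrightarrow> a \<preceq> a \<otimes> b"
  using zero_or_suc[of b] by (auto simp: mult_suc)

lemma dv_le: "dv a b \<Longrightarrow> b \<noteq> \<zero> \<Longrightarrow> a \<preceq> b"
  unfolding dv_def by (metis le_mult arith.mult_zero_right)

lemma dv_add_cancel: "dv a (b \<oplus> c) \<Longrightarrow> dv a b \<Longrightarrow> dv a c"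
proof (cases "a = \<zero>")
  case False
  assume "dv a (b \<oplus> c)" "dv a b"
  then obtain q r where q: "b = a \<otimes> q" and r: "b \<oplus> c = a \<otimes> r"
    unfolding dv_def by blast
  have "a \<otimes> q \<preceq> a \<otimes> r" using q r le_add_left by metis
  then have "q \<preceq> r"
    using False arith.mult_left_le_imp_le neq_zero_iff by blast
  then obtain s where "r = q \<oplus> s" unfolding le_iff_add' by blast
  then show ?thesis
    unfolding dv_def using q r arith.distrib_left arith.add_left_cancel by metis
next
  case True
  assume "dv a (b \<oplus> c)" "dv a b"
  then have "b \<oplus> c = \<zero>" using True unfolding dv_def by auto
  then have "c = \<zero>" using le_add_right[of c b] by (simp add: le_def)
  then show ?thesis using True by simp
qed

lemma dv_bounded: "dv a b \<longleftrightarrow> (\<exists>q. q \<preceq> b \<and> b = a \<otimes> q)"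
proof
  assume "dv a b"
  then obtain q where q: "b = a \<otimes> q" unfolding dv_def by blast
  show "\<exists>q. q \<preceq> b \<and> b = a \<otimes> q"
  proof (cases "a = \<zero>")
    case True
    then show ?thesis using q by (intro exI[of _ \<zero>]) simp
  next
    case False
    then show ?thesis using q le_mult[of a q] by (auto simp: arith.mult.commute)
  qed
qed (auto simp: dv_def)

lemma D0_dv: "Tm f \<Longrightarrow> Tm g \<Longrightarrow> D0 (\<lambda>v. dv (f v) (g v))"
proof (rule D0_subst2)
  show "D0 (\<lambda>v. dv (v 0) (v 1))"
    unfolding dv_bounded by (intro D0_bounded_intros)
qed


subsection \<open>Codes of finite sets\<close>

definition beta :: "'a \<Rightarrow> 'a \<Rightarrow> 'a" where
  "beta m i = m \<otimes> (i \<oplus> \<one>) \<oplus> \<one>"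

lemma Tm_beta: "Tm f \<Longrightarrow> Tm g \<Longrightarrow> Tm (\<lambda>v. beta (f v) (g v))"
  unfolding beta_def by (intro Tm_intros)

definition Triple :: "'a \<Rightarrow> bool" where
  "Triple c \<longleftrightarrow> (\<exists>k m n. c = pair k (pair m n))"

definition In :: "'a \<Rightarrow> 'a \<Rightarrow> bool" where
  "In i c \<longleftrightarrow> (\<exists>k m n. c = pair k (pair m n) \<and> i \<prec> k \<and> dv (beta m i) n)"

definition FinCode :: "'a \<Rightarrow> bool" where
  "FinCode c \<longleftrightarrow> Triple c \<and> \<not> (\<exists>c'. c' \<prec> c \<and> Triple c' \<and> (\<forall>i. In i c' \<longleftrightarrow> In i c))"

text \<open>
  For a common multiple \<open>m\<close> of $1,\dots,k$ the numbers \<open>beta m i\<close> with \<open>i < k\<close> are pairwise coprime,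
  because $(j+1)\beta_i = (i+1)\beta_j + (j-i)$.
\<close>

lemma beta_coprime_aux:
  assumes "dv d m" "dv (beta m l) (n \<otimes> d)" shows "dv (beta m l) n"
proof -
  have "dv (beta m l) (n \<otimes> m)"
    using assms unfolding dv_def by (metis arith.mult.assoc)
  then have "dv (beta m l) (n \<otimes> m \<otimes> (l \<oplus> \<one>))" by (rule dv_mult)
  \<comment> \<open>Modulo \<open>beta m l\<close> the product of \<open>m\<close> and
    \<open>l \<oplus> \<one>\<close> is -1, so \<open>m\<close> can be cancelled, and with it its
    divisor \<open>d\<close>.\<close>
  moreover have "n \<otimes> beta m l = n \<otimes> m \<otimes> (l \<oplus> \<one>) \<oplus> n"
    unfolding beta_def by (simp add: algebra_simps del: arith.one_add_one)
  then have "dv (beta m l) (n \<otimes> m \<otimes> (l \<oplus> \<one>) \<oplus> n)"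
    using dv_mult_left[OF dv_refl] by metis
  ultimately show ?thesis by (rule dv_add_cancel[rotated])
qed

text \<open>Coprimality is expressed as cancellation of the factor \<open>beta m j\<close>, so that
  neither primes nor greatest common divisors have to be developed in the model.\<close>

lemma beta_coprime:
  assumes m: "\<And>i. i \<prec> k \<Longrightarrow> dv (i \<oplus> \<one>) m" and "i \<prec> k" "j \<prec> k" "i \<noteq> j"
    and "dv (beta m i) (n \<otimes> beta m j)"
  shows "dv (beta m i) n"
proof -
  have key: "(i' \<oplus> (d \<oplus> \<one>) \<oplus> \<one>) \<otimes> beta m i' =
      (i' \<oplus> \<one>) \<otimes> beta m (i' \<oplus> (d \<oplus> \<one>)) \<oplus> (d \<oplus> \<one>)" for i' d
    unfolding beta_def by (simp add: algebra_simps del: arith.one_add_one)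
  consider d where "j = i \<oplus> (d \<oplus> \<one>)" | d where "i = j \<oplus> (d \<oplus> \<one>)"
    using \<open>i \<noteq> j\<close> less_linear' less_iff_add by blast
  then show ?thesis
  proof cases
    case 1
    have "n \<otimes> ((j \<oplus> \<one>) \<otimes> beta m i) = (i \<oplus> \<one>) \<otimes> (n \<otimes> beta m j) \<oplus> n \<otimes> (d \<oplus> \<one>)"
      unfolding key[of i d, folded 1] by (simp add: algebra_simps del: arith.one_add_one)
    then have "dv (beta m i) (n \<otimes> (d \<oplus> \<one>))"
      using dv_add_cancel dv_mult_left[OF assms(5)] dv_mult_left[OF dv_mult_left[OF dv_refl]] by metis
    \<comment> \<open>The difference of the two indices is \<open>d \<oplus> \<one>\<close>, which
      divides \<open>m\<close> because \<open>d\<close> is below \<open>k\<close>.\<close>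
    moreover have "d \<prec> k"
      using 1 \<open>j \<prec> k\<close> by (metis add_commute' arith.less_trans less_add_suc less_suc_iff arith.add.assoc le_add_left arith.le_less_trans)
    ultimately show ?thesis using beta_coprime_aux m by blast
  next
    case 2
    have "n \<otimes> ((i \<oplus> \<one>) \<otimes> beta m j) = (j \<oplus> \<one>) \<otimes> n \<otimes> beta m i \<oplus> n \<otimes> (d \<oplus> \<one>)"
      unfolding key[of j d, folded 2] by (simp add: algebra_simps del: arith.one_add_one)
    moreover have "n \<otimes> ((i \<oplus> \<one>) \<otimes> beta m j) = (i \<oplus> \<one>) \<otimes> (n \<otimes> beta m j)"
      by (simp only: ac_simps)
    ultimately have "dv (beta m i) (n \<otimes> (d \<oplus> \<one>))"
      using dv_add_cancel dv_mult_left[OF assms(5)] dv_mult_left[OF dv_refl] by metis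
    moreover have "d \<prec> k"
      using 2 \<open>i \<prec> k\<close> by (metis add_commute' arith.less_trans less_add_suc less_suc_iff arith.add.assoc le_add_left arith.le_less_trans)
    ultimately show ?thesis using beta_coprime_aux m by blast
  qed
qed

text \<open>Takes the place of the factorial, since primitive recursion is itself built on the codes
  prepared here: that some nonzero common multiple exists is a Sigma01 statement.\<close>

lemma ex_common_multiple:
  assumes "D0 (\<lambda>v. dv (f (v 0)) (v 1))" "\<And>i. f i \<noteq> \<zero>"
  shows "\<exists>m. m \<noteq> \<zero> \<and> (\<forall>i. i \<prec> k \<longrightarrow> dv (f i) m)"
proof (rule S1_induct[where P = "\<lambda>k. \<exists>m. m \<noteq> \<zero> \<and> (\<forall>i. i \<prec> k \<longrightarrow> dv (f i) m)"])
  show "S1 (\<lambda>v. \<exists>m. m \<noteq> \<zero> \<and> (\<forall>i. i \<prec> v 0 \<longrightarrow> dv (f i) m))"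
    using assms(1) by (intro S1_exI0 D0_bounded_intros) simp
  show "\<exists>m. m \<noteq> \<zero> \<and> (\<forall>i. i \<prec> \<zero> \<longrightarrow> dv (f i) m)"
    by (auto intro: exI[of _ \<one>])
  fix k assume "\<exists>m. m \<noteq> \<zero> \<and> (\<forall>i. i \<prec> k \<longrightarrow> dv (f i) m)"
  then obtain m where "m \<noteq> \<zero>" "\<And>i. i \<prec> k \<Longrightarrow> dv (f i) m" by blast
  then show "\<exists>m. m \<noteq> \<zero> \<and> (\<forall>i. i \<prec> k \<oplus> \<one> \<longrightarrow> dv (f i) m)"
    using assms(2)[of k] dv_mult dv_mult_left[OF dv_refl]
    by (intro exI[of _ "m \<otimes> f k"]) (auto simp: less_suc_iff)
qed

lemma beta_neq [simp]: "beta m i \<noteq> \<zero>"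
  unfolding beta_def by (rule suc_neq_zero)

lemma not_dv_beta_one: "m \<noteq> \<zero> \<Longrightarrow> \<not> dv (beta m i) \<one>"
proof
  assume "m \<noteq> \<zero>" "dv (beta m i) \<one>"
  then have "beta m i \<preceq> \<one>" using dv_le by simp
  then have "m \<otimes> (i \<oplus> \<one>) \<preceq> \<zero>"
    unfolding beta_def using arith.add_le_cancel_right[of _ \<one> \<zero>] by simp
  then show False
    using \<open>m \<noteq> \<zero>\<close> suc_neq_zero[of i] by (simp add: le_def)
qed

lemma ex_beta_basis:
  obtains m N where "m \<noteq> \<zero>" "\<And>i. i \<prec> k \<Longrightarrow> dv (i \<oplus> \<one>) m"
    "N \<noteq> \<zero>" "\<And>i. i \<prec> k \<Longrightarrow> dv (beta m i) N"
proof -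
  obtain m where m: "m \<noteq> \<zero>" "\<And>i. i \<prec> k \<Longrightarrow> dv (i \<oplus> \<one>) m"
    using ex_common_multiple[of "\<lambda>i. i \<oplus> \<one>", OF D0_dv suc_neq_zero] Tm_intros by blast
  obtain N where "N \<noteq> \<zero>" "\<And>i. i \<prec> k \<Longrightarrow> dv (beta m i) N"
    using ex_common_multiple[of "beta m", OF D0_dv beta_neq] Tm_beta Tm_index Tm_const by blast
  with m show ?thesis by (rule that)
qed

text \<open>The bound can be independent of \<open>A\<close> because the product coding
  \<open>A\<close> divides the common multiple \<open>N\<close> of all \<open>beta m i\<close>,
  hence is at most \<open>N\<close>.\<close>

lemma ex_code:
  obtains B where "\<And>A. A \<in> range \<sigma> \<Longrightarrow>
    \<exists>c. c \<preceq> B \<and> Triple c \<and> (\<forall>i. In i c \<longleftrightarrow> i \<prec> k \<and> i \<in> A)"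
proof -
  obtain m N where "m \<noteq> \<zero>" and m: "\<And>i. i \<prec> k \<Longrightarrow> dv (i \<oplus> \<one>) m"
    and "N \<noteq> \<zero>" and N: "\<And>i. i \<prec> k \<Longrightarrow> dv (beta m i) N"
    using ex_beta_basis by metis
  have "\<exists>c. c \<preceq> pair k (pair m N) \<and> Triple c \<and> (\<forall>i. In i c \<longleftrightarrow> i \<prec> k \<and> i \<in> A)"
    if A: "A \<in> range \<sigma>" for A
  proof -
    \<comment> \<open>\<open>n\<close> plays the role of the product of the \<open>beta m i\<close>
      over those \<open>i\<close> in \<open>A\<close> that are below \<open>j\<close>. The last
      clause says that the other \<open>beta m i\<close> are coprime to it; bounding
      \<open>q\<close> by \<open>N\<close> keeps the formula bounded.\<close>
    let ?good = "\<lambda>j n. dv n N \<and> (\<forall>i. i \<prec> k \<longrightarrow> (i \<prec> j \<and> i \<in> A \<longrightarrow> dv (beta m i) n) \<and>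
        (\<not> (i \<prec> j \<and> i \<in> A) \<longrightarrow> (\<forall>q. q \<preceq> N \<longrightarrow> dv (beta m i) (n \<otimes> q) \<longrightarrow> dv (beta m i) q)))"
    have "\<exists>n. ?good k n"
    proof (rule S1_induct[where P = "\<lambda>j. \<exists>n. ?good j n"])
      show "S1 (\<lambda>v. \<exists>n. ?good (v 0) n)"
        by (intro S1_exI0 D0_bounded_intros D0_dv Tm_beta A)
      show "\<exists>n. ?good \<zero> n"
        by (intro exI[of _ \<one>]) (auto simp: dv_def)
      fix j assume "\<exists>n. ?good j n"
      then obtain n where n: "?good j n" by blast
      show "\<exists>n. ?good (j \<oplus> \<one>) n"
      proof (cases "j \<prec> k \<and> j \<in> A")
        case True
        obtain r where r: "N = n \<otimes> r" using n unfolding dv_def by blast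
        have "r \<preceq> N"
          using r \<open>N \<noteq> \<zero>\<close> le_mult[of n r] by (metis arith.mult.commute arith.mult_zero_left le_mult)
        moreover have "dv (beta m j) (n \<otimes> r)" using N True r by simp
        \<comment> \<open>As \<open>j\<close> has not been used yet, its factor of \<open>N\<close>
          must lie in the cofactor \<open>r\<close>; so the enlarged product still divides
          \<open>N\<close>.\<close>
        ultimately have "dv (beta m j) r"
          using n True less_irrefl' by blast
        then have "dv (n \<otimes> beta m j) N"
          using r unfolding dv_def by (metis arith.mult.assoc)
        moreover have "dv (beta m i) q"
          if "i \<prec> k" "\<not> (i \<prec> j \<oplus> \<one> \<and> i \<in> A)" "q \<preceq> N" "dv (beta m i) (n \<otimes> beta m j \<otimes> q)" for i q
        proof -
          have "i \<noteq> j" using that(2) True by (auto simp: less_suc_iff)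
          moreover have "dv (beta m i) ((n \<otimes> q) \<otimes> beta m j)"
            using that(4) by (simp only: ac_simps)
          ultimately have "dv (beta m i) (n \<otimes> q)"
            using beta_coprime[of k m i j] m \<open>i \<prec> k\<close> True by blast
          then show ?thesis using n that less_suc_iff by blast
        qed
        moreover have "dv (beta m i) (n \<otimes> beta m j)" if "i \<prec> k" "i \<prec> j \<oplus> \<one>" "i \<in> A" for i
          using that n dv_mult dv_mult_left[OF dv_refl] by (auto simp: less_suc_iff)
        ultimately show ?thesis
          by (intro exI[of _ "n \<otimes> beta m j"]) blast
      next
        case False
        then have "i \<prec> j \<oplus> \<one> \<and> i \<in> A \<longleftrightarrow> i \<prec> j \<and> i \<in> A" if "i \<prec> k" for i
          using that by (auto simp: less_suc_iff)
        then show ?thesis using n by (intro exI[of _ n]) blast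
      qed
    qed
    then obtain n where n: "?good k n" by blast
    have "dv (beta m i) n \<longleftrightarrow> i \<in> A" if "i \<prec> k" for i
    proof
      assume *: "dv (beta m i) n"
      show "i \<in> A"
      proof (rule ccontr)
        assume "i \<notin> A"
        moreover have "\<one> \<preceq> N"
          using \<open>N \<noteq> \<zero>\<close> zero_or_suc[of N] by auto
        moreover have "dv (beta m i) (n \<otimes> \<one>)" using * by simp
        ultimately have "dv (beta m i) \<one>" using n that by blast
        then show False using not_dv_beta_one \<open>m \<noteq> \<zero>\<close> by blast
      qed
    qed (use n that in blast)
    then have "\<forall>i. In i (pair k (pair m n)) \<longleftrightarrow> i \<prec> k \<and> i \<in> A"
      unfolding In_def by auto
    moreover have "n \<preceq> N" using n dv_le \<open>N \<noteq> \<zero>\<close> by blast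
    then have "pair k (pair m n) \<preceq> pair k (pair m N)" by (intro pair_mono) auto
    ultimately show ?thesis unfolding Triple_def by blast
  qed
  then show ?thesis using that by blast
qed

lemma In_less: "In i c \<Longrightarrow> i \<prec> c"
  unfolding In_def using le_pair(1) arith.less_le_trans by blast

lemma le_triple: "k \<preceq> pair k (pair m n)" "m \<preceq> pair k (pair m n)" "n \<preceq> pair k (pair m n)"
  using le_pair arith.order_trans by blast+

lemma Triple_bounded:
  "Triple c \<longleftrightarrow> (\<exists>k. k \<preceq> c \<and> (\<exists>m. m \<preceq> c \<and> (\<exists>n. n \<preceq> c \<and> c = pair k (pair m n))))"
  unfolding Triple_def by (auto simp: le_triple)

lemma In_bounded:
  "In i c \<longleftrightarrow> (\<exists>k. k \<preceq> c \<and> (\<exists>m. m \<preceq> c \<and> (\<exists>n. n \<preceq> c \<and>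
    c = pair k (pair m n) \<and> i \<prec> k \<and> dv (beta m i) n)))"
  unfolding In_def by (auto simp: le_triple)

lemma D0_Triple: "Tm f \<Longrightarrow> D0 (\<lambda>v. Triple (f v))"
proof (rule D0_subst1)
  show "D0 (\<lambda>v. Triple (v 0))"
    unfolding Triple_bounded by (intro D0_bounded_intros Tm_pair)
qed

lemma D0_In: "Tm f \<Longrightarrow> Tm g \<Longrightarrow> D0 (\<lambda>v. In (f v) (g v))"
proof (rule D0_subst2)
  show "D0 (\<lambda>v. In (v 0) (v 1))"
    unfolding In_bounded by (intro D0_bounded_intros Tm_pair D0_dv Tm_beta)
qed

lemma FinCode_bounded:
  "FinCode c \<longleftrightarrow> Triple c \<and>
    \<not> (\<exists>c'. c' \<prec> c \<and> Triple c' \<and> (\<forall>i. i \<prec> c \<longrightarrow> (In i c' \<longleftrightarrow> In i c)))"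
  unfolding FinCode_def using In_less arith.less_trans by metis

lemma D0_FinCode: "Tm f \<Longrightarrow> D0 (\<lambda>v. FinCode (f v))"
proof (rule D0_subst1)
  show "D0 (\<lambda>v. FinCode (v 0))"
    unfolding FinCode_bounded by (intro D0_bounded_intros D0_Triple D0_In)
qed

lemma FinCode_unique:
  assumes "FinCode c" "FinCode c'" "\<And>i. In i c \<longleftrightarrow> In i c'" shows "c = c'"
  using assms less_linear' unfolding FinCode_def by blast

text \<open>Passing to the least code of a set can only lower the code, so the bound from
  \<open>ex_code\<close> carries over.\<close>

lemma ex_FinCode_bounded:
  obtains B where "\<And>A. A \<in> range \<sigma> \<Longrightarrow>
    \<exists>c. c \<preceq> B \<and> FinCode c \<and> (\<forall>i. In i c \<longleftrightarrow> i \<prec> k \<and> i \<in> A)"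
proof -
  obtain B where B: "\<And>A. A \<in> range \<sigma> \<Longrightarrow>
    \<exists>c. c \<preceq> B \<and> Triple c \<and> (\<forall>i. In i c \<longleftrightarrow> i \<prec> k \<and> i \<in> A)"
    using ex_code by blast
  have "\<exists>c. c \<preceq> B \<and> FinCode c \<and> (\<forall>i. In i c \<longleftrightarrow> i \<prec> k \<and> i \<in> A)" if A: "A \<in> range \<sigma>" for A
  proof -
    let ?P = "\<lambda>c. c \<preceq> B \<and> Triple c \<and> (\<forall>i. i \<prec> c \<longrightarrow> In i c \<longrightarrow> i \<prec> k \<and> i \<in> A) \<and>
      (\<forall>i. i \<prec> k \<longrightarrow> i \<in> A \<longrightarrow> In i c)"
    have P_iff: "?P c \<longleftrightarrow> c \<preceq> B \<and> Triple c \<and> (\<forall>i. In i c \<longleftrightarrow> i \<prec> k \<and> i \<in> A)" for c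
      using In_less by blast
    have "D0 (\<lambda>v. ?P (v 0))"
      by (intro D0_bounded_intros D0_Triple D0_In A)
    moreover obtain c where "?P c" using B[OF A] P_iff by blast
    ultimately obtain c where c: "?P c" and least: "\<And>x. x \<prec> c \<Longrightarrow> \<not> ?P x"
      using least_element[of ?P] by blast
    have "FinCode c"
      unfolding FinCode_def
    proof (intro conjI notI)
      show "Triple c" using c by blast
      assume "\<exists>c'. c' \<prec> c \<and> Triple c' \<and> (\<forall>i. In i c' \<longleftrightarrow> In i c)"
      then obtain c' where c': "c' \<prec> c" "Triple c'" "\<And>i. In i c' \<longleftrightarrow> In i c" by blast
      have "c' \<preceq> B" using c c'(1) arith.less_imp_le arith.order_trans by blast
      then have "?P c'" using c c' P_iff by blast
      then show False using least c'(1) by blast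
    qed
    then show ?thesis using c P_iff by blast
  qed
  then show ?thesis using that by blast
qed

lemma ex_FinCode:
  assumes "A \<in> range \<sigma>"
  obtains c where "FinCode c" "\<And>i. In i c \<longleftrightarrow> i \<prec> k \<and> i \<in> A"
  using ex_FinCode_bounded assms by metis

end

subsection \<open>The meaning of the formulas about diagrams\<close>

lemma vars_pr [simp]: "vars (pr s t) = vars s \<union> vars t"
  unfolding pr_def by auto

lemma schematic_tm_pr [simp]:
  "schematic_tm f \<Longrightarrow> schematic_tm g \<Longrightarrow> schematic_tm (\<lambda>t. pr (f t) (g t))"
  unfolding pr_def by simp

lemma schematic_unary:
  "(\<And>s. fv (C s) = vars s) \<Longrightarrow> schematic_tm f \<Longrightarrow> schematic (\<lambda>t. C (f t))"
  unfolding schematic_def schematic_tm_def by simp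

lemma schematic_binary:
  "(\<And>s t. fv (C s t) = vars s \<union> vars t) \<Longrightarrow> schematic_tm f \<Longrightarrow> schematic_tm g
    \<Longrightarrow> schematic (\<lambda>t. C (f t) (g t))"
  unfolding schematic_def schematic_tm_def by auto

lemma schematic_ternary:
  "(\<And>s t u. fv (C s t u) = vars s \<union> vars t \<union> vars u) \<Longrightarrow> schematic_tm f \<Longrightarrow> schematic_tm g
    \<Longrightarrow> schematic_tm h \<Longrightarrow> schematic (\<lambda>t. C (f t) (g t) (h t))"
  unfolding schematic_def schematic_tm_def by auto

lemma fv_dvd_fm [simp]: "fv (dvd_fm s t) = vars s \<union> vars t"
  by (auto simp: dvd_fm_def)

lemmas schematic_dvd_fm [simp] = schematic_binary[where C = dvd_fm, OF fv_dvd_fm]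

lemma fv_triple [simp]: "fv (triple c) = vars c"
  by (auto simp: triple_def)

lemmas schematic_triple [simp] = schematic_unary[where C = triple, OF fv_triple]

lemma fv_in_fin [simp]: "fv (in_fin i c) = vars i \<union> vars c"
  by (auto simp: in_fin_def)

lemmas schematic_in_fin [simp] = schematic_binary[where C = in_fin, OF fv_in_fin]

lemma fv_fin_code [simp]: "fv (fin_code c) = vars c"
  by (auto simp: fin_code_def)

lemmas schematic_fin_code [simp] = schematic_unary[where C = fin_code, OF fv_fin_code]

lemma fv_seq_code [simp]: "fv (seq_code s) = vars s"
  by (auto simp: seq_code_def)

lemmas schematic_seq_code [simp] = schematic_unary[where C = seq_code, OF fv_seq_code]

lemma fv_diagram [simp]: "fv (diagram d) = vars d"
  by (auto simp: diagram_def)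

lemmas schematic_diagram [simp] = schematic_unary[where C = diagram, OF fv_diagram]

lemma fv_row [simp]: "fv (row d i r) = vars d \<union> vars i \<union> vars r"
  by (auto simp: row_def)

lemmas schematic_row [simp] = schematic_ternary[where C = row, OF fv_row]

lemma fv_le_diagram [simp]: "fv (le_diagram d e) = vars d \<union> vars e"
  by (auto simp: le_diagram_def)

lemmas schematic_le_diagram [simp] = schematic_binary[where C = le_diagram, OF fv_le_diagram]

lemma fv_in_ucl [simp]: "fv (in_ucl e s) = vars e \<union> vars s"
  by (auto simp: in_ucl_def)

lemmas schematic_in_ucl [simp] = schematic_binary[where C = in_ucl, OF fv_in_ucl]

lemma fv_range_seq [simp]: "fv (range_seq F e) = vars e"
  by (auto simp: range_seq_def)

lemmas schematic_range_seq [simp] = schematic_unary[where C = "range_seq F" for F, OF fv_range_seq]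

lemma fv_set_at [simp]: "fv (set_at U i d) = vars i \<union> vars d"
  by (auto simp: set_at_def)

lemmas schematic_set_at [simp] = schematic_binary[where C = "set_at U" for U, OF fv_set_at]

lemma fv_member_of [simp]: "fv (member_of U d) = vars d"
  by (auto simp: member_of_def)

lemmas schematic_member_of [simp] = schematic_unary[where C = "member_of U" for U, OF fv_member_of]

lemma schematic_fv_subset: "schematic p \<Longrightarrow> x \<in> fv (p Zero) \<Longrightarrow> x \<in> fv (p t)"
  unfolding schematic_def by blast

context rca0_model
begin

section \<open>The coded notions read in the model\<close>

definition SeqCode :: "'a \<Rightarrow> bool" where
  "SeqCode s \<longleftrightarrow> FinCode s \<and> (\<forall>n. In n s \<longrightarrow> (\<exists>i j. n = pair i j)) \<and>
    (\<forall>i j j'. In (pair i j) s \<and> In (pair i j') s \<longrightarrow> j = j') \<and>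
    (\<exists>l. \<forall>i. i \<prec> l \<longleftrightarrow> (\<exists>j. In (pair i j) s))"

definition Diagram :: "'a \<Rightarrow> bool" where
  "Diagram d \<longleftrightarrow> SeqCode d \<and> (\<exists>a. In (pair \<zero> a) d) \<and>
    (\<forall>i a. In (pair i a) d \<longrightarrow> \<zero> \<prec> a) \<and>
    (\<forall>i a b. In (pair i a) d \<and> In (pair (i \<oplus> \<one>) b) d \<longrightarrow> b \<preceq> a)"

definition Row :: "'a \<Rightarrow> 'a \<Rightarrow> 'a \<Rightarrow> bool" where
  "Row d i r \<longleftrightarrow> In (pair i r) d \<or> \<not> (\<exists>a. In (pair i a) d) \<and> r = \<zero>"

definition LeD :: "'a \<Rightarrow> 'a \<Rightarrow> bool" where
  "LeD d e \<longleftrightarrow> (\<forall>i a b. Row d i a \<and> Row e i b \<longrightarrow> a \<preceq> b)"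

definition UpClosed :: "('a \<Rightarrow> bool) \<Rightarrow> bool" where
  "UpClosed P \<longleftrightarrow> (\<forall>d. P d \<longrightarrow> Diagram d) \<and> (\<forall>d e. P d \<and> Diagram e \<and> LeD d e \<longrightarrow> P e)"

definition InUcl :: "'a \<Rightarrow> 'a \<Rightarrow> bool" where
  "InUcl e s \<longleftrightarrow> Diagram e \<and> (\<exists>d. In d s \<and> LeD d e)"

definition FinGen :: "('a \<Rightarrow> bool) \<Rightarrow> bool" where
  "FinGen P \<longleftrightarrow> (\<exists>s. FinCode s \<and> (\<forall>d. In d s \<longrightarrow> Diagram d) \<and> (\<forall>e. InUcl e s \<longleftrightarrow> P e))"

definition DiagramSeq :: "'a set \<Rightarrow> bool" where
  "DiagramSeq F \<longleftrightarrow> (\<forall>n. n \<in> F \<longrightarrow> (\<exists>i d. Diagram d \<and> n = pair i d)) \<and> (\<forall>i. \<exists>d. pair i d \<in> F) \<and>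
    (\<forall>i d e. pair i d \<in> F \<and> pair i e \<in> F \<longrightarrow> d = e)"

definition InRange :: "'a set \<Rightarrow> 'a \<Rightarrow> bool" where
  "InRange F e \<longleftrightarrow> (\<exists>j. pair j e \<in> F)"

definition UpClosedSeq :: "'a set \<Rightarrow> bool" where
  "UpClosedSeq F \<longleftrightarrow> (\<forall>i d e. pair i d \<in> F \<and> Diagram e \<and> LeD d e \<longrightarrow> InRange F e)"

definition Ascending :: "'a set \<Rightarrow> bool" where
  "Ascending U \<longleftrightarrow> (\<forall>i j. i \<prec> j \<longrightarrow> (\<forall>d. pair d i \<in> U \<longrightarrow> pair d j \<in> U) \<and>
    (\<exists>d. pair d j \<in> U \<and> \<not> pair d i \<in> U))"

lemma val_pr [simp]: "val v (pr s t) = pair (val v s) (val v t)"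
  by (simp add: pr_def pair_def)

lemma sat_dvd_fm [simp]: "sat v \<tau> (dvd_fm s t) \<longleftrightarrow> dv (val v s) (val v t)"
  unfolding dvd_fm_def dv_def by (intro sat_congs) auto

lemma sat_triple [simp]: "sat v \<tau> (triple c) \<longleftrightarrow> Triple (val v c)"
  unfolding triple_def Triple_def by (intro sat_congs) auto

lemma sat_in_fin [simp]: "sat v \<tau> (in_fin i c) \<longleftrightarrow> In (val v i) (val v c)"
  unfolding in_fin_def In_def beta_def by (intro sat_congs) auto

lemma sat_fin_code [simp]: "sat v \<tau> (fin_code c) \<longleftrightarrow> FinCode (val v c)"
  unfolding fin_code_def FinCode_def by (intro sat_congs) auto

lemma sat_seq_code [simp]: "sat v \<tau> (seq_code s) \<longleftrightarrow> SeqCode (val v s)"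
  unfolding seq_code_def SeqCode_def by (intro sat_congs) auto

lemma sat_Leq: "sat v \<tau> (s \<^bold>\<le> t) \<longleftrightarrow> val v s \<preceq> val v t"
  by (auto simp: le_def)

lemma sat_diagram [simp]: "sat v \<tau> (diagram d) \<longleftrightarrow> Diagram (val v d)"
  unfolding diagram_def Diagram_def by (intro sat_congs; (subst sat_Leq)?) auto

lemma sat_row [simp]: "sat v \<tau> (row d i r) \<longleftrightarrow> Row (val v d) (val v i) (val v r)"
  unfolding row_def Row_def by (intro sat_congs) auto

lemma sat_le_diagram [simp]: "sat v \<tau> (le_diagram d e) \<longleftrightarrow> LeD (val v d) (val v e)"
  unfolding le_diagram_def LeD_def by (intro sat_congs; (subst sat_Leq)?) auto

lemma sat_in_ucl [simp]: "sat v \<tau> (in_ucl e s) \<longleftrightarrow> InUcl (val v e) (val v s)"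
  unfolding in_ucl_def InUcl_def by (intro sat_congs) auto

lemma sat_range_seq [simp]: "sat v \<tau> (range_seq F e) \<longleftrightarrow> InRange (\<tau> F) (val v e)"
  unfolding range_seq_def InRange_def by (intro sat_congs) auto

lemma sat_set_at [simp]: "sat v \<tau> (set_at U i d) \<longleftrightarrow> pair (val v d) (val v i) \<in> \<tau> U"
  by (simp add: set_at_def)

lemma sat_member_of [simp]: "sat v \<tau> (member_of U d) \<longleftrightarrow> val v d \<in> \<tau> U"
  by (simp add: member_of_def)

text \<open>The schema \<open>P\<close> may contain parameters, such as the index of a section.
  \<open>w\<close> arises from \<open>v\<close> by changes at the bound variables, which are not
  among them.\<close>

lemma sat_upwardly_closed:
  assumes "schematic P"
    and sat_P: "\<And>w d. (\<And>x. x \<in> fv (P Zero) \<Longrightarrow> w x = v x) \<Longrightarrow> sat w \<tau> (P d) \<longleftrightarrow> A (val w d)"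
  shows "sat v \<tau> (upwardly_closed P) \<longleftrightarrow> UpClosed A"
  unfolding upwardly_closed_def UpClosed_def
  by (intro sat_congs; (subst sat_P)?) (use schematic_fv_subset[OF assms(1)] assms(1) in auto)

lemma sat_finitely_generated:
  assumes "schematic P"
    and sat_P: "\<And>w d. (\<And>x. x \<in> fv (P Zero) \<Longrightarrow> w x = v x) \<Longrightarrow> sat w \<tau> (P d) \<longleftrightarrow> A (val w d)"
  shows "sat v \<tau> (finitely_generated P) \<longleftrightarrow> FinGen A"
  unfolding finitely_generated_def FinGen_def
  by (intro sat_congs; (subst sat_P)?) (use schematic_fv_subset[OF assms(1)] assms(1) in auto)

lemma sat_upwardly_closed_set_at:
  "sat v \<tau> (upwardly_closed (set_at U i)) \<longleftrightarrow> UpClosed (\<lambda>d. pair d (val v i) \<in> \<tau> U)"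
proof (rule sat_upwardly_closed)
  fix w d assume "\<And>x. x \<in> fv (set_at U i Zero) \<Longrightarrow> w x = v x"
  then have "val w i = val v i" by (intro val_cong) simp
  then show "sat w \<tau> (set_at U i d) \<longleftrightarrow> pair (val w d) (val v i) \<in> \<tau> U" by simp
qed simp

lemma sat_finitely_generated_set_at:
  "sat v \<tau> (finitely_generated (set_at U i)) \<longleftrightarrow> FinGen (\<lambda>d. pair d (val v i) \<in> \<tau> U)"
proof (rule sat_finitely_generated)
  fix w d assume "\<And>x. x \<in> fv (set_at U i Zero) \<Longrightarrow> w x = v x"
  then have "val w i = val v i" by (intro val_cong) simp
  then show "sat w \<tau> (set_at U i d) \<longleftrightarrow> pair (val w d) (val v i) \<in> \<tau> U" by simp
qed simp

lemma sat_ascending: "sat v \<tau> (ascending U) \<longleftrightarrow> Ascending (\<tau> U)"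
  unfolding ascending_def strict_subset_def Ascending_def by (intro sat_congs) auto

lemma sat_diagram_seq: "sat v \<tau> (diagram_seq F) \<longleftrightarrow> DiagramSeq (\<tau> F)"
  unfolding diagram_seq_def DiagramSeq_def by (intro sat_congs) auto

lemma sat_WPO:
  "sat v \<tau> WPO_diagrams \<longleftrightarrow> (\<forall>F\<in>range \<sigma>. DiagramSeq F \<longrightarrow>
    (\<exists>i j d e. i \<prec> j \<and> pair i d \<in> F \<and> pair j e \<in> F \<and> LeD d e))"
proof -
  have "sat v \<tau> (\<^bold>\<exists>i j d e. i \<^bold>< j \<^bold>\<and> pr i d \<^bold>\<in> 0 \<^bold>\<and> pr j e \<^bold>\<in> 0 \<^bold>\<and> le_diagram d e) \<longleftrightarrow>
      (\<exists>i j d e. i \<prec> j \<and> pair i d \<in> \<tau> 0 \<and> pair j e \<in> \<tau> 0 \<and> LeD d e)" for \<tau>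
    by (intro sat_congs) auto
  then show ?thesis unfolding WPO_diagrams_def by (simp add: sat_diagram_seq)
qed

lemma sat_ACC:
  "sat v \<tau> ACC_upwardly_closed \<longleftrightarrow>
    \<not> (\<exists>U\<in>range \<sigma>. (\<forall>i. UpClosed (\<lambda>d. pair d i \<in> U)) \<and> Ascending U)"
proof -
  have "sat v \<tau> (\<^bold>\<forall>i. upwardly_closed (set_at 0 i)) \<longleftrightarrow> (\<forall>i. UpClosed (\<lambda>d. pair d i \<in> \<tau> 0))" for \<tau>
    by (intro sat_congs) (simp add: sat_upwardly_closed_set_at)
  then show ?thesis unfolding ACC_upwardly_closed_def by (simp add: sat_ascending)
qed

lemma sat_ACC_finitely_generated:
  "sat v \<tau> ACC_finitely_generated \<longleftrightarrow>
    \<not> (\<exists>U\<in>range \<sigma>. (\<forall>i. FinGen (\<lambda>d. pair d i \<in> U) \<and> UpClosed (\<lambda>d. pair d i \<in> U)) \<and> Ascending U)"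
proof -
  have "sat v \<tau> (\<^bold>\<forall>i. finitely_generated (set_at 0 i) \<^bold>\<and> upwardly_closed (set_at 0 i)) \<longleftrightarrow>
      (\<forall>i. FinGen (\<lambda>d. pair d i \<in> \<tau> 0) \<and> UpClosed (\<lambda>d. pair d i \<in> \<tau> 0))" for \<tau>
    by (intro sat_congs) (simp_all add: sat_upwardly_closed_set_at sat_finitely_generated_set_at)
  then show ?thesis unfolding ACC_finitely_generated_def by (simp add: sat_ascending)
qed

lemma sat_upwardly_closed_sets_fg:
  "sat v \<tau> upwardly_closed_sets_fg \<longleftrightarrow>
    (\<forall>U\<in>range \<sigma>. UpClosed (\<lambda>d. d \<in> U) \<longrightarrow> FinGen (\<lambda>d. d \<in> U))"
proof -
  have "sat v \<tau> (upwardly_closed (member_of 0)) \<longleftrightarrow> UpClosed (\<lambda>d. d \<in> \<tau> 0)"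
    "sat v \<tau> (finitely_generated (member_of 0)) \<longleftrightarrow> FinGen (\<lambda>d. d \<in> \<tau> 0)" for \<tau>
    by (rule sat_upwardly_closed sat_finitely_generated; simp)+
  then show ?thesis unfolding upwardly_closed_sets_fg_def by simp
qed

lemma sat_upwardly_closed_seqs_fg:
  "sat v \<tau> upwardly_closed_seqs_fg \<longleftrightarrow>
    (\<forall>F\<in>range \<sigma>. DiagramSeq F \<and> UpClosedSeq F \<longrightarrow> FinGen (InRange F))"
proof -
  have "sat v \<tau> (upwardly_closed_seq 0) \<longleftrightarrow> UpClosedSeq (\<tau> 0)" for \<tau>
    unfolding upwardly_closed_seq_def UpClosedSeq_def by (intro sat_congs) auto
  moreover have "sat v \<tau> (finitely_generated (range_seq 0)) \<longleftrightarrow> FinGen (InRange (\<tau> 0))" for \<tau>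
    by (rule sat_finitely_generated) simp_all
  ultimately show ?thesis unfolding upwardly_closed_seqs_fg_def by (simp add: sat_diagram_seq)
qed


section \<open>Comprehension for sets and relations with an explicit complement\<close>

lemma D1_ex_le:
  assumes "Tm f" "D1 (\<lambda>v. P (v 0) (\<lambda>i. v (Suc i)))" shows "D1 (\<lambda>v. \<exists>x. x \<preceq> f v \<and> P x v)"
  using D1_ex_less[OF Tm_add[OF assms(1) Tm_one] assms(2)] by (simp add: less_suc_le)

lemma S1_all_le:
  assumes "Tm f" "S1 (\<lambda>v. P (v 0) (\<lambda>i. v (Suc i)))" shows "S1 (\<lambda>v. \<forall>x. x \<preceq> f v \<longrightarrow> P x v)"
  using S1_all_less[OF Tm_add[OF assms(1) Tm_one] assms(2)] by (simp add: less_suc_le)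

lemma S1_imp: "D0 P \<Longrightarrow> S1 Q \<Longrightarrow> S1 (\<lambda>v. P v \<longrightarrow> Q v)"
  unfolding imp_conv_disj by (rule S1_disj[OF D0_S1[OF D0_not]])

lemmas S1_intros = S1_exI S1_conj S1_disj S1_all_less S1_all_le S1_imp

lemmas D0_rules = D0_bounded_intros Tm_pair D0_In D0_FinCode

lemma D0_set: "D0 (\<lambda>v. P (v 0)) \<Longrightarrow> {x. P x} \<in> range \<sigma>"
  by (intro comprehension D0_D1)

text \<open>\<open>R'\<close> is a Sigma01 definition of the complement. It is supplied separately
  because it is often the negation of \<open>R\<close> only by totality and uniqueness of some
  function, not by its logical form.\<close>

lemma comprehension_rel:
  assumes "S1 (\<lambda>v. R (v 0) (v 1))" "S1 (\<lambda>v. R' (v 0) (v 1))" "\<And>i x. R' i x \<longleftrightarrow> \<not> R i x"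
  obtains A where "A \<in> range \<sigma>" "\<And>i x. pair i x \<in> A \<longleftrightarrow> R i x"
    "\<And>n. n \<in> A \<Longrightarrow> \<exists>i x. n = pair i x"
proof -
  have "D1 (\<lambda>v. R (v 1) (v 0))"
    using S1_rename[OF assms(1), of "case_nat 1 (\<lambda>_. 0)"] S1_rename[OF assms(2), of "case_nat 1 (\<lambda>_. 0)"]
    unfolding D1_def assms(3) by simp
  then have "D1 (\<lambda>v. \<exists>i. i \<preceq> v 0 \<and> (\<exists>x. x \<preceq> v 0 \<and> v 0 = pair i x \<and> R i x))"
    by (intro D1_ex_le D1_conj D0_D1[OF D0_eq] Tm_intros Tm_pair) simp
  then have "{n. \<exists>i. i \<preceq> n \<and> (\<exists>x. x \<preceq> n \<and> n = pair i x \<and> R i x)} \<in> range \<sigma>"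
    by (rule comprehension)
  then show ?thesis by (rule that) (auto simp: le_pair)
qed

lemma comprehension_set:
  assumes "S1 (\<lambda>v. P (v 0))" "S1 (\<lambda>v. P' (v 0))" "\<And>x. P' x \<longleftrightarrow> \<not> P x"
  shows "{x. P x} \<in> range \<sigma>"
  using assms(1,2) unfolding assms(3) by (intro comprehension) (simp add: D1_def)

lemma least_member:
  assumes "A \<in> range \<sigma>" "a \<in> A"
  obtains m where "m \<in> A" "\<And>x. x \<prec> m \<Longrightarrow> x \<notin> A"
  using least_element[of "\<lambda>x. x \<in> A", OF D0_mem[OF assms(1) Tm_index] assms(2)] by blast


subsection \<open>Codes of diagrams\<close>

lemma In_pair_less: "In (pair i j) s \<Longrightarrow> i \<prec> s" "In (pair i j) s \<Longrightarrow> j \<prec> s"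
  using In_less le_pair arith.le_less_trans by blast+

text \<open>A code exceeds its elements and the components of the pairs among them, so every
  quantifier can be bounded in terms of \<open>s\<close>.\<close>

lemma SeqCode_bounded:
  "SeqCode s \<longleftrightarrow> FinCode s \<and>
    (\<forall>n. n \<prec> s \<longrightarrow> In n s \<longrightarrow> (\<exists>i. i \<preceq> n \<and> (\<exists>j. j \<preceq> n \<and> n = pair i j))) \<and>
    (\<forall>i. i \<prec> s \<longrightarrow> (\<forall>j. j \<prec> s \<longrightarrow> (\<forall>j'. j' \<prec> s \<longrightarrow> In (pair i j) s \<and> In (pair i j') s \<longrightarrow> j = j'))) \<and>
    (\<exists>l. l \<preceq> s \<and> (\<forall>i. i \<preceq> s \<longrightarrow> (i \<prec> l \<longleftrightarrow> (\<exists>j. j \<prec> s \<and> In (pair i j) s))))"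
proof -
  have "(\<forall>n. In n s \<longrightarrow> (\<exists>i j. n = pair i j)) \<longleftrightarrow>
      (\<forall>n. n \<prec> s \<longrightarrow> In n s \<longrightarrow> (\<exists>i. i \<preceq> n \<and> (\<exists>j. j \<preceq> n \<and> n = pair i j)))"
    using In_less le_pair by metis
  moreover have "(\<forall>i j j'. In (pair i j) s \<and> In (pair i j') s \<longrightarrow> j = j') \<longleftrightarrow>
      (\<forall>i. i \<prec> s \<longrightarrow> (\<forall>j. j \<prec> s \<longrightarrow> (\<forall>j'. j' \<prec> s \<longrightarrow> In (pair i j) s \<and> In (pair i j') s \<longrightarrow> j = j')))"
    using In_pair_less by blast
  moreover have "(\<exists>l. \<forall>i. i \<prec> l \<longleftrightarrow> (\<exists>j. In (pair i j) s)) \<longleftrightarrow>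
      (\<exists>l. l \<preceq> s \<and> (\<forall>i. i \<preceq> s \<longrightarrow> (i \<prec> l \<longleftrightarrow> (\<exists>j. j \<prec> s \<and> In (pair i j) s))))" (is "?L \<longleftrightarrow> ?R")
  proof
    assume ?L
    then obtain l where l: "\<And>i. i \<prec> l \<longleftrightarrow> (\<exists>j. In (pair i j) s)" by blast
    \<comment> \<open>If the length exceeded \<open>s\<close>, then \<open>s\<close> itself would be
      an index, but indices are smaller than the code.\<close>
    then have "\<not> s \<prec> l" using In_pair_less(1) less_irrefl' by blast
    then have "l \<preceq> s" by simp
    moreover have "i \<prec> l \<longleftrightarrow> (\<exists>j. j \<prec> s \<and> In (pair i j) s)" for i
      using l In_pair_less(2) by blast
    ultimately show ?R by blast
  next
    assume ?R
    then obtain l where l: "l \<preceq> s" "\<And>i. i \<preceq> s \<Longrightarrow> i \<prec> l \<longleftrightarrow> (\<exists>j. j \<prec> s \<and> In (pair i j) s)" by blast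
    have "i \<prec> l \<longleftrightarrow> (\<exists>j. In (pair i j) s)" for i
    proof
      assume "i \<prec> l"
      then have "i \<preceq> s" using l(1) arith.less_le_trans arith.less_imp_le by blast
      then show "\<exists>j. In (pair i j) s" using l(2) \<open>i \<prec> l\<close> by blast
    next
      assume "\<exists>j. In (pair i j) s"
      then obtain j where j: "In (pair i j) s" by blast
      then have "i \<preceq> s" using In_pair_less(1) arith.less_imp_le by blast
      then show "i \<prec> l" using l(2) j In_pair_less(2) by blast
    qed
    then show ?L by blast
  qed
  ultimately show ?thesis unfolding SeqCode_def by simp
qed

lemma D0_SeqCode: "Tm f \<Longrightarrow> D0 (\<lambda>v. SeqCode (f v))"
proof (rule D0_subst1)
  show "D0 (\<lambda>v. SeqCode (v 0))"
    unfolding SeqCode_bounded by (intro D0_rules)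
qed

lemma Diagram_bounded:
  "Diagram d \<longleftrightarrow> SeqCode d \<and> (\<exists>a. a \<prec> d \<and> In (pair \<zero> a) d) \<and>
    (\<forall>i. i \<prec> d \<longrightarrow> (\<forall>a. a \<prec> d \<longrightarrow> In (pair i a) d \<longrightarrow> \<zero> \<prec> a)) \<and>
    (\<forall>i. i \<prec> d \<longrightarrow> (\<forall>a. a \<prec> d \<longrightarrow> (\<forall>b. b \<prec> d \<longrightarrow>
      In (pair i a) d \<and> In (pair (i \<oplus> \<one>) b) d \<longrightarrow> b \<preceq> a)))"
proof -
  have "(\<exists>a. In (pair \<zero> a) d) \<longleftrightarrow> (\<exists>a. a \<prec> d \<and> In (pair \<zero> a) d)"
    using In_pair_less(2) by blast
  moreover have "(\<forall>i a. In (pair i a) d \<longrightarrow> \<zero> \<prec> a) \<longleftrightarrow>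
      (\<forall>i. i \<prec> d \<longrightarrow> (\<forall>a. a \<prec> d \<longrightarrow> In (pair i a) d \<longrightarrow> \<zero> \<prec> a))"
    by (meson In_pair_less)
  moreover have "(\<forall>i a b. In (pair i a) d \<and> In (pair (i \<oplus> \<one>) b) d \<longrightarrow> b \<preceq> a) \<longleftrightarrow>
      (\<forall>i. i \<prec> d \<longrightarrow> (\<forall>a. a \<prec> d \<longrightarrow> (\<forall>b. b \<prec> d \<longrightarrow>
        In (pair i a) d \<and> In (pair (i \<oplus> \<one>) b) d \<longrightarrow> b \<preceq> a)))"
    by (meson In_pair_less)
  ultimately show ?thesis unfolding Diagram_def by simp
qed

lemma D0_Diagram: "Tm f \<Longrightarrow> D0 (\<lambda>v. Diagram (f v))"
proof (rule D0_subst1)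
  show "D0 (\<lambda>v. Diagram (v 0))"
    unfolding Diagram_bounded by (intro D0_rules D0_SeqCode)
qed

lemma Row_bounded: "Row d i r \<longleftrightarrow> In (pair i r) d \<or> \<not> (\<exists>a. a \<prec> d \<and> In (pair i a) d) \<and> r = \<zero>"
  unfolding Row_def using In_pair_less by blast

lemma Row_le: "Row d i a \<Longrightarrow> a \<preceq> d"
  unfolding Row_def using In_pair_less(2) arith.less_imp_le by auto

lemma Row_beyond: "Row d i a \<Longrightarrow> \<not> i \<prec> d \<Longrightarrow> a = \<zero>"
  unfolding Row_def using In_pair_less(1) by blast

text \<open>From index \<open>d\<close> on, the rows of \<open>d\<close> are empty, so the
  comparison is trivial there.\<close>

lemma LeD_bounded:
  "LeD d e \<longleftrightarrow> (\<forall>i. i \<prec> d \<longrightarrow> (\<forall>a. a \<preceq> d \<longrightarrow> (\<forall>b. b \<preceq> e \<longrightarrow> Row d i a \<and> Row e i b \<longrightarrow> a \<preceq> b)))"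
proof (intro iffI allI impI)
  assume *: "\<forall>i. i \<prec> d \<longrightarrow> (\<forall>a. a \<preceq> d \<longrightarrow> (\<forall>b. b \<preceq> e \<longrightarrow> Row d i a \<and> Row e i b \<longrightarrow> a \<preceq> b))"
  have "a \<preceq> b" if "Row d i a" "Row e i b" for i a b
    using * that Row_le Row_beyond zero_le by (cases "i \<prec> d") blast+
  then show "LeD d e" unfolding LeD_def by blast
qed (auto simp: LeD_def)

lemma D0_LeD: "Tm f \<Longrightarrow> Tm g \<Longrightarrow> D0 (\<lambda>v. LeD (f v) (g v))"
proof (rule D0_subst2)
  show "D0 (\<lambda>v. LeD (v 0) (v 1))"
    unfolding LeD_bounded Row_bounded by (intro D0_rules)
qed

lemma Row_total: "\<exists>a. Row d i a"
  unfolding Row_def by blast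

lemma Row_unique: "Diagram d \<Longrightarrow> Row d i a \<Longrightarrow> Row d i b \<Longrightarrow> a = b"
  unfolding Row_def Diagram_def SeqCode_def by blast

lemma LeD_refl: "Diagram d \<Longrightarrow> LeD d d"
  unfolding LeD_def using Row_unique by blast

lemma LeD_trans: "LeD d e \<Longrightarrow> LeD e f \<Longrightarrow> LeD d f"
  unfolding LeD_def using Row_total arith.order_trans by metis

definition Bnd :: "'a \<Rightarrow> 'a \<Rightarrow> bool" where
  "Bnd d N \<longleftrightarrow> (\<forall>n. In n d \<longrightarrow> n \<prec> N)"

lemma D0_Bnd: "Tm f \<Longrightarrow> Tm g \<Longrightarrow> D0 (\<lambda>v. Bnd (f v) (g v))"
proof (rule D0_subst2)
  have Bnd_iff: "Bnd d N \<longleftrightarrow> (\<forall>n. n \<prec> d \<longrightarrow> In n d \<longrightarrow> n \<prec> N)" for d N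
    unfolding Bnd_def using In_less by blast
  show "D0 (\<lambda>v. Bnd (v 0) (v 1))"
    unfolding Bnd_iff by (intro D0_rules)
qed

lemma Bnd_self: "Bnd d d"
  unfolding Bnd_def using In_less by blast

lemma Bnd_mono: "Bnd d M \<Longrightarrow> M \<preceq> N \<Longrightarrow> Bnd d N"
  unfolding Bnd_def using arith.less_le_trans by blast

text \<open>An element of \<open>d\<close> is \<open>pair i a\<close> with positive
  \<open>a\<close>. The row of \<open>e\<close> at \<open>i\<close> has length \<open>b\<close> at
  least \<open>a\<close>, hence is nonempty, and its element \<open>pair i b\<close> is at least
  \<open>pair i a\<close>.\<close>

lemma Bnd_LeD:
  assumes "Diagram d" "LeD d e" "Bnd e N" shows "Bnd d N"
  unfolding Bnd_def
proof (intro allI impI)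
  fix n assume "In n d"
  moreover from this obtain i a where n: "n = pair i a"
    using assms(1) unfolding Diagram_def SeqCode_def by blast
  ultimately have "Row d i a" "\<zero> \<prec> a"
    using assms(1) unfolding Row_def Diagram_def by blast+
  moreover obtain b where b: "Row e i b" using Row_total by blast
  ultimately have "a \<preceq> b" using assms(2) unfolding LeD_def by blast
  then have "b \<noteq> \<zero>" using \<open>\<zero> \<prec> a\<close> by auto
  then have "pair i b \<prec> N" using b assms(3) unfolding Row_def Bnd_def by blast
  then show "n \<prec> N" using n pair_mono[OF arith.order_refl \<open>a \<preceq> b\<close>] arith.le_less_trans by blast
qed

text \<open>The bound in \<open>ex_FinCode_bounded\<close> serves all sets at once, and a canonical
  code is determined by its elements.\<close>

lemma bounded_codes:
  obtains C where "\<And>d. FinCode d \<Longrightarrow> Bnd d N \<Longrightarrow> d \<preceq> C"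
proof -
  obtain C where C: "\<And>A. A \<in> range \<sigma> \<Longrightarrow>
    \<exists>c. c \<preceq> C \<and> FinCode c \<and> (\<forall>i. In i c \<longleftrightarrow> i \<prec> N \<and> i \<in> A)"
    using ex_FinCode_bounded by blast
  have "d \<preceq> C" if "FinCode d" "Bnd d N" for d
  proof -
    have "{n. In n d} \<in> range \<sigma>" by (intro D0_set D0_rules)
    from C[OF this] obtain c where c: "c \<preceq> C" "FinCode c" "\<And>i. In i c \<longleftrightarrow> i \<prec> N \<and> In i d" by auto
    then have "c = d" using that unfolding Bnd_def by (intro FinCode_unique) auto
    then show ?thesis using c(1) by simp
  qed
  then show ?thesis using that by blast
qed

text \<open>
  Pigeonhole principle: the product of \<open>beta m (F 0), \<dots>, beta m (F (j-1))\<close> is at least \<open>j\<close>,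
  yet divides the fixed number \<open>N\<close>.
\<close>

lemma no_injection:
  assumes F: "F \<in> range \<sigma>" and total: "\<And>i. \<exists>x. x \<prec> k \<and> pair i x \<in> F"
    and inj: "\<And>i j x. pair i x \<in> F \<Longrightarrow> pair j x \<in> F \<Longrightarrow> i = j"
  shows False
proof -
  obtain m N where "m \<noteq> \<zero>" and m: "\<And>i. i \<prec> k \<Longrightarrow> dv (i \<oplus> \<one>) m"
    and "N \<noteq> \<zero>" and N: "\<And>i. i \<prec> k \<Longrightarrow> dv (beta m i) N"
    using ex_beta_basis by metis
  \<comment> \<open>\<open>n\<close> stands for the product over the values taken before
    \<open>j\<close>; the factors of values not yet taken stay cancellable, as in
    \<open>ex_code\<close>.\<close>
  let ?good = "\<lambda>j n. j \<preceq> n \<and> n \<noteq> \<zero> \<and> dv n N \<and> (\<forall>x. x \<prec> k \<longrightarrow> (\<forall>i. i \<prec> j \<longrightarrow> pair i x \<notin> F) \<longrightarrow>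
      (\<forall>q. q \<preceq> N \<longrightarrow> dv (beta m x) (n \<otimes> q) \<longrightarrow> dv (beta m x) q))"
  have "\<exists>n. ?good j n" for j
  proof (rule S1_induct[where P = "\<lambda>j. \<exists>n. ?good j n"])
    show "S1 (\<lambda>v. \<exists>n. ?good (v 0) n)"
      by (intro S1_exI0 D0_rules D0_dv Tm_beta F)
    show "\<exists>n. ?good \<zero> n"
      by (intro exI[of _ \<one>]) (auto simp: dv_def)
    fix j assume "\<exists>n. ?good j n"
    then obtain n where n: "?good j n" by blast
    obtain x where x: "x \<prec> k" "pair j x \<in> F" using total by blast
    have unused: "\<And>i. i \<prec> j \<Longrightarrow> pair i x \<notin> F" using inj x(2) less_irrefl' by blast
    obtain r where r: "N = n \<otimes> r" using n unfolding dv_def by blast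
    have "r \<preceq> N"
      using r n le_mult[of n r] by (simp add: arith.mult.commute)
    moreover have "dv (beta m x) (n \<otimes> r)" using N x(1) r by simp
    ultimately have "dv (beta m x) r"
      using n x(1) unused by blast
    then have "dv (n \<otimes> beta m x) N"
      using r unfolding dv_def by (metis arith.mult.assoc)
    moreover have "dv (beta m y) q"
      if "y \<prec> k" "\<forall>i. i \<prec> j \<oplus> \<one> \<longrightarrow> pair i y \<notin> F" "q \<preceq> N" "dv (beta m y) (n \<otimes> beta m x \<otimes> q)" for y q
    proof -
      have "y \<noteq> x" using that(2) x(2) by (auto simp: less_suc_iff)
      moreover have "dv (beta m y) ((n \<otimes> q) \<otimes> beta m x)"
        using that(4) by (simp only: ac_simps)
      ultimately have "dv (beta m y) (n \<otimes> q)"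
        using beta_coprime[of k m y x] m \<open>y \<prec> k\<close> x(1) by blast
      then show ?thesis using n that less_suc_iff by blast
    qed
    \<comment> \<open>As \<open>m\<close> is nonzero, each factor \<open>beta m x\<close> is at
      least 2, so the product grows by at least one.\<close>
    moreover have "j \<oplus> \<one> \<preceq> n \<otimes> beta m x"
    proof -
      have "n \<otimes> beta m x = n \<otimes> (m \<otimes> (x \<oplus> \<one>)) \<oplus> n"
        unfolding beta_def by (rule mult_suc)
      moreover have "n \<otimes> (m \<otimes> (x \<oplus> \<one>)) \<noteq> \<zero>"
        using n \<open>m \<noteq> \<zero>\<close> suc_neq_zero by simp
      then have "\<one> \<preceq> n \<otimes> (m \<otimes> (x \<oplus> \<one>))"
        using zero_or_suc[of "n \<otimes> (m \<otimes> (x \<oplus> \<one>))"] by auto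
      ultimately show ?thesis
        using n arith.add_mono[of \<one> "n \<otimes> (m \<otimes> (x \<oplus> \<one>))" j n] by (simp add: add_commute')
    qed
    moreover have "n \<otimes> beta m x \<noteq> \<zero>" using n by simp
    ultimately show "\<exists>n. ?good (j \<oplus> \<one>) n"
      by (intro exI[of _ "n \<otimes> beta m x"]) blast
  qed
  then obtain n where "N \<oplus> \<one> \<preceq> n" "dv n N" by blast
  then have "N \<oplus> \<one> \<preceq> N" using dv_le \<open>N \<noteq> \<zero>\<close> arith.order_trans by blast
  then show False using less_irrefl' by (simp add: suc_le_iff)
qed


subsection \<open>Primitive recursion\<close>

text \<open>\<open>Comp s i\<close> says that \<open>s\<close> contains a computation up to
  \<open>i\<close>. Computations exist by Sigma01 induction and agree where both are defined. So the
  value at \<open>i\<close> is \<open>x\<close> iff some computation has value \<open>x\<close>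
  there, and it is not \<open>x\<close> iff some computation has another value.\<close>

lemma primitive_recursion:
  assumes N: "N \<in> range \<sigma>" and total: "\<And>z. \<exists>x. pair z x \<in> N"
    and unique: "\<And>z x y. pair z x \<in> N \<Longrightarrow> pair z y \<in> N \<Longrightarrow> x = y"
  obtains F where "F \<in> range \<sigma>" "\<And>i. \<exists>x. pair i x \<in> F"
    "\<And>i x y. pair i x \<in> F \<Longrightarrow> pair i y \<in> F \<Longrightarrow> x = y"
    "pair \<zero> a \<in> F" "\<And>i x y. pair i x \<in> F \<Longrightarrow> pair (i \<oplus> \<one>) y \<in> F \<Longrightarrow> pair x y \<in> N"
proof -
  define Comp where "Comp s i \<longleftrightarrow> In (pair \<zero> a) s \<and> (\<forall>x. x \<prec> s \<longrightarrow> In (pair \<zero> x) s \<longrightarrow> x = a) \<and>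
    (\<forall>y. y \<prec> i \<longrightarrow> (\<exists>x. x \<prec> s \<and> In (pair (y \<oplus> \<one>) x) s) \<and>
      (\<forall>x. x \<prec> s \<longrightarrow> In (pair (y \<oplus> \<one>) x) s \<longrightarrow> (\<exists>z. z \<prec> s \<and> In (pair y z) s \<and> pair z x \<in> N)))" for s i
  have D0_Comp: "D0 (\<lambda>v. Comp (f v) (g v))" if "Tm f" "Tm g" for f g
  proof (rule D0_subst2[OF _ that])
    show "D0 (\<lambda>v. Comp (v 0) (v 1))"
      unfolding Comp_def by (intro D0_rules N)
  qed
  \<comment> \<open>Existence and uniqueness are proved together in bounded form, to suit
    \<open>D0_induct\<close>; taking \<open>s\<close> for both computations also yields that a
    single one is total and single-valued up to its index.\<close>
  have agree: "\<exists>x. x \<prec> s \<oplus> t \<and> In (pair y x) s \<and> In (pair y x) t \<and>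
      (\<forall>x'. x' \<prec> s \<oplus> t \<longrightarrow> In (pair y x') s \<or> In (pair y x') t \<longrightarrow> x' = x)"
    if s: "Comp s i" and t: "Comp t j" and y: "y \<preceq> i" "y \<preceq> j" for s t i j y
  proof -
    let ?P = "\<lambda>y. y \<preceq> i \<longrightarrow> y \<preceq> j \<longrightarrow> (\<exists>x. x \<prec> s \<oplus> t \<and> In (pair y x) s \<and> In (pair y x) t \<and>
      (\<forall>x'. x' \<prec> s \<oplus> t \<longrightarrow> In (pair y x') s \<or> In (pair y x') t \<longrightarrow> x' = x))"
    have less_sum: "x \<prec> s \<oplus> t" if "In (pair y x) s \<or> In (pair y x) t" for x y
      using that In_pair_less(2) le_add_left le_add_right arith.less_le_trans by blast
    have "?P y"
    proof (rule D0_induct[where P = ?P])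
      show "D0 (\<lambda>v. ?P (v 0))" by (intro D0_rules)
      have "In (pair \<zero> a) s" "In (pair \<zero> a) t" "x' = a" if "In (pair \<zero> x') s \<or> In (pair \<zero> x') t" for x'
        using s t that In_pair_less(2) unfolding Comp_def by blast+
      moreover have "In (pair \<zero> a) s" "In (pair \<zero> a) t" using s t unfolding Comp_def by blast+
      ultimately show "?P \<zero>" using less_sum by blast
      fix y assume IH: "?P y"
      show "?P (y \<oplus> \<one>)"
      proof (intro impI)
        assume le: "y \<oplus> \<one> \<preceq> i" "y \<oplus> \<one> \<preceq> j"
        then have "y \<prec> i" "y \<prec> j" by (simp_all add: suc_le_iff)
        then obtain z where z: "\<And>z'. In (pair y z') s \<or> In (pair y z') t \<Longrightarrow> z' = z"
          using IH less_sum arith.less_imp_le by meson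
        have next_N: "pair z x \<in> N" if "In (pair (y \<oplus> \<one>) x) s \<or> In (pair (y \<oplus> \<one>) x) t" for x
          using s t that z \<open>y \<prec> i\<close> \<open>y \<prec> j\<close> In_pair_less(2) unfolding Comp_def by metis
        obtain x x' where "In (pair (y \<oplus> \<one>) x) s" "In (pair (y \<oplus> \<one>) x') t"
          using s t \<open>y \<prec> i\<close> \<open>y \<prec> j\<close> unfolding Comp_def by blast
        then show "\<exists>x. x \<prec> s \<oplus> t \<and> In (pair (y \<oplus> \<one>) x) s \<and> In (pair (y \<oplus> \<one>) x) t \<and>
            (\<forall>x'. x' \<prec> s \<oplus> t \<longrightarrow> In (pair (y \<oplus> \<one>) x') s \<or> In (pair (y \<oplus> \<one>) x') t \<longrightarrow> x' = x)"
          using next_N unique less_sum by metis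
      qed
    qed
    then show ?thesis using y by blast
  qed
  have agree': "x = x'"
    if "Comp s i" "Comp t j" "y \<preceq> i" "y \<preceq> j" "In (pair y x) s" "In (pair y x') t" for s t i j y x x'
  proof -
    have "x \<prec> s \<oplus> t" "x' \<prec> s \<oplus> t"
      using that(5,6) In_pair_less(2) le_add_left le_add_right arith.less_le_trans by blast+
    then show ?thesis using agree[OF that(1-4)] that(5,6) by blast
  qed
  have ex_Comp: "\<exists>s. Comp s i" for i
  proof (rule S1_induct[where P = "\<lambda>i. \<exists>s. Comp s i"])
    show "S1 (\<lambda>v. \<exists>s. Comp s (v 0))"
      by (intro S1_exI0 D0_Comp Tm_intros)
    have "{n. n = pair \<zero> a} \<in> range \<sigma>" by (intro D0_set D0_rules)
    then have "{pair \<zero> a} \<in> range \<sigma>" by simp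
    then obtain s where "\<And>n. In n s \<longleftrightarrow> n \<prec> pair \<zero> a \<oplus> \<one> \<and> n \<in> {pair \<zero> a}"
      using ex_FinCode by blast
    then have "Comp s \<zero>" unfolding Comp_def by (auto simp: less_suc_iff)
    then show "\<exists>s. Comp s \<zero>" by blast
    fix i assume "\<exists>s. Comp s i"
    then obtain s where s: "Comp s i" by blast
    then obtain x where x: "In (pair i x) s" using agree[OF s s, of i] by auto
    obtain x' where x': "pair x x' \<in> N" using total by blast
    \<comment> \<open>The old set is cut off after index \<open>i\<close>, since it may contain
      arbitrary pairs beyond, and then receives its value at
      \<open>i \<oplus> \<one>\<close>.\<close>
    define A where "A = {n. (\<exists>y. y \<preceq> i \<and> (\<exists>z. z \<prec> s \<and> n = pair y z \<and> In n s)) \<or> n = pair (i \<oplus> \<one>) x'}"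
    have "A \<in> range \<sigma>" unfolding A_def by (intro D0_set D0_rules)
    from ex_FinCode[OF this, where k = "s \<oplus> pair (i \<oplus> \<one>) x' \<oplus> \<one>"]
    obtain t where t: "\<And>n. In n t \<longleftrightarrow> n \<prec> s \<oplus> pair (i \<oplus> \<one>) x' \<oplus> \<one> \<and> n \<in> A"
      by blast
    have "n \<prec> s \<oplus> pair (i \<oplus> \<one>) x' \<oplus> \<one>" if "n \<in> A" for n
    proof -
      have "n \<preceq> s \<or> n \<preceq> pair (i \<oplus> \<one>) x'"
        using that In_less arith.less_imp_le unfolding A_def by blast
      then show ?thesis
        unfolding less_suc_le using le_add_left le_add_right arith.order_trans by blast
    qed
    then have t_iff: "In n t \<longleftrightarrow> (\<exists>y. y \<preceq> i \<and> (\<exists>z. z \<prec> s \<and> n = pair y z \<and> In n s)) \<or>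
        n = pair (i \<oplus> \<one>) x'" for n
      using t A_def by blast
    have not_le: "\<not> i \<oplus> \<one> \<preceq> i" by (simp add: suc_le_iff)
    have old: "In (pair y z) t \<longleftrightarrow> In (pair y z) s" if "y \<preceq> i" for y z
      unfolding t_iff using that not_le In_pair_less(2) by auto
    have new: "In (pair (i \<oplus> \<one>) z) t \<longleftrightarrow> z = x'" for z
      unfolding t_iff using not_le by auto
    have "(\<exists>x. x \<prec> t \<and> In (pair (y \<oplus> \<one>) x) t) \<and>
        (\<forall>x. x \<prec> t \<longrightarrow> In (pair (y \<oplus> \<one>) x) t \<longrightarrow> (\<exists>z. z \<prec> t \<and> In (pair y z) t \<and> pair z x \<in> N))"
      if "y \<prec> i \<oplus> \<one>" for y
    proof (cases "y = i")
      case True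
      have 1: "In (pair i x) t" using old[of i] x by simp
      have 2: "In (pair (i \<oplus> \<one>) x') t" using new by simp
      show ?thesis
        unfolding True new using x' 1 In_pair_less(2)[OF 1] In_pair_less(2)[OF 2] by auto
    next
      case False
      then have "y \<prec> i" using that by (simp add: less_suc_iff)
      then have "y \<preceq> i" "y \<oplus> \<one> \<preceq> i" by (simp_all add: suc_le_iff arith.less_imp_le)
      moreover have "\<exists>x. In (pair (y \<oplus> \<one>) x) s"
        "\<And>x. In (pair (y \<oplus> \<one>) x) s \<Longrightarrow> \<exists>z. In (pair y z) s \<and> pair z x \<in> N"
        using s \<open>y \<prec> i\<close> In_pair_less(2) unfolding Comp_def by blast+
      ultimately have "\<exists>x. In (pair (y \<oplus> \<one>) x) t"
        "\<And>x. In (pair (y \<oplus> \<one>) x) t \<Longrightarrow> \<exists>z. In (pair y z) t \<and> pair z x \<in> N"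
        by (simp_all add: old)
      then show ?thesis using In_pair_less(2) by blast
    qed
    moreover have "In (pair \<zero> a) t \<and> (\<forall>x. x \<prec> t \<longrightarrow> In (pair \<zero> x) t \<longrightarrow> x = a)"
      using s old[OF zero_le] In_pair_less(2) unfolding Comp_def by blast
    ultimately have "Comp t (i \<oplus> \<one>)" unfolding Comp_def by blast
    then show "\<exists>s. Comp s (i \<oplus> \<one>)" by blast
  qed
  obtain F where F: "F \<in> range \<sigma>" and F_iff: "\<And>i x. pair i x \<in> F \<longleftrightarrow> (\<exists>s. Comp s i \<and> In (pair i x) s)"
  proof (rule comprehension_rel)
    show "S1 (\<lambda>v. \<exists>s. Comp s (v 0) \<and> In (pair (v 0) (v 1)) s)"
      by (intro S1_exI0 D0_rules D0_Comp)
    show "S1 (\<lambda>v. \<exists>s. Comp s (v 0) \<and> (\<exists>y. y \<prec> s \<and> In (pair (v 0) y) s \<and> y \<noteq> v 1))"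
      by (intro S1_exI0 D0_rules D0_Comp)
    show "(\<exists>s. Comp s i \<and> (\<exists>y. y \<prec> s \<and> In (pair i y) s \<and> y \<noteq> x)) \<longleftrightarrow>
        \<not> (\<exists>s. Comp s i \<and> In (pair i x) s)" for i x
    proof -
      obtain s where s: "Comp s i" using ex_Comp by blast
      then obtain y where "In (pair i y) s" using agree[OF s s, of i] by auto
      then show ?thesis using s agree'[of _ i _ i i] In_pair_less(2) by (metis arith.order_refl)
    qed
  qed blast
  show ?thesis
  proof
    show "F \<in> range \<sigma>" by (rule F)
    show "\<exists>x. pair i x \<in> F" for i
    proof -
      obtain s where s: "Comp s i" using ex_Comp by blast
      then obtain y where "In (pair i y) s" using agree[OF s s, of i] by auto
      then show ?thesis using s F_iff by blast
    qed
    show "x = y" if "pair i x \<in> F" "pair i y \<in> F" for i x y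
      using that agree'[of _ i _ i i] unfolding F_iff by (metis arith.order_refl)
    show "pair \<zero> a \<in> F"
      using ex_Comp[of \<zero>] unfolding F_iff Comp_def by blast
    show "pair x y \<in> N" if x: "pair i x \<in> F" and y: "pair (i \<oplus> \<one>) y \<in> F" for i x y
    proof -
      obtain s where s: "Comp s i" "In (pair i x) s"
        using x F_iff by blast
      obtain t where t: "Comp t (i \<oplus> \<one>)" "In (pair (i \<oplus> \<one>) y) t"
        using y F_iff by blast
      have "i \<prec> i \<oplus> \<one>" by (simp add: less_suc_le)
      then obtain z where z: "In (pair i z) t" "pair z y \<in> N"
        using t In_pair_less(2) unfolding Comp_def by metis
      then have "z = x" using agree'[OF t(1) s(1) _ _ z(1) s(2)] by simp
      then show ?thesis using z(2) by simp
    qed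
  qed
qed

text \<open>The recursion iterates the map from \<open>z\<close> to the least element of
  \<open>V\<close> above \<open>z\<close>.\<close>

lemma increasing_enumeration:
  assumes V: "V \<in> range \<sigma>" and unbounded: "\<And>b. \<exists>x. x \<in> V \<and> b \<prec> x"
  obtains G where "G \<in> range \<sigma>" "\<And>i. \<exists>x. pair i x \<in> G"
    "\<And>i x y. pair i x \<in> G \<Longrightarrow> pair i y \<in> G \<Longrightarrow> x = y" "\<And>i x. pair i x \<in> G \<Longrightarrow> x \<in> V"
    "\<And>i j x y. i \<prec> j \<Longrightarrow> pair i x \<in> G \<Longrightarrow> pair j y \<in> G \<Longrightarrow> x \<prec> y"
proof -
  let ?next = "\<lambda>z x. x \<in> V \<and> z \<prec> x \<and> (\<forall>w. w \<prec> x \<longrightarrow> z \<prec> w \<longrightarrow> w \<notin> V)"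
  obtain N where N: "N \<in> range \<sigma>" and N_iff: "\<And>z x. pair z x \<in> N \<longleftrightarrow> ?next z x"
  proof (rule comprehension_rel)
    show "S1 (\<lambda>v. ?next (v 0) (v 1))" by (intro D0_S1 D0_rules V)
    show "S1 (\<lambda>v. \<not> ?next (v 0) (v 1))" by (intro D0_S1 D0_rules V)
  qed auto
  obtain a where "a \<in> V" using unbounded by blast
  have N_total: "\<exists>x. pair z x \<in> N" for z
  proof -
    have "D0 (\<lambda>v. v 0 \<in> V \<and> z \<prec> v 0)" by (intro D0_rules V)
    moreover obtain x where "x \<in> V \<and> z \<prec> x" using unbounded by blast
    ultimately show ?thesis
      unfolding N_iff using least_element[of "\<lambda>x. x \<in> V \<and> z \<prec> x"] by metis
  qed
  have N_unique: "x = y" if "pair z x \<in> N" "pair z y \<in> N" for z x y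
    using that less_linear' unfolding N_iff by blast
  obtain G where G: "G \<in> range \<sigma>" "\<And>i. \<exists>x. pair i x \<in> G"
    "\<And>i x y. pair i x \<in> G \<Longrightarrow> pair i y \<in> G \<Longrightarrow> x = y" "pair \<zero> a \<in> G"
    and step: "\<And>i x y. pair i x \<in> G \<Longrightarrow> pair (i \<oplus> \<one>) y \<in> G \<Longrightarrow> pair x y \<in> N"
    by (rule primitive_recursion[OF N N_total N_unique, where a = a]) blast+
  have in_V: "x \<in> V" if "pair i x \<in> G" for i x
    using zero_or_suc[of i]
  proof
    assume "i = \<zero>"
    then show ?thesis using that G(3,4) \<open>a \<in> V\<close> by blast
  next
    assume "\<exists>j. i = j \<oplus> \<one>"
    then show ?thesis using that G(2) step N_iff by blast
  qed
  have "x \<prec> y" if "i \<prec> j" "pair i x \<in> G" "pair j y \<in> G" for i j x y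
  proof -
    \<comment> \<open>In existential form the claim is Sigma01; uniqueness of values turns it back
      into a statement about the given \<open>y\<close>.\<close>
    have "\<exists>y. i \<prec> j \<longrightarrow> pair j y \<in> G \<and> x \<prec> y"
    proof (rule S1_induct[where P = "\<lambda>j. \<exists>y. i \<prec> j \<longrightarrow> pair j y \<in> G \<and> x \<prec> y"])
      show "S1 (\<lambda>v. \<exists>y. i \<prec> v 0 \<longrightarrow> pair (v 0) y \<in> G \<and> x \<prec> y)"
        by (intro S1_exI0 D0_rules G(1))
      fix j assume IH: "\<exists>y. i \<prec> j \<longrightarrow> pair j y \<in> G \<and> x \<prec> y"
      obtain y' where y': "pair (j \<oplus> \<one>) y' \<in> G" using G(2) by blast
      have "x \<prec> y'" if ij: "i \<prec> j \<oplus> \<one>"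
      proof (cases "i = j")
        case True
        then show ?thesis using step \<open>pair i x \<in> G\<close> y' N_iff by blast
      next
        case False
        then obtain y where "pair j y \<in> G" "x \<prec> y"
          using IH ij by (auto simp: less_suc_iff)
        then show ?thesis using step y' N_iff arith.less_trans by blast
      qed
      then show "\<exists>y. i \<prec> j \<oplus> \<one> \<longrightarrow> pair (j \<oplus> \<one>) y \<in> G \<and> x \<prec> y" using y' by blast
    qed simp
    then show ?thesis using that G(3) by blast
  qed
  then show ?thesis using that[of G] G(1-3) in_V by blast
qed

end

section \<open>The equivalences\<close>

context rca0_model
begin

definition Good :: "'a set \<Rightarrow> bool" where
  "Good F \<longleftrightarrow> (\<exists>i j d e. i \<prec> j \<and> pair i d \<in> F \<and> pair j e \<in> F \<and> LeD d e)"

lemma DiagramSeqD: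
  assumes "DiagramSeq F"
  shows "\<exists>d. pair i d \<in> F" "pair i d \<in> F \<Longrightarrow> pair i e \<in> F \<Longrightarrow> d = e" "pair i d \<in> F \<Longrightarrow> Diagram d"
proof -
  show "\<exists>d. pair i d \<in> F" "pair i d \<in> F \<Longrightarrow> pair i e \<in> F \<Longrightarrow> d = e"
    using assms unfolding DiagramSeq_def by blast+
  assume "pair i d \<in> F"
  then obtain i' d' where "Diagram d'" "pair i d = pair i' d'"
    using assms unfolding DiagramSeq_def by blast
  then show "Diagram d" by simp
qed

lemma DiagramSeqI:
  assumes "\<And>n. n \<in> F \<Longrightarrow> \<exists>i d. n = pair i d" "\<And>i d. pair i d \<in> F \<Longrightarrow> Diagram d"
    and "\<And>i. \<exists>d. pair i d \<in> F" "\<And>i d e. pair i d \<in> F \<Longrightarrow> pair i e \<in> F \<Longrightarrow> d = e"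
  shows "DiagramSeq F"
  unfolding DiagramSeq_def using assms by metis

text \<open>The sequence takes the least diagram that is new in each next set. Were \<open>d\<close>
  at \<open>i\<close> below \<open>e\<close> at a later \<open>j\<close>, then \<open>d\<close>
  would be in the set with index \<open>j\<close>, and so would \<open>e\<close> by upward closure;
  but \<open>e\<close> is new only in the next one.\<close>

lemma WPO_imp_ACC:
  assumes WPO: "\<And>F. F \<in> range \<sigma> \<Longrightarrow> DiagramSeq F \<Longrightarrow> Good F"
    and U: "U \<in> range \<sigma>" and up: "\<And>i. UpClosed (\<lambda>d. pair d i \<in> U)" and asc: "Ascending U"
  shows False
proof -
  let ?new = "\<lambda>i d. pair d (i \<oplus> \<one>) \<in> U \<and> pair d i \<notin> U"
  let ?R = "\<lambda>i d. ?new i d \<and> (\<forall>x. x \<prec> d \<longrightarrow> \<not> ?new i x)"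
  obtain F where F: "F \<in> range \<sigma>" and F_iff: "\<And>i d. pair i d \<in> F \<longleftrightarrow> ?R i d"
    and F_pairs: "\<And>n. n \<in> F \<Longrightarrow> \<exists>i d. n = pair i d"
  proof (rule comprehension_rel)
    show "S1 (\<lambda>v. ?R (v 0) (v 1))" by (intro D0_S1 D0_rules U)
    show "S1 (\<lambda>v. \<not> ?R (v 0) (v 1))" by (intro D0_S1 D0_rules U)
  qed blast+
  have diag: "Diagram d" if "pair d i \<in> U" for d i
    using up[of i] that unfolding UpClosed_def by blast
  have "DiagramSeq F"
  proof (rule DiagramSeqI[OF F_pairs])
    show "\<exists>d. pair i d \<in> F" for i
    proof -
      have "i \<prec> i \<oplus> \<one>" by (simp add: less_suc_le)
      then obtain x where x: "?new i x" using asc unfolding Ascending_def by blast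
      have "D0 (\<lambda>v. ?new i (v 0))" by (intro D0_rules U)
      then obtain d where "?new i d" "\<And>x. x \<prec> d \<Longrightarrow> \<not> ?new i x"
        by (rule least_element[where P = "?new i", OF _ x]) blast
      then show ?thesis unfolding F_iff by blast
    qed
    show "d = e" if "pair i d \<in> F" "pair i e \<in> F" for i d e
      using that less_linear' unfolding F_iff by blast
    show "Diagram d" if "pair i d \<in> F" for i d
      using that diag unfolding F_iff by blast
  qed
  then obtain i j d e where ij: "i \<prec> j" and "pair i d \<in> F" "pair j e \<in> F" and de: "LeD d e"
    using WPO[OF F] unfolding Good_def by blast
  then have d: "pair d (i \<oplus> \<one>) \<in> U" and e: "pair e j \<notin> U" "Diagram e"
    using F_iff diag by blast+
  have "i \<oplus> \<one> \<preceq> j" using ij by (simp add: suc_le_iff)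
  then have "pair d j \<in> U" using d asc unfolding Ascending_def le_def by blast
  then show False using up[of j] de e unfolding UpClosed_def by blast
qed

text \<open>The set with index \<open>i\<close> is the upward closure of the terms up to
  \<open>i\<close>. These sets ascend strictly because, without a good pair, each term lies above no
  earlier one.\<close>

lemma ACC_finitely_generated_imp_WPO:
  assumes ACC: "\<And>U. U \<in> range \<sigma> \<Longrightarrow> (\<And>i. FinGen (\<lambda>d. pair d i \<in> U)) \<Longrightarrow>
      (\<And>i. UpClosed (\<lambda>d. pair d i \<in> U)) \<Longrightarrow> Ascending U \<Longrightarrow> False"
    and F: "F \<in> range \<sigma>" and seq: "DiagramSeq F"
  shows "Good F"
proof (rule ccontr)
  assume bad: "\<not> Good F"
  note F_total = DiagramSeqD(1)[OF seq] and F_unique = DiagramSeqD(2)[OF seq]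
    and F_diagram = DiagramSeqD(3)[OF seq]
  let ?R = "\<lambda>e i. Diagram e \<and> (\<exists>j. j \<preceq> i \<and> (\<exists>d. pair j d \<in> F \<and> LeD d e))"
  let ?R' = "\<lambda>e i. \<not> Diagram e \<or> (\<forall>j. j \<preceq> i \<longrightarrow> (\<exists>d. pair j d \<in> F \<and> \<not> LeD d e))"
  obtain U where U: "U \<in> range \<sigma>" and U_iff: "\<And>e i. pair e i \<in> U \<longleftrightarrow> ?R e i"
  proof (rule comprehension_rel)
    show "S1 (\<lambda>v. ?R (v 0) (v 1))"
      by (intro S1_intros; intro D0_S1 D0_rules D0_Diagram D0_LeD F)
    show "S1 (\<lambda>v. ?R' (v 0) (v 1))"
      by (intro S1_intros; intro D0_S1 D0_rules D0_Diagram D0_LeD F)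
    show "?R' e i \<longleftrightarrow> \<not> ?R e i" for e i
      using F_total F_unique by blast
  qed blast
  have up: "UpClosed (\<lambda>d. pair d i \<in> U)" for i
    unfolding UpClosed_def U_iff using LeD_trans by blast
  have "Ascending U"
    unfolding Ascending_def
  proof (intro allI impI conjI)
    fix i j d assume "i \<prec> j" "pair d i \<in> U"
    then show "pair d j \<in> U"
      unfolding U_iff using arith.order_trans arith.less_imp_le by blast
  next
    fix i j assume "i \<prec> j"
    obtain d where d: "pair j d \<in> F" using F_total by blast
    then have "pair d j \<in> U"
      unfolding U_iff using LeD_refl F_diagram by blast
    moreover have "\<not> pair d i \<in> U"
    proof
      assume "pair d i \<in> U"
      then obtain k e where "k \<preceq> i" "pair k e \<in> F" "LeD e d" unfolding U_iff by blast
      then show False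
        using bad d \<open>i \<prec> j\<close> arith.le_less_trans unfolding Good_def by blast
    qed
    ultimately show "\<exists>d. pair d j \<in> U \<and> pair d i \<notin> U" by blast
  qed
  moreover have "FinGen (\<lambda>d. pair d i \<in> U)" for i
  proof -
    \<comment> \<open>Collection bounds the generators, so that they form a coded finite
      set.\<close>
    have "D0 (\<lambda>v. pair (v 0) (v 1) \<in> F)" by (intro D0_rules F)
    from D0_collection[OF this, of "i \<oplus> \<one>"]
    obtain b where b: "\<And>j. j \<preceq> i \<Longrightarrow> \<exists>d. d \<preceq> b \<and> pair j d \<in> F"
      using F_total unfolding less_suc_le by blast
    define A where "A = {d. \<exists>j. j \<preceq> i \<and> pair j d \<in> F}"
    have "A \<in> range \<sigma>" unfolding A_def by (intro D0_set D0_rules F)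
    from ex_FinCode[OF this, where k = "b \<oplus> \<one>"]
    obtain s where "FinCode s" and s: "\<And>d. In d s \<longleftrightarrow> d \<preceq> b \<and> d \<in> A"
      unfolding less_suc_le by blast
    have s_iff: "In d s \<longleftrightarrow> (\<exists>j. j \<preceq> i \<and> pair j d \<in> F)" for d
      unfolding s A_def using b F_unique by blast
    show ?thesis
      unfolding FinGen_def InUcl_def s_iff U_iff
      using \<open>FinCode s\<close> F_diagram s_iff by (intro exI[of _ s]) auto
  qed
  ultimately show False using ACC U up by blast
qed

lemma WPO_imp_sequences_finitely_generated:
  assumes WPO: "\<And>F. F \<in> range \<sigma> \<Longrightarrow> DiagramSeq F \<Longrightarrow> Good F"
    and F: "F \<in> range \<sigma>" and seq: "DiagramSeq F" and up: "UpClosedSeq F"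
  shows "FinGen (InRange F)"
proof -
  note F_total = DiagramSeqD(1)[OF seq] and F_unique = DiagramSeqD(2)[OF seq]
    and F_diagram = DiagramSeqD(3)[OF seq]
  \<comment> \<open>The two existential quantifiers merely name the values of \<open>F\<close> at
    \<open>m\<close> and \<open>n\<close>, so the complement is Sigma01 as well.\<close>
  let ?V = "{n. \<forall>m. m \<prec> n \<longrightarrow> (\<exists>d e. pair m d \<in> F \<and> pair n e \<in> F \<and> \<not> LeD d e)}"
  have V: "?V \<in> range \<sigma>"
  proof (rule comprehension_set)
    show "S1 (\<lambda>v. \<forall>m. m \<prec> v 0 \<longrightarrow> (\<exists>d e. pair m d \<in> F \<and> pair (v 0) e \<in> F \<and> \<not> LeD d e))"
      by (intro S1_intros; intro D0_S1 D0_rules D0_LeD F)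
    show "S1 (\<lambda>v. \<exists>m. m \<prec> v 0 \<and> (\<exists>d e. pair m d \<in> F \<and> pair (v 0) e \<in> F \<and> LeD d e))"
      by (intro S1_intros; intro D0_S1 D0_rules D0_LeD F)
    show "(\<exists>m. m \<prec> n \<and> (\<exists>d e. pair m d \<in> F \<and> pair n e \<in> F \<and> LeD d e)) \<longleftrightarrow>
        \<not> (\<forall>m. m \<prec> n \<longrightarrow> (\<exists>d e. pair m d \<in> F \<and> pair n e \<in> F \<and> \<not> LeD d e))" for n
      using F_total F_unique by metis
  qed
  have "\<exists>b. \<forall>n\<in>?V. n \<preceq> b"
  proof (rule ccontr)
    assume "\<not> ?thesis"
    then have unbounded: "\<exists>n. n \<in> ?V \<and> b \<prec> n" for b
      by (meson arith.not_less)
    obtain G where G: "G \<in> range \<sigma>" and G_total: "\<And>i. \<exists>n. pair i n \<in> G"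
      and G_unique: "\<And>i m n. pair i m \<in> G \<Longrightarrow> pair i n \<in> G \<Longrightarrow> m = n"
      and G_V: "\<And>i n. pair i n \<in> G \<Longrightarrow> n \<in> ?V"
      and G_mono: "\<And>i j m n. i \<prec> j \<Longrightarrow> pair i m \<in> G \<Longrightarrow> pair j n \<in> G \<Longrightarrow> m \<prec> n"
      by (rule increasing_enumeration[OF V unbounded]) blast+
    obtain H where H: "H \<in> range \<sigma>" and H_iff: "\<And>i d. pair i d \<in> H \<longleftrightarrow> (\<exists>n. pair i n \<in> G \<and> pair n d \<in> F)"
      and H_pairs: "\<And>n. n \<in> H \<Longrightarrow> \<exists>i d. n = pair i d"
    proof (rule comprehension_rel)
      show "S1 (\<lambda>v. \<exists>n. pair (v 0) n \<in> G \<and> pair n (v 1) \<in> F)"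
        by (intro S1_intros; intro D0_S1 D0_rules F G)
      show "S1 (\<lambda>v. \<exists>n e. pair (v 0) n \<in> G \<and> pair n e \<in> F \<and> e \<noteq> v 1)"
        by (intro S1_intros; intro D0_S1 D0_rules F G)
      show "(\<exists>n e. pair i n \<in> G \<and> pair n e \<in> F \<and> e \<noteq> d) \<longleftrightarrow>
          \<not> (\<exists>n. pair i n \<in> G \<and> pair n d \<in> F)" for i d
        using F_total F_unique G_total G_unique by metis
    qed blast+
    have "DiagramSeq H"
    proof (rule DiagramSeqI[OF H_pairs])
      show "Diagram d" if "pair i d \<in> H" for i d
        using that F_diagram unfolding H_iff by blast
      show "\<exists>d. pair i d \<in> H" for i
        unfolding H_iff using F_total G_total by blast
      show "d = e" if "pair i d \<in> H" "pair i e \<in> H" for i d e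
        using that F_unique G_unique unfolding H_iff by metis
    qed
    then obtain i j d e m n where "i \<prec> j" "LeD d e" "pair i m \<in> G" "pair m d \<in> F"
      "pair j n \<in> G" "pair n e \<in> F"
      using WPO[OF H] unfolding Good_def H_iff by blast
    \<comment> \<open>The later index lies in \<open>V\<close>, so its diagram is above no earlier
      one, against the good pair of \<open>H\<close>.\<close>
    then show False using G_mono[of i j m n] G_V[of j n] F_unique by blast
  qed
  then obtain b where b: "\<And>n. n \<in> ?V \<Longrightarrow> n \<preceq> b" by blast
  define A where "A = {d. \<exists>n. n \<preceq> b \<and> pair n d \<in> F}"
  have "D0 (\<lambda>v. pair (v 0) (v 1) \<in> F)" by (intro D0_rules F)
  from D0_collection[OF this, of "b \<oplus> \<one>"]
  obtain c where c: "\<And>n. n \<preceq> b \<Longrightarrow> \<exists>d. d \<preceq> c \<and> pair n d \<in> F"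
    using F_total unfolding less_suc_le by blast
  have "A \<in> range \<sigma>" unfolding A_def by (intro D0_set D0_rules F)
  from ex_FinCode[OF this, where k = "c \<oplus> \<one>"]
  obtain s where "FinCode s" and s: "\<And>d. In d s \<longleftrightarrow> d \<preceq> c \<and> d \<in> A"
    unfolding less_suc_le by blast
  have s_iff: "In d s \<longleftrightarrow> (\<exists>n. n \<preceq> b \<and> pair n d \<in> F)" for d
    unfolding s A_def using c F_unique by blast
  have "InUcl e s \<longleftrightarrow> InRange F e" for e
  proof
    assume "InUcl e s"
    then show "InRange F e"
      using up unfolding InUcl_def s_iff UpClosedSeq_def by blast
  next
    assume "InRange F e"
    then obtain n where n: "pair n e \<in> F" unfolding InRange_def by blast
    \<comment> \<open>The first index whose diagram lies below \<open>e\<close> belongs to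
      \<open>V\<close>: an earlier diagram below that one would lie below \<open>e\<close>,
      too.\<close>
    let ?B = "{m. \<exists>d. pair m d \<in> F \<and> LeD d e}"
    have B: "?B \<in> range \<sigma>"
    proof (rule comprehension_set)
      show "S1 (\<lambda>v. \<exists>d. pair (v 0) d \<in> F \<and> LeD d e)"
        by (intro S1_intros; intro D0_S1 D0_rules D0_LeD F)
      show "S1 (\<lambda>v. \<exists>d. pair (v 0) d \<in> F \<and> \<not> LeD d e)"
        by (intro S1_intros; intro D0_S1 D0_rules D0_LeD F)
    qed (use F_total F_unique in blast)
    have "n \<in> ?B" using n LeD_refl F_diagram by blast
    then obtain m where m: "m \<in> ?B" and least: "\<And>x. x \<prec> m \<Longrightarrow> x \<notin> ?B"
      using least_member[OF B] by blast
    then obtain d where d: "pair m d \<in> F" "LeD d e" by blast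
    have "m \<in> ?V"
    proof (intro CollectI allI impI)
      fix k assume "k \<prec> m"
      obtain d' where "pair k d' \<in> F" using F_total by blast
      moreover from this have "\<not> LeD d' d"
        using least[OF \<open>k \<prec> m\<close>] LeD_trans d(2) by blast
      ultimately show "\<exists>d e. pair k d \<in> F \<and> pair m e \<in> F \<and> \<not> LeD d e" using d(1) by blast
    qed
    then show "InUcl e s"
      unfolding InUcl_def s_iff using b d F_diagram n by blast
  qed
  then show ?thesis
    unfolding FinGen_def using \<open>FinCode s\<close> s_iff F_diagram by blast
qed

text \<open>A nonempty set is the range of the map that is the identity on it and takes the fixed
  element \<open>a\<close> elsewhere. The empty set is not the range of a sequence, but the empty
  finite set generates it.\<close>

lemma sequences_imp_sets_finitely_generated:
  assumes seqs: "\<And>F. F \<in> range \<sigma> \<Longrightarrow> DiagramSeq F \<Longrightarrow> UpClosedSeq F \<Longrightarrow> FinGen (InRange F)"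
    and U: "U \<in> range \<sigma>" and up: "UpClosed (\<lambda>d. d \<in> U)"
  shows "FinGen (\<lambda>d. d \<in> U)"
proof (cases "U = {}")
  case True
  from ex_FinCode[OF U, where k = \<zero>]
  obtain s where "FinCode s" "\<And>d. \<not> In d s" by auto
  then show ?thesis unfolding FinGen_def InUcl_def using True by blast
next
  case False
  then obtain a where a: "a \<in> U" by blast
  let ?R = "\<lambda>n d. n \<in> U \<and> d = n \<or> n \<notin> U \<and> d = a"
  obtain F where F: "F \<in> range \<sigma>" and F_iff: "\<And>n d. pair n d \<in> F \<longleftrightarrow> ?R n d"
    and F_pairs: "\<And>n. n \<in> F \<Longrightarrow> \<exists>i d. n = pair i d"
  proof (rule comprehension_rel)
    show "S1 (\<lambda>v. ?R (v 0) (v 1))" by (intro D0_S1 D0_rules U)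
    show "S1 (\<lambda>v. \<not> ?R (v 0) (v 1))" by (intro D0_S1 D0_rules U)
  qed blast+
  have range: "InRange F d \<longleftrightarrow> d \<in> U" for d
    unfolding InRange_def F_iff using a by blast
  have "DiagramSeq F"
  proof (rule DiagramSeqI[OF F_pairs])
    show "Diagram d" if "pair n d \<in> F" for n d
      using that a up unfolding F_iff UpClosed_def by blast
    show "\<exists>d. pair n d \<in> F" for n
      unfolding F_iff by blast
    show "d = e" if "pair n d \<in> F" "pair n e \<in> F" for n d e
      using that unfolding F_iff by blast
  qed
  moreover have "UpClosedSeq F"
    unfolding UpClosedSeq_def range F_iff using a up unfolding UpClosed_def by blast
  ultimately have "FinGen (InRange F)" by (rule seqs[OF F])
  then show ?thesis unfolding FinGen_def range .
qed

lemma sets_finitely_generated_imp_WPO: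
  assumes sets: "\<And>U. U \<in> range \<sigma> \<Longrightarrow> UpClosed (\<lambda>d. d \<in> U) \<Longrightarrow> FinGen (\<lambda>d. d \<in> U)"
    and F: "F \<in> range \<sigma>" and seq: "DiagramSeq F"
  shows "Good F"
proof (rule ccontr)
  assume "\<not> Good F"
  then have bad: "\<not> LeD d e" if "i \<prec> j" "pair i d \<in> F" "pair j e \<in> F" for i j d e
    using that unfolding Good_def by blast
  note F_total = DiagramSeqD(1)[OF seq] and F_unique = DiagramSeqD(2)[OF seq]
    and F_diagram = DiagramSeqD(3)[OF seq]
  txt \<open>\<open>V\<close> consists of the indices at which a new largest element appears.\<close>
  define Rec where "Rec n \<longleftrightarrow> (\<exists>d x. pair n d \<in> F \<and> In x d \<and>
    (\<forall>m. m \<prec> n \<longrightarrow> (\<exists>e. pair m e \<in> F \<and> Bnd e x)))" for n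
  define V where "V = {n. Rec n}"
  have V: "V \<in> range \<sigma>"
    unfolding V_def
  proof (rule comprehension_set)
    show "S1 (\<lambda>v. Rec (v 0))"
      unfolding Rec_def by (intro S1_intros; intro D0_S1 D0_rules D0_Bnd F)
    show "S1 (\<lambda>v. \<exists>d. pair (v 0) d \<in> F \<and> (\<forall>x. x \<prec> d \<longrightarrow> In x d \<longrightarrow>
        (\<exists>m. m \<prec> v 0 \<and> (\<exists>e. pair m e \<in> F \<and> \<not> Bnd e x))))"
      by (intro S1_intros S1_ex_less; intro D0_S1 D0_rules D0_Bnd F)
    show "(\<exists>d. pair n d \<in> F \<and> (\<forall>x. x \<prec> d \<longrightarrow> In x d \<longrightarrow>
        (\<exists>m. m \<prec> n \<and> (\<exists>e. pair m e \<in> F \<and> \<not> Bnd e x)))) \<longleftrightarrow> \<not> Rec n" for n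
    proof -
      have "(\<exists>m. m \<prec> n \<and> (\<exists>e. pair m e \<in> F \<and> \<not> Bnd e x)) \<longleftrightarrow>
          \<not> (\<forall>m. m \<prec> n \<longrightarrow> (\<exists>e. pair m e \<in> F \<and> Bnd e x))" for x
        using F_total F_unique by blast
      then show ?thesis
        unfolding Rec_def using F_total[of n] F_unique[of n] In_less by blast
    qed
  qed
  \<comment> \<open>Choose \<open>M\<close> at least \<open>N\<close> and above all elements of the
    diagrams before \<open>K\<close>. The first diagram not bounded by \<open>M\<close> has its
    index at or after \<open>K\<close>, and its element \<open>x\<close> with
    \<open>M \<preceq> x\<close> exceeds everything earlier, so the index lies in
    \<open>V\<close>.\<close>
  have large: "\<exists>n d. n \<in> V \<and> K \<preceq> n \<and> pair n d \<in> F \<and> \<not> Bnd d N" for K N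
  proof -
    have "D0 (\<lambda>v. pair (v 0) (v 1) \<in> F)" by (intro D0_rules F)
    from D0_collection[OF this, of K]
    obtain b where b: "\<And>m. m \<prec> K \<Longrightarrow> \<exists>d. d \<preceq> b \<and> pair m d \<in> F"
      using F_total by blast
    define M where "M = b \<oplus> N"
    have early: "Bnd d M" if "m \<prec> K" "pair m d \<in> F" for m d
      using b[OF that(1)] that(2) F_unique Bnd_mono[OF Bnd_self] le_add_left arith.order_trans
      unfolding M_def by metis
    let ?A = "{n. \<exists>d. pair n d \<in> F \<and> \<not> Bnd d M}"
    have A: "?A \<in> range \<sigma>"
    proof (rule comprehension_set)
      show "S1 (\<lambda>v. \<exists>d. pair (v 0) d \<in> F \<and> \<not> Bnd d M)"
        by (intro S1_intros; intro D0_S1 D0_rules D0_Bnd F)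
      show "S1 (\<lambda>v. \<exists>d. pair (v 0) d \<in> F \<and> Bnd d M)"
        by (intro S1_intros; intro D0_S1 D0_rules D0_Bnd F)
    qed (use F_total F_unique in blast)
    \<comment> \<open>Otherwise all codes lie below a fixed number, and \<open>F\<close> would be an
      injection into a bounded interval, as a repeated term gives a good pair.\<close>
    have "?A \<noteq> {}"
    proof
      assume "?A = {}"
      then have all: "Bnd d M" if "pair n d \<in> F" for n d using that by blast
      obtain C where C: "\<And>d. FinCode d \<Longrightarrow> Bnd d M \<Longrightarrow> d \<preceq> C"
        using bounded_codes by blast
      show False
      proof (rule no_injection[OF F])
        show "\<exists>d. d \<prec> C \<oplus> \<one> \<and> pair n d \<in> F" for n
          using F_total[of n] C all F_diagram unfolding less_suc_le Diagram_def SeqCode_def by blast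
        show "i = j" if "pair i d \<in> F" "pair j d \<in> F" for i j d
          using bad that LeD_refl F_diagram less_linear' by blast
      qed
    qed
    then obtain n where n: "n \<in> ?A" and least: "\<And>m. m \<prec> n \<Longrightarrow> m \<notin> ?A"
      using least_member[OF A] by blast
    then obtain d where d: "pair n d \<in> F" "\<not> Bnd d M" by blast
    then obtain x where x: "In x d" "M \<preceq> x"
      unfolding Bnd_def by auto
    have "\<exists>e. pair m e \<in> F \<and> Bnd e x" if "m \<prec> n" for m
      using F_total[of m] least[OF that] Bnd_mono[OF _ x(2)] by blast
    then have "n \<in> V" unfolding V_def Rec_def using d(1) x(1) by blast
    moreover have "K \<preceq> n" using early d by (meson arith.not_less)
    moreover have "\<not> Bnd d N"
      using d(2) Bnd_mono unfolding M_def by (meson le_add_right)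
    ultimately show ?thesis using d(1) by blast
  qed
  have V_mono: "\<exists>x. In x d \<and> Bnd e x" if "n \<in> V" "m \<prec> n" "pair n d \<in> F" "pair m e \<in> F" for m n d e
    using that F_unique unfolding V_def Rec_def by blast
  let ?R = "\<lambda>e. Diagram e \<and> (\<exists>n d. n \<in> V \<and> pair n d \<in> F \<and> LeD d e)"
  \<comment> \<open>Once some index in \<open>V\<close> has a diagram with an element not below
    \<open>e\<close>, no diagram at a later index in \<open>V\<close> lies below \<open>e\<close>.
    So it suffices to examine the indices up to that one, which makes the complement
    Sigma01.\<close>
  let ?R' = "\<lambda>e. \<not> Diagram e \<or> (\<exists>n d. n \<in> V \<and> pair n d \<in> F \<and> \<not> Bnd d e \<and>
    (\<forall>m. m \<preceq> n \<longrightarrow> m \<in> V \<longrightarrow> (\<exists>d'. pair m d' \<in> F \<and> \<not> LeD d' e)))"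
  define U where "U = {e. ?R e}"
  have "?R' e \<longleftrightarrow> \<not> ?R e" for e
  proof
    assume R': "?R' e"
    show "\<not> ?R e"
    proof
      assume R: "?R e"
      then obtain m d' where m: "m \<in> V" "pair m d' \<in> F" "LeD d' e" by blast
      from R R' obtain n d where n: "n \<in> V" "pair n d \<in> F" "\<not> Bnd d e"
        and none: "\<And>m. m \<preceq> n \<Longrightarrow> m \<in> V \<Longrightarrow> \<exists>d'. pair m d' \<in> F \<and> \<not> LeD d' e" by blast
      have "\<not> m \<preceq> n" using none m F_unique by blast
      then have "n \<prec> m" by simp
      then obtain x where x: "In x d'" "Bnd d x" using V_mono m n by blast
      have "Bnd d' e" using Bnd_LeD m F_diagram Bnd_self by blast
      then have "x \<prec> e" using x(1) unfolding Bnd_def by blast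
      then show False using x(2) n(3) Bnd_mono arith.less_imp_le by blast
    qed
  next
    assume "\<not> ?R e"
    moreover obtain n d where "n \<in> V" "pair n d \<in> F" "\<not> Bnd d e" using large by blast
    ultimately show "?R' e" using F_total by blast
  qed
  then have U: "U \<in> range \<sigma>"
    unfolding U_def
    by (intro comprehension_set[of ?R ?R'])
      ((intro S1_intros; intro D0_S1 D0_rules D0_Diagram D0_LeD D0_Bnd F V),
       (intro S1_intros; intro D0_S1 D0_rules D0_Diagram D0_LeD D0_Bnd F V), blast)
  have "UpClosed (\<lambda>e. e \<in> U)"
    unfolding UpClosed_def U_def using LeD_trans by blast
  then obtain s where s: "\<And>d. In d s \<Longrightarrow> Diagram d" "\<And>e. InUcl e s \<longleftrightarrow> e \<in> U"
    using sets[OF U] unfolding FinGen_def by blast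
  \<comment> \<open>Each generator is related to the indices in \<open>V\<close> whose diagrams lie
    below it. Numbers outside \<open>s\<close> are related to every index, so that \<open>W\<close>
    is total and collection yields a bound \<open>b\<close>.\<close>
  obtain W where W: "W \<in> range \<sigma>"
    and W_iff: "\<And>x n. pair x n \<in> W \<longleftrightarrow> (In x s \<longrightarrow> n \<in> V \<and> (\<exists>d. pair n d \<in> F \<and> LeD d x))"
  proof (rule comprehension_rel)
    show "S1 (\<lambda>v. In (v 0) s \<longrightarrow> v 1 \<in> V \<and> (\<exists>d. pair (v 1) d \<in> F \<and> LeD d (v 0)))"
      by (intro S1_intros; intro D0_S1 D0_rules D0_LeD F V)
    show "S1 (\<lambda>v. In (v 0) s \<and> (v 1 \<notin> V \<or> (\<exists>d. pair (v 1) d \<in> F \<and> \<not> LeD d (v 0))))"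
      by (intro S1_intros; intro D0_S1 D0_rules D0_LeD F V)
    show "In x s \<and> (n \<notin> V \<or> (\<exists>d. pair n d \<in> F \<and> \<not> LeD d x)) \<longleftrightarrow>
        \<not> (In x s \<longrightarrow> n \<in> V \<and> (\<exists>d. pair n d \<in> F \<and> LeD d x))" for x n
      using F_total[of n] F_unique[of n] by blast
  qed blast
  have "\<exists>n. pair x n \<in> W" for x
    unfolding W_iff using s LeD_refl unfolding InUcl_def U_def by blast
  moreover have "D0 (\<lambda>v. pair (v 0) (v 1) \<in> W)" by (intro D0_rules W)
  ultimately obtain b where b: "\<And>x. x \<prec> s \<Longrightarrow> \<exists>n. n \<preceq> b \<and> pair x n \<in> W"
    using D0_collection[of "\<lambda>x n. pair x n \<in> W" s] by blast
  \<comment> \<open>A diagram with index in \<open>V\<close> beyond \<open>b\<close> lies above some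
    generator, hence above a diagram with index at most \<open>b\<close>, which is a good
    pair.\<close>
  obtain n d where n: "n \<in> V" "b \<oplus> \<one> \<preceq> n" "pair n d \<in> F"
    using large by blast
  then have "d \<in> U" unfolding U_def using F_diagram LeD_refl by blast
  then obtain x where x: "In x s" "LeD x d" using s(2) unfolding InUcl_def by blast
  then obtain m e where "m \<preceq> b" "pair m e \<in> F" "LeD e x"
    using b[OF In_less[OF x(1)]] unfolding W_iff by blast
  moreover from this have "m \<prec> n"
    using n(2) by (simp add: suc_le_iff arith.le_less_trans)
  ultimately show False using bad n(3) LeD_trans x(2) by blast
qed

lemma sat_equivalences:
  assumes "\<phi> \<in> {WPO_diagrams, ACC_upwardly_closed, ACC_finitely_generated,
      upwardly_closed_sets_fg, upwardly_closed_seqs_fg}"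
    and "\<psi> \<in> {WPO_diagrams, ACC_upwardly_closed, ACC_finitely_generated,
      upwardly_closed_sets_fg, upwardly_closed_seqs_fg}"
  shows "sat v \<tau> (\<phi> \<^bold>\<longleftrightarrow> \<psi>)"
proof -
  have 12: "sat v \<tau> WPO_diagrams \<Longrightarrow> sat v \<tau> ACC_upwardly_closed"
    unfolding sat_WPO sat_ACC Good_def[symmetric] using WPO_imp_ACC by blast
  have 23: "sat v \<tau> ACC_upwardly_closed \<Longrightarrow> sat v \<tau> ACC_finitely_generated"
    unfolding sat_ACC sat_ACC_finitely_generated by blast
  have 31: "sat v \<tau> ACC_finitely_generated \<Longrightarrow> sat v \<tau> WPO_diagrams"
    unfolding sat_WPO sat_ACC_finitely_generated Good_def[symmetric]
    using ACC_finitely_generated_imp_WPO by blast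
  have 15: "sat v \<tau> WPO_diagrams \<Longrightarrow> sat v \<tau> upwardly_closed_seqs_fg"
    unfolding sat_WPO sat_upwardly_closed_seqs_fg Good_def[symmetric]
    using WPO_imp_sequences_finitely_generated by blast
  have 54: "sat v \<tau> upwardly_closed_seqs_fg \<Longrightarrow> sat v \<tau> upwardly_closed_sets_fg"
    unfolding sat_upwardly_closed_sets_fg sat_upwardly_closed_seqs_fg
    using sequences_imp_sets_finitely_generated by blast
  have 41: "sat v \<tau> upwardly_closed_sets_fg \<Longrightarrow> sat v \<tau> WPO_diagrams"
    unfolding sat_WPO sat_upwardly_closed_sets_fg Good_def[symmetric]
    using sets_finitely_generated_imp_WPO by blast
  show ?thesis
    using assms 12 23 31 15 54 41 by auto
qed

end

theorem theorem2p6: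
  assumes "\<phi> \<in> {WPO_diagrams, ACC_upwardly_closed, ACC_finitely_generated,
      upwardly_closed_sets_fg, upwardly_closed_seqs_fg}"
    and "\<psi> \<in> {WPO_diagrams, ACC_upwardly_closed, ACC_finitely_generated,
      upwardly_closed_sets_fg, upwardly_closed_seqs_fg}"
  shows "RCA0 \<turnstile> \<phi> \<^bold>\<longleftrightarrow> \<psi>"
proof (rule ccontr)
  assume "\<not> (RCA0 \<turnstile> \<phi> \<^bold>\<longleftrightarrow> \<psi>)"
  then obtain zr on pl tm ls v and \<sigma> :: "nat \<Rightarrow> nat set" where
    model: "\<And>q w \<tau>. q \<in> RCA0 \<Longrightarrow> range \<tau> \<subseteq> range \<sigma>
      \<Longrightarrow> interpretation_data.sat zr on pl tm ls (range \<sigma>) w \<tau> q"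
    and "\<not> interpretation_data.sat zr on pl tm ls (range \<sigma>) v \<sigma> (\<phi> \<^bold>\<longleftrightarrow> \<psi>)"
    using completeness[OF _ RCA0_num_neq] by metis
  moreover have "rca0_model zr on pl tm ls \<sigma>"
    using model by unfold_locales
  ultimately show False
    using rca0_model.sat_equivalences[OF _ assms] by blast
qed

end
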